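(* Let $d\ge2$ and let $C\subset[0,1]^2$ be a Cantor set generated by a sequence $(n_k)$ with $n_{2k-1}\ge n_{2k}$ (construction in the context) which satisfies: $0<\mathcal H^1(C)<\infty$; the packing dimension of $C$ is strictly larger than $1$; and $m^1(\pi_+(C))=m^1(\pi_-(C))=0$, where $\pi_\pm$ are the orthogonal projections onto the lines $y=\pm x$. Write points of $C^{d-1}\subset\mathbb R^{2d-2}$ as $(v_1,a_1,\dots,v_{d-1},a_{d-1})$ with $(v_i,a_i)\in C$, and set $\mathbf v=(v_1,\dots,v_{d-1})$, $\mathbf a=(a_1,\dots,a_{d-1})$. Let $$\mathbb K_0=\bigcup_{(\mathbf v,\mathbf a)}\{(\mathbf a,0)+t(\mathbf v,1):t\in[0,1]\}\subset\mathbb R^d,$$ the union over all points of $C^{d-1}$. Then some finite union of rotated copies of $\mathbb K_0$ is a non-sticky Kakeya set in $\mathbb R^d$ of $d$-dimensional Lebesgue measure zero and Hausdorff dimension $d$.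
   Context: $\mathcal H^1$ is one-dimensional Hausdorff measure, $m^1$ one-dimensional Lebesgue measure. Construction of $C$: let $N_j=n_1+\dots+n_j$, $N_0=0$; squares are closed grid squares $[i4^{-N},(i+1)4^{-N}]\times[j4^{-N},(j+1)4^{-N}]$, and a column of width $4^{-N}$ is $[j4^{-N},(j+1)4^{-N}]\times[0,1]$. Let $C_0=\{[0,1]^2\}$. For $k\ge0$, given $C_{2k}$ (squares of side $4^{-N_{2k}}$): (i) each $Q\in C_{2k}$ is subdivided into $4^{2n_{2k+1}}$ squares of side $4^{-N_{2k+1}}$ and $2^{3n_{2k+1}}$ are chosen so that each column of width $4^{-N_{2k+1}}$ meeting the interior of $Q$ contains exactly $2^{n_{2k+1}}$ chosen squares inside $Q$; these form $C_{2k+1}$. (ii) Each square of $C_{2k+1}$ is subdivided into $4^{2n_{2k+2}}$ squares of side $4^{-N_{2k+2}}$ and $2^{n_{2k+2}}$ are chosen so that for each $Q\in C_{2k}$ every column of width $4^{-N_{2k+2}}$ meeting the interior of $Q$ contains at least one chosen square inside $Q$, and among the chosen squares inside $Q$ two have coinciding orthogonal projections onto $y=x$ and two have coinciding orthogonal projections onto $y=-x$; these form $C_{2k+2}$. Then $C=\bigcap_m C_m$ (unions of squares). A Kakeya set in $\mathbb R^d$ is a compact set containing a unit line segment in every direction. For $\mathbf v,\mathbf a\in\mathbb R^{d-1}$ let $L_{\mathbf v,\mathbf a}=\{(\mathbf a,0)+t(\mathbf v,1):t\in\mathbb R\}$; for a Kakeya set $\mathbb K$, $\mathcal A_{\mathbb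 K}=\{(\mathbf v,\mathbf a)\in\mathbb R^{2d-2}:L_{\mathbf v,\mathbf a}\cap\mathbb K\text{ contains a unit line segment}\}$, and $\mathbb K$ is non-sticky if the packing dimension of $\mathcal A_{\mathbb K}$ is strictly larger than $d-1$. *)

theory Defs
  imports "HOL-Analysis.Analysis"
begin

definition hausdorff_content :: "real \<Rightarrow> real \<Rightarrow> 'a::metric_space set \<Rightarrow> ennreal" where
  "hausdorff_content s \<delta> A =
     (INF U \<in> {U :: nat \<Rightarrow> 'a set. A \<subseteq> (\<Union>i. U i) \<and>
                 (\<forall>i. bounded (U i) \<and> diameter (U i) \<le> \<delta>)}.
        (\<Sum>i. ennreal (diameter (U i) powr s)))"

definition hausdorff_measure :: "real \<Rightarrow> 'a::metric_space set \<Rightarrow> ennreal" where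
  "hausdorff_measure s A = (SUP \<delta> \<in> {0<..}. hausdorff_content s \<delta> A)"

definition hausdorff_dim :: "'a::metric_space set \<Rightarrow> real" where
  "hausdorff_dim A = Inf {s. 0 \<le> s \<and> hausdorff_measure s A = 0}"

text \<open>delta-packing premeasure: supremum over (countable) families of pairwise disjoint
  closed balls with centres in A and radii at most delta of the sum of diam(B_i)^s.
  Radius 0 entries are dummies (they contribute 0 and are ignored for disjointness),
  which allows finite families.\<close>
definition packing_pre :: "real \<Rightarrow> real \<Rightarrow> 'a::metric_space set \<Rightarrow> ennreal" where
  "packing_pre s \<delta> A =
     (SUP xr \<in> {xr :: nat \<Rightarrow> 'a \<times> real.
                  (\<forall>i. 0 \<le> snd (xr i) \<and> snd (xr i) \<le> \<delta> \<and> (0 < snd (xr i) \<longrightarrow> fst (xr i) \<in> A)) \<and>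
                  (\<forall>i j. i \<noteq> j \<longrightarrow> 0 < snd (xr i) \<longrightarrow> 0 < snd (xr j) \<longrightarrow>
                      cball (fst (xr i)) (snd (xr i)) \<inter> cball (fst (xr j)) (snd (xr j)) = {})}.
        (\<Sum>i. ennreal (if snd (xr i) = 0 then 0 else (2 * snd (xr i)) powr s)))"

definition packing_premeasure :: "real \<Rightarrow> 'a::metric_space set \<Rightarrow> ennreal" where
  "packing_premeasure s A = (INF \<delta> \<in> {0<..}. packing_pre s \<delta> A)"

definition packing_measure :: "real \<Rightarrow> 'a::metric_space set \<Rightarrow> ennreal" where
  "packing_measure s A =
     (INF B \<in> {B :: nat \<Rightarrow> 'a set. A \<subseteq> (\<Union>i. B i)}. (\<Sum>i. packing_premeasure s (B i)))"

definition packing_dim :: "'a::metric_space set \<Rightarrow> real" where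
  "packing_dim A = Inf {s. 0 \<le> s \<and> packing_measure s A = 0}"

text \<open>n k for k \<ge> 1 is n_k (n 0 is unused); N j = n_1 + ... + n_j.\<close>
definition NN :: "(nat \<Rightarrow> nat) \<Rightarrow> nat \<Rightarrow> nat" where
  "NN n j = (\<Sum>i\<in>{1..j}. n i)"

definition grid_square :: "nat \<Rightarrow> nat \<times> nat \<Rightarrow> (real \<times> real) set" where
  "grid_square N ij = cbox (real (fst ij) / 4 ^ N, real (snd ij) / 4 ^ N)
                           (real (fst ij + 1) / 4 ^ N, real (snd ij + 1) / 4 ^ N)"

text \<open>Sub-squares (at level N + k) of the square with index q at level N.\<close>
definition subsquares :: "nat \<Rightarrow> nat \<times> nat \<Rightarrow> (nat \<times> nat) set" where
  "subsquares k q = {(i, j). i div 4 ^ k = fst q \<and> j div 4 ^ k = snd q}"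

text \<open>Cs m is the set of (indices of) chosen squares of C_m, of side 4^-(N_m).\<close>
definition cantor_construction :: "(nat \<Rightarrow> nat) \<Rightarrow> (nat \<Rightarrow> (nat \<times> nat) set) \<Rightarrow> bool" where
  "cantor_construction n Cs \<longleftrightarrow>
     Cs 0 = {(0, 0)} \<and>
     (\<forall>k. Cs (2*k+1) \<subseteq> (\<Union>q\<in>Cs (2*k). subsquares (n (2*k+1)) q) \<and>
          (\<forall>q\<in>Cs (2*k). \<forall>c. c div 4 ^ n (2*k+1) = fst q \<longrightarrow>
               card {p \<in> Cs (2*k+1) \<inter> subsquares (n (2*k+1)) q. fst p = c} = 2 ^ n (2*k+1))) \<and>
     (\<forall>k. Cs (2*k+2) \<subseteq> (\<Union>q\<in>Cs (2*k+1). subsquares (n (2*k+2)) q) \<and>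
          (\<forall>q\<in>Cs (2*k+1). card (Cs (2*k+2) \<inter> subsquares (n (2*k+2)) q) = 2 ^ n (2*k+2)) \<and>
          (\<forall>q\<in>Cs (2*k).
             let S = Cs (2*k+2) \<inter> subsquares (n (2*k+1) + n (2*k+2)) q in
             (\<forall>c. c div 4 ^ (n (2*k+1) + n (2*k+2)) = fst q \<longrightarrow> (\<exists>p\<in>S. fst p = c)) \<and>
             (\<exists>p\<in>S. \<exists>p'\<in>S. p \<noteq> p' \<and> int (fst p) + int (snd p) = int (fst p') + int (snd p')) \<and>
             (\<exists>p\<in>S. \<exists>p'\<in>S. p \<noteq> p' \<and> int (fst p) - int (snd p) = int (fst p') - int (snd p'))))"

definition cantor_set :: "(nat \<Rightarrow> nat) \<Rightarrow> (nat \<Rightarrow> (nat \<times> nat) set) \<Rightarrow> (real \<times> real) set" where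
  "cantor_set n Cs = (\<Inter>m. \<Union>q\<in>Cs m. grid_square (NN n m) q)"

text \<open>Orthogonal projections onto the lines y = x and y = -x (arc-length coordinate).\<close>
definition proj_plus :: "real \<times> real \<Rightarrow> real" where
  "proj_plus p = (fst p + snd p) / sqrt 2"

definition proj_minus :: "real \<times> real \<Rightarrow> real" where
  "proj_minus p = (fst p - snd p) / sqrt 2"

text \<open>R^d is modelled as real^('m option), with coordinate None the last one;
  R^(d-1) is real^'m, so d = CARD('m) + 1 \<ge> 2.\<close>
definition lift_pt :: "real^'m \<Rightarrow> real \<Rightarrow> real^('m::finite option)" where
  "lift_pt a t = (\<chi> i. case i of None \<Rightarrow> t | Some j \<Rightarrow> a $ j)"

definition line_va :: "real^'m::finite \<Rightarrow> real^'m \<Rightarrow> (real^('m option)) set" where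
  "line_va v a = {lift_pt a 0 + t *\<^sub>R lift_pt v 1 | t. True}"

definition kakeya_set :: "'a::euclidean_space set \<Rightarrow> bool" where
  "kakeya_set K \<longleftrightarrow> compact K \<and>
     (\<forall>e. norm e = 1 \<longrightarrow> (\<exists>x. closed_segment x (x + e) \<subseteq> K))"

definition contains_unit_segment :: "'a::euclidean_space set \<Rightarrow> bool" where
  "contains_unit_segment S \<longleftrightarrow> (\<exists>x y. dist x y = 1 \<and> closed_segment x y \<subseteq> S)"

definition A_set :: "(real^('m::finite option)) set \<Rightarrow> ((real^'m) \<times> (real^'m)) set" where
  "A_set K = {(v, a). contains_unit_segment (line_va v a \<inter> K)}"

definition non_sticky :: "(real^('m::finite option)) set \<Rightarrow> bool" where
  "non_sticky K \<longleftrightarrow> packing_dim (A_set K) > real CARD('m)"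

definition K0 :: "(real \<times> real) set \<Rightarrow> (real^('m::finite option)) set" where
  "K0 C = (\<Union>(v, a) \<in> {(v, a). \<forall>i. (v $ i, a $ i) \<in> C}.
             {lift_pt a 0 + t *\<^sub>R lift_pt v 1 | t. t \<in> {0..1}})"

definition rotation :: "(real^'n::finite \<Rightarrow> real^'n) \<Rightarrow> bool" where
  "rotation \<rho> \<longleftrightarrow> orthogonal_transformation \<rho> \<and> det (matrix \<rho>) = 1"

end

(*
  The slice of K_0 at height t is the (d-1)-fold product of C_t = {a + t v | (v,a) in C}, so K_0 is a
  null set once C_t is null for almost every t. This is Besicovitch's projection theorem for C: in the
  coordinates v + a and v - a the set C lies in a product of two null sets, so it meets every Lipschitz
  graph in a set of length zero. For almost every t, H^1-almost every point of C that contributes to C_t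
  has thin cones in direction t of arbitrarily small relative mass (by density of the directions in which
  the mass of strips is bounded and no other nearby point is met), and a set of such points is, up to a
  small proportion at every scale, a Lipschitz graph, hence null.

  Since every column of the construction is hit, C contains the graph of a Borel function g on [0,1].
  The map (v,t) -> (g(v) + t v, t) sends Lebesgue measure to a measure on K_0 whose small balls have
  mass about r^d up to an arbitrarily small loss in the exponent, which gives dimension d. The same
  surjectivity makes the set of lines project onto the product of C and a cube, and packings of C are
  thickened by grids, with Baire's theorem taking care of countable covers; thus the packing dimension
  exceeds d - 1. Finitely many rotations of the cone of directions (v,1) cover the sphere by compactness.
*)
theory Submission
  imports Defs
begin

section \<open>Hausdorff measure on the Borel sets\<close>

text \<open>Null projections in two directions must give null projections in almost every direction.
  For fixed \<open>t\<close> there are two kinds of exceptions. Values \<open>y\<close> with an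
  infinite fibre, or with strips of unbounded mass-to-width ratio, are negligible on the line
  itself. Every other point of \<open>C\<close> is \<open>regular\<close> for some \<open>k\<close>;
  by Fubini in \<open>(p, t)\<close>, for almost every \<open>t\<close> almost every regular point
  is \<open>sparse\<close>, and sparse points are \<open>mu\<close>-null for each \<open>t\<close>
  in \<open>{0..1}\<close>, because strips of too little mass would cover a dense piece of them.
  Null sets of points then have negligible projections since \<open>proj t\<close> is Lipschitz.
  Measurability shapes the definitions: radii range over rationals and apertures are
  \<open>1 / real (j+1)\<close>, so that Fubini meets Borel sets, while sets on the line are merely
  enclosed in Borel sets, mostly through the single Vitali estimate
  \<open>vitali_measure_bound\<close>. The factors 10000 and 280000 only have to be large enough for
  the last comparison, 3/10 against 1/2. For both dimensions a strict gap in the exponent absorbs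
  all losses: any \<open>s1\<close> between 1 and the packing dimension of \<open>C\<close>, and any
  \<open>s\<close> below \<open>d\<close>.\<close>

lemma hausdorff_content_mono:
  "A \<subseteq> B \<Longrightarrow> hausdorff_content s \<delta> A \<le> hausdorff_content s \<delta> B"
  unfolding hausdorff_content_def by (rule INF_superset_mono) auto

lemma hausdorff_content_antimono:
  "\<delta> \<le> \<delta>' \<Longrightarrow> hausdorff_content s \<delta>' A \<le> hausdorff_content s \<delta> A"
  unfolding hausdorff_content_def by (rule INF_superset_mono) (auto intro: order_trans)

lemma hausdorff_content_le_measure:
  "0 < \<delta> \<Longrightarrow> hausdorff_content s \<delta> A \<le> hausdorff_measure s A"
  unfolding hausdorff_measure_def by (rule SUP_upper) auto

lemma hausdorff_measure_mono:
  "A \<subseteq> B \<Longrightarrow> hausdorff_measure s A \<le> hausdorff_measure s B"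
  unfolding hausdorff_measure_def by (intro SUP_mono) (blast intro: hausdorff_content_mono)

lemma hausdorff_content_le_suminf:
  assumes "A \<subseteq> (\<Union>i. U i)" "\<And>i. bounded (U i)" "\<And>i. diameter (U i) \<le> \<delta>"
  shows "hausdorff_content s \<delta> A \<le> (\<Sum>i. ennreal (diameter (U i) powr s))"
  unfolding hausdorff_content_def by (rule INF_lower) (use assms in auto)

lemma hausdorff_content_cover:
  assumes "hausdorff_content s \<delta> A < c"
  obtains U where "A \<subseteq> (\<Union>i. U i)" "\<And>i. bounded (U i)" "\<And>i. diameter (U i) \<le> \<delta>"
    "(\<Sum>i. ennreal (diameter (U i) powr s)) < c"
  using assms unfolding hausdorff_content_def INF_less_iff by auto

lemma hausdorff_measure_empty [simp]: "hausdorff_measure s {} = 0"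
proof -
  have "hausdorff_content s \<delta> {} = 0" if "\<delta> > 0" for \<delta> :: real
    using hausdorff_content_le_suminf[of "{}" "\<lambda>_. {}" \<delta> s] that by simp
  then have "hausdorff_measure s {} \<le> 0"
    unfolding hausdorff_measure_def by (intro SUP_least) auto
  then show ?thesis by simp
qed

lemma suminf_ennreal_add_geometric:
  fixes a :: "nat \<Rightarrow> ennreal"
  assumes "0 < e"
  shows "(\<Sum>n. a n + ennreal (e * (1/2) ^ Suc n)) = (\<Sum>n. a n) + ennreal e"
proof -
  have "(\<Sum>n. ennreal (e * (1/2) ^ Suc n)) = (\<Sum>n. ennreal e * ennreal ((1/2) ^ Suc n))"
    using assms by (intro suminf_cong ennreal_mult) auto
  also have "\<dots> = ennreal e"
    unfolding ennreal_suminf_cmult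
    by (subst suminf_ennreal_eq[OF zero_le_power power_half_series]) auto
  finally show ?thesis
    by (subst suminf_add[symmetric]) auto
qed

lemma hausdorff_content_UN:
  "hausdorff_content s \<delta> (\<Union>n. A n) \<le> (\<Sum>n. hausdorff_content s \<delta> (A n))"
proof (rule ennreal_le_epsilon)
  fix e :: real assume e: "0 < e" and fin: "(\<Sum>n. hausdorff_content s \<delta> (A n)) < top"
  have "\<exists>U. A n \<subseteq> (\<Union>i. U i) \<and> (\<forall>i. bounded (U i) \<and> diameter (U i) \<le> \<delta>) \<and>
      (\<Sum>i. ennreal (diameter (U i) powr s)) < hausdorff_content s \<delta> (A n) + ennreal (e * (1/2)^Suc n)" for n
  proof -
    \<comment> \<open>Finiteness is what makes adding a positive amount strict, so that a
      near-optimal cover exists.\<close>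
    have "hausdorff_content s \<delta> (A n) < top"
      using fin by (auto simp: less_top dest!: ennreal_suminf_lessD)
    then have "hausdorff_content s \<delta> (A n) < hausdorff_content s \<delta> (A n) + ennreal (e * (1/2)^Suc n)"
      using e by (auto simp: less_top)
    then show ?thesis
      by (metis hausdorff_content_cover)
  qed
  then obtain U where U: "\<And>n. A n \<subseteq> (\<Union>i. U n i)" "\<And>n i. bounded (U n i) \<and> diameter (U n i) \<le> \<delta>"
      "\<And>n. (\<Sum>i. ennreal (diameter (U n i) powr s)) < hausdorff_content s \<delta> (A n) + ennreal (e * (1/2)^Suc n)"
    by metis
  define V where "V = case_prod U \<circ> prod_decode"
  have "(\<Union>n. A n) \<subseteq> (\<Union>i. V i)"
    using U(1) by (auto simp: V_def subset_eq) (metis prod.case prod_encode_inverse)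
  then have "hausdorff_content s \<delta> (\<Union>n. A n) \<le> (\<Sum>i. ennreal (diameter (V i) powr s))"
    by (rule hausdorff_content_le_suminf) (use U(2) in \<open>auto simp: V_def split: prod.split\<close>)
  also have "\<dots> = (\<Sum>n. \<Sum>i. ennreal (diameter (U n i) powr s))"
    unfolding V_def comp_def
    by (rule suminf_ennreal_2dimen[where f = "\<lambda>p. ennreal (diameter (case_prod U p) powr s)"]) simp
  also have "\<dots> \<le> (\<Sum>n. hausdorff_content s \<delta> (A n) + ennreal (e * (1/2)^Suc n))"
    by (intro suminf_le less_imp_le U(3)) auto
  also have "\<dots> = (\<Sum>n. hausdorff_content s \<delta> (A n)) + ennreal e"
    by (rule suminf_ennreal_add_geometric[OF e])
  finally show "hausdorff_content s \<delta> (\<Union>n. A n) \<le> (\<Sum>n. hausdorff_content s \<delta> (A n)) + ennreal e" .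
qed

lemma hausdorff_measure_UN:
  "hausdorff_measure s (\<Union>n. A n) \<le> (\<Sum>n. hausdorff_measure s (A n))"
  unfolding hausdorff_measure_def[of s "\<Union>n. A n"]
proof (rule SUP_least)
  fix \<delta> :: real assume "\<delta> \<in> {0<..}"
  then show "hausdorff_content s \<delta> (\<Union>n. A n) \<le> (\<Sum>n. hausdorff_measure s (A n))"
    by (intro order_trans[OF hausdorff_content_UN] suminf_le)
       (auto intro: hausdorff_content_le_measure)
qed

lemma hausdorff_measure_Un:
  "hausdorff_measure s (A \<union> B) \<le> hausdorff_measure s A + hausdorff_measure s B"
proof -
  have "hausdorff_measure s (A \<union> B) \<le> (\<Sum>n. hausdorff_measure s (binaryset A B n))"
    using hausdorff_measure_UN[of s "binaryset A B"] by (simp add: UN_binaryset_eq)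
  also have "\<dots> = hausdorff_measure s A + hausdorff_measure s B"
    by (rule suminf_binaryset_eq) simp
  finally show ?thesis .
qed

text \<open>A covering set of diameter at most \<delta> cannot meet both sets, so any cover of the
  union splits into two covers that share no member.\<close>

lemma hausdorff_content_Un_separated:
  fixes A B :: "'a::metric_space set"
  assumes sep: "\<And>x y. x \<in> A \<Longrightarrow> y \<in> B \<Longrightarrow> \<delta> < dist x y" and "0 \<le> \<delta>"
  shows "hausdorff_content s \<delta> A + hausdorff_content s \<delta> B \<le> hausdorff_content s \<delta> (A \<union> B)"
  unfolding hausdorff_content_def[of s \<delta> "A \<union> B"]
proof (rule INF_greatest)
  fix U :: "nat \<Rightarrow> 'a set"
  assume "U \<in> {U. A \<union> B \<subseteq> (\<Union>i. U i) \<and> (\<forall>i. bounded (U i) \<and> diameter (U i) \<le> \<delta>)}"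
  then have U: "A \<union> B \<subseteq> (\<Union>i. U i)" "\<And>i. bounded (U i)" "\<And>i. diameter (U i) \<le> \<delta>"
    by auto
  \<comment> \<open>Discarded members become empty; as \<open>0 powr s = 0\<close> even for
    \<open>s = 0\<close>, they cost nothing.\<close>
  define V where "V = (\<lambda>i. if U i \<inter> A = {} then {} else U i)"
  define W where "W = (\<lambda>i. if U i \<inter> B = {} then {} else U i)"
  have VW: "V i = {} \<or> W i = {}" for i
  proof (rule ccontr)
    assume "\<not> (V i = {} \<or> W i = {})"
    then obtain x y where "x \<in> U i" "x \<in> A" "y \<in> U i" "y \<in> B"
      by (auto simp: V_def W_def split: if_splits)
    then show False
      using diameter_bounded_bound[OF U(2)[of i]] U(3)[of i] sep[of x y] by fastforce
  qed
  have "hausdorff_content s \<delta> A + hausdorff_content s \<delta> B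
      \<le> (\<Sum>i. ennreal (diameter (V i) powr s)) + (\<Sum>i. ennreal (diameter (W i) powr s))"
    using U \<open>0 \<le> \<delta>\<close>
    by (intro add_mono hausdorff_content_le_suminf) (fastforce simp: V_def W_def)+
  also have "\<dots> = (\<Sum>i. ennreal (diameter (V i) powr s) + ennreal (diameter (W i) powr s))"
    by (rule suminf_add) auto
  also have "\<dots> \<le> (\<Sum>i. ennreal (diameter (U i) powr s))"
  proof (intro suminf_le allI)
    fix i
    show "ennreal (diameter (V i) powr s) + ennreal (diameter (W i) powr s) \<le> ennreal (diameter (U i) powr s)"
      using VW[of i] by (auto simp: V_def W_def simp del: Int_emptyI split: if_splits)
  qed auto
  finally show "hausdorff_content s \<delta> A + hausdorff_content s \<delta> B
      \<le> (\<Sum>i. ennreal (diameter (U i) powr s))" .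
qed

text \<open>Contents grow as the scale shrinks, so two arbitrary scales can both be lowered to a
  common one below the separation.\<close>

lemma hausdorff_measure_Un_separated:
  fixes A B :: "'a::metric_space set"
  assumes sep: "\<And>x y. x \<in> A \<Longrightarrow> y \<in> B \<Longrightarrow> \<delta> < dist x y" and "0 < \<delta>"
  shows "hausdorff_measure s (A \<union> B) = hausdorff_measure s A + hausdorff_measure s B"
proof (rule antisym[OF hausdorff_measure_Un])
  have "hausdorff_measure s A + hausdorff_measure s B =
     (SUP \<epsilon> \<in> {0<..}. hausdorff_content s \<epsilon> A) + (SUP \<epsilon> \<in> {0<..}. hausdorff_content s \<epsilon> B)"
    by (simp add: hausdorff_measure_def)
  also have "\<dots> \<le> hausdorff_measure s (A \<union> B)"
  proof -
    have "hausdorff_content s a A + hausdorff_content s b B \<le> hausdorff_measure s (A \<union> B)"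
      if ab: "a \<in> {0<..}" "b \<in> {0<..}" for a b :: real
    proof -
    define c where "c = min \<delta> (min a b)"
    have c: "c > 0" "c \<le> \<delta>" "c \<le> a" "c \<le> b" using ab \<open>0 < \<delta>\<close> by (auto simp: c_def)
    have "hausdorff_content s a A + hausdorff_content s b B
        \<le> hausdorff_content s c A + hausdorff_content s c B"
      using c by (intro add_mono hausdorff_content_antimono)
    also have "\<dots> \<le> hausdorff_content s c (A \<union> B)"
      using sep c by (intro hausdorff_content_Un_separated) fastforce+
    also have "\<dots> \<le> hausdorff_measure s (A \<union> B)"
      using c by (intro hausdorff_content_le_measure)
    finally show ?thesis .
    qed
    then have "hausdorff_content s a A + (SUP b\<in>{0<..}. hausdorff_content s b B) \<le> hausdorff_measure s (A \<union> B)"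
      if "a \<in> {0<..}" for a :: real
      using that by (subst ennreal_SUP_add_right) (auto intro!: SUP_least)
    then show ?thesis
      by (subst ennreal_SUP_add_left[symmetric]) (auto intro!: SUP_least)
  qed
  finally show "hausdorff_measure s A + hausdorff_measure s B \<le> hausdorff_measure s (A \<union> B)" .
qed

text \<open>The gap may depend on \<open>n\<close>: the induction only separates each new set from
  the finitely many earlier ones. This suits shells that accumulate at a closed set.\<close>

lemma hausdorff_measure_separated_chain:
  fixes D :: "nat \<Rightarrow> 'a::metric_space set"
  assumes sep: "\<And>n. \<exists>\<delta>>0. \<forall>m<n. \<forall>x\<in>D m. \<forall>y\<in>D n. \<delta> < dist x y"
  shows "(\<Sum>i<N. hausdorff_measure s (D i)) = hausdorff_measure s (\<Union>i<N. D i)"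
proof (induction N)
  case (Suc N)
  obtain \<delta> where "\<delta> > 0" "\<forall>m<N. \<forall>x\<in>D m. \<forall>y\<in>D N. \<delta> < dist x y"
    using sep by blast
  then have "hausdorff_measure s ((\<Union>i<N. D i) \<union> D N) = hausdorff_measure s (\<Union>i<N. D i) + hausdorff_measure s (D N)"
    by (intro hausdorff_measure_Un_separated[of _ _ \<delta>]) auto
  then show ?case
    using Suc by (simp add: lessThan_Suc Un_commute)
qed simp

text \<open>Caratheodory's criterion: the shells around \<open>F\<close> with indices of equal parity are separated,
  so their measures are summable and the part of \<open>A\<close> close to \<open>F\<close> is negligible.\<close>

lemma hausdorff_measure_closed_split:
  fixes F A :: "'a::metric_space set"
  assumes "closed F"
  shows "hausdorff_measure s (A \<inter> F) + hausdorff_measure s (A - F) \<le> hausdorff_measure s A"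
proof (cases "F = {} \<or> hausdorff_measure s A = top")
  case True
  then show ?thesis
    by auto
next
  case False
  then have F: "F \<noteq> {}" and fin: "hausdorff_measure s A < top"
    by (auto simp: less_top)
  define H :: "'a set \<Rightarrow> ennreal" where "H = hausdorff_measure s"
  define d where "d = (\<lambda>x::'a. infdist x F)"
  define An where "An = (\<lambda>n::nat. {x \<in> A. 1 / real (n+1) \<le> d x})"
  define D where "D = (\<lambda>n::nat. {x \<in> A. 1 / real (n+2) \<le> d x \<and> d x < 1 / real (n+1)})"
  define S where "S = (SUP n. H (An n))"
  have d_lip: "d x \<le> d y + dist x y" for x y
    unfolding d_def by (rule infdist_triangle)
  have dpos: "d x > 0" if "x \<notin> F" for x
    using that assms F by (simp add: d_def infdist_pos_not_in_closed)
  have dzero: "d x = 0" if "x \<in> F" for x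
    using that by (simp add: d_def)
  have AnS: "H (An n) \<le> S" for n
    unfolding S_def by (rule SUP_upper) auto
  have An_add: "H (A \<inter> F) + H (An n) \<le> H A" for n
  proof -
    have "H (A \<inter> F) + H (An n) = H ((A \<inter> F) \<union> An n)"
      unfolding H_def
    proof (rule hausdorff_measure_Un_separated[symmetric, where \<delta> = "1 / real (n+2)"])
      fix x y assume "x \<in> A \<inter> F" "y \<in> An n"
      moreover have "1 / real (n+2) < 1 / real (n+1)" by (simp add: field_simps)
      ultimately show "1 / real (n+2) < dist x y"
        using d_lip[of y x] dzero[of x] by (auto simp: An_def dist_commute)
    qed simp
    also have "\<dots> \<le> H A"
      unfolding H_def by (rule hausdorff_measure_mono) (auto simp: An_def)
    finally show ?thesis .
  qed
  have S_fin: "S < top"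
  proof -
    have "S \<le> H A"
      unfolding S_def by (intro SUP_least hausdorff_measure_mono[of _ A s, folded H_def]) (auto simp: An_def)
    then show ?thesis using fin by (auto simp: H_def)
  qed
  have shell: "(\<Sum>i<N. H (D (2*i+c))) \<le> S" for N c
  proof -
    have "(\<Sum>i<N. H (D (2*i+c))) = H (\<Union>i<N. D (2*i+c))"
      unfolding H_def
    proof (rule hausdorff_measure_separated_chain)
      fix n
      \<comment> \<open>The thickness of the skipped shell \<open>2*n+c-1\<close>. For
        \<open>n = 0\<close> there is no earlier shell, and with \<open>c = 0\<close> the convention
        \<open>1 / 0 = 0\<close> would even make this negative; hence the case split.\<close>
      define e where "e = 1 / real (2*n+c) - 1 / real (2*n+c+1)"
      show "\<exists>\<delta>>0. \<forall>m<n. \<forall>x\<in>D (2*m+c). \<forall>y\<in>D (2*n+c). \<delta> < dist x y"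
      proof (cases "n = 0")
        case False
        then have e: "e > 0"
          unfolding e_def diff_gt_0_iff_gt by (intro divide_strict_left_mono) auto
        moreover have "e < dist x y" if "m < n" "x \<in> D (2*m+c)" "y \<in> D (2*n+c)" for m x y
        proof -
          have "1 / real (2*m+c+2) \<le> d x" "d y < 1 / real (2*n+c+1)"
            using that by (auto simp: D_def)
          moreover have "1 / real (2*n+c) \<le> 1 / real (2*m+c+2)"
            using that(1) by (intro divide_left_mono) auto
          ultimately show ?thesis
            using d_lip[of x y] unfolding e_def by linarith
        qed
        ultimately show ?thesis by blast
      qed (auto intro: exI[of _ 1])
    qed
    also have "\<dots> \<le> H (An (2*N+c))"
      unfolding H_def
    proof (rule hausdorff_measure_mono, safe)
      fix i x assume "i < N" "x \<in> D (2*i+c)"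
      moreover have "1 / real (2*N+c+1) \<le> 1 / real (2*i+c+2)"
        using \<open>i < N\<close> by (intro divide_left_mono) auto
      ultimately show "x \<in> An (2*N+c)"
        by (auto simp: D_def An_def)
    qed
    also have "\<dots> \<le> S" by (rule AnS)
    finally show ?thesis .
  qed
  have tot: "(\<Sum>i<N. H (D i)) \<le> S + S" for N
  proof -
    have "(\<Sum>i<N. H (D i)) \<le> (\<Sum>i<2*N. H (D i))"
      by (rule sum_mono2) auto
    also have "\<dots> = (\<Sum>i<N. H (D (2*i+0))) + (\<Sum>i<N. H (D (2*i+1)))"
      by (induction N) (auto simp: algebra_simps)
    also have "\<dots> \<le> S + S"
      by (intro add_mono shell)
    finally show ?thesis .
  qed
  have sumfin: "(\<Sum>i. H (D i)) < top"
  proof -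
    have "(\<Sum>i. H (D i)) \<le> S + S"
      by (rule suminf_le_const) (auto intro: tot)
    then show ?thesis
      using S_fin by (auto simp: less_top[symmetric] top_unique)
  qed
  \<comment> \<open>Points outside \<open>An n\<close> lie in shells of index at least
    \<open>n\<close>, whose total measure is the tail of a convergent series.\<close>
  have AF: "H (A - F) \<le> S + (\<Sum>i. H (D (i + n)))" for n
  proof -
    have "A - F \<subseteq> An n \<union> (\<Union>i. D (i+n))"
    proof
      fix x assume x: "x \<in> A - F"
      then have pos: "d x > 0" using dpos by auto
      show "x \<in> An n \<union> (\<Union>i. D (i+n))"
      proof (cases "1 / real (n+1) \<le> d x")
        case False
        define P where "P = (\<lambda>k::nat. 1 / real (k+1) \<le> d x)"
        have ex: "\<exists>k. P k"
          using reals_Archimedean[OF pos] by (auto simp: P_def inverse_eq_divide intro: less_imp_le)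
        define k where "k = (LEAST k. P k)"
        have Pk: "P k" unfolding k_def using ex by (rule LeastI_ex)
        have nPn: "\<not> P n" using False by (simp add: P_def)
        have anti: "P j" if "P i" "i \<le> j" for i j
        proof -
          have "1 / real (j+1) \<le> 1 / real (i+1)" using that(2) by (intro divide_left_mono) auto
          then show ?thesis using that(1) by (simp add: P_def)
        qed
        have "n < k" using nPn Pk anti by (meson not_le_imp_less)
        then obtain j where j: "k = j + n + 1"
          by (metis Suc_eq_plus1 add.commute less_natE)
        have "\<not> P (j+n)" unfolding k_def using not_less_Least[of "j+n" P] j k_def by auto
        then have "x \<in> D (j+n)"
          using x Pk j by (auto simp: P_def D_def algebra_simps)
        then show ?thesis by blast
      qed (use x in \<open>auto simp: An_def\<close>)
    qed
    then have "H (A - F) \<le> H (An n) + H (\<Union>i. D (i+n))"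
      unfolding H_def by (meson hausdorff_measure_mono hausdorff_measure_Un order_trans)
    also have "\<dots> \<le> S + (\<Sum>i. H (D (i + n)))"
      by (intro add_mono AnS) (simp add: H_def hausdorff_measure_UN)
    finally show ?thesis .
  qed
  have "(\<lambda>n. S + (\<Sum>i. H (D (i + n)))) \<longlonglongrightarrow> S + 0"
  proof (intro tendsto_add tendsto_const)
    have eq: "H (D i) = ennreal (enn2real (H (D i)))" for i
      using ennreal_suminf_lessD[OF sumfin, of i] by simp
    have "summable (\<lambda>i. enn2real (H (D i)))"
      by (rule summable_suminf_not_top) (use sumfin eq in auto)
    then have "(\<lambda>n. ennreal (\<Sum>i. enn2real (H (D (i + n))))) \<longlonglongrightarrow> ennreal 0"
      by (intro tendsto_ennrealI suminf_exist_split2)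
    moreover have "ennreal (\<Sum>i. enn2real (H (D (i + n)))) = (\<Sum>i. H (D (i + n)))" for n
    proof -
      have "(\<Sum>i. H (D (i + n))) = (\<Sum>i. ennreal (enn2real (H (D (i + n)))))"
        by (intro suminf_cong eq)
      also have "\<dots> = ennreal (\<Sum>i. enn2real (H (D (i + n))))"
        by (intro suminf_ennreal2 summable_ignore_initial_segment \<open>summable (\<lambda>i. enn2real (H (D i)))\<close>) auto
      finally show ?thesis ..
    qed
    ultimately show "(\<lambda>n. \<Sum>i. H (D (i + n))) \<longlonglongrightarrow> 0" by simp
  qed
  then have "H (A - F) \<le> S"
    using AF by (intro LIMSEQ_le_const[where X="\<lambda>n. S + (\<Sum>i. H (D (i + n)))"]) auto
  then have "H (A \<inter> F) + H (A - F) \<le> H (A \<inter> F) + S"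
    by (rule add_left_mono)
  also have "\<dots> = (SUP n. H (A \<inter> F) + H (An n))"
    unfolding S_def by (rule ennreal_SUP_add_right) auto
  also have "\<dots> \<le> H A"
    by (rule SUP_least) (rule An_add)
  finally show ?thesis by (simp add: H_def)
qed

text \<open>\<open>measure_of\<close> falls back to the zero measure when countable additivity
  fails, so the definition gets its content only from
  \<open>emeasure_hausdorff_borel\<close>.\<close>

definition hausdorff_borel :: "real \<Rightarrow> 'a::metric_space measure" where
  "hausdorff_borel s = measure_of UNIV (sets borel) (hausdorff_measure s)"

lemma sets_hausdorff_borel [simp, measurable_cong]: "sets (hausdorff_borel s) = sets borel"
  unfolding hausdorff_borel_def by (simp add: sets_measure_of_conv sigma_algebra.sigma_sets_eq[OF sets.sigma_algebra_axioms[of borel, simplified]])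

lemma space_hausdorff_borel [simp]: "space (hausdorff_borel s) = UNIV"
  unfolding hausdorff_borel_def by (simp add: space_measure_of_conv)

text \<open>Closed sets split every set additively, so they belong to the Caratheodory sigma-algebra
  \<open>?L\<close>, which then contains all Borel sets.\<close>

lemma emeasure_hausdorff_borel:
  fixes A :: "'a::metric_space set"
  assumes "A \<in> sets borel"
  shows "emeasure (hausdorff_borel s) A = hausdorff_measure s A"
proof -
  let ?H = "hausdorff_measure s :: 'a set \<Rightarrow> ennreal"
  let ?L = "lambda_system UNIV UNIV ?H"
  interpret P: sigma_algebra UNIV "UNIV :: 'a set set"
    by (metis Pow_UNIV sigma_algebra_Pow)
  have om: "outer_measure_space UNIV ?H"
    unfolding outer_measure_space_def positive_def increasing_def countably_subadditive_def
    by (auto intro: hausdorff_measure_mono hausdorff_measure_UN)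
  have ms: "measure_space UNIV ?L ?H"
    by (rule P.caratheodory_lemma[OF om])
  then interpret L: sigma_algebra UNIV ?L
    by (simp add: measure_space_def)
  have "F \<in> ?L" if "closed F" for F
    unfolding P.lambda_system_eq
    using hausdorff_measure_closed_split[OF that, of s] hausdorff_measure_Un[of s "x \<inter> F" "x - F" for x]
    by (auto intro!: antisym simp: Int_Diff_Un)
  then have "sigma_sets UNIV (Collect closed) \<subseteq> ?L"
    by (intro L.sigma_sets_subset) auto
  moreover have sb: "sets (borel :: 'a measure) = sigma_sets UNIV (Collect closed)"
    unfolding borel_eq_closed by (simp add: sets_measure_of_conv)
  ultimately have "sets borel \<subseteq> ?L" by simp
  then have "measure_space UNIV (sets borel) ?H"
    by (intro measure_down[OF ms] sets.sigma_algebra_axioms[of borel, simplified])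
  then show ?thesis
    unfolding hausdorff_borel_def
    by (intro emeasure_measure_of_sigma) (use assms in \<open>auto simp: measure_space_def\<close>)
qed

section \<open>Covering arguments on the line\<close>

text \<open>Vitali's covering lemma picks disjoint balls whose fivefold enlargements cover
  \<open>A\<close>; the local inequality is summed over them. Keeping \<open>M\<close> and
  \<open>N\<close> independent lets one estimate serve the maximal inequality, the density theorem
  and both cone arguments. \<open>A\<close> may be non-measurable, hence the enclosing
  \<open>T\<close>.\<close>

lemma vitali_measure_bound:
  fixes A S V :: "real set" and r :: "real \<Rightarrow> real" and c :: ennreal
  assumes sets: "sets M = sets borel" "sets N = sets borel" "S \<in> sets borel" "V \<in> sets borel"
    and r: "\<And>a. a \<in> A \<Longrightarrow> 0 < r a \<and> r a \<le> B"
    and V: "\<And>a. a \<in> A \<Longrightarrow> cball a (r a) \<subseteq> V"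
    and le: "\<And>a. a \<in> A \<Longrightarrow> emeasure M (cball a (5 * r a)) \<le> c * emeasure N (cball a (r a) \<inter> S)"
  obtains T where "T \<in> sets borel" "A \<subseteq> T" "emeasure M T \<le> c * emeasure N (V \<inter> S)"
proof -
  obtain C where C: "countable C" "C \<subseteq> A"
     "pairwise (\<lambda>i j. disjnt (cball i (r i)) (cball j (r j))) C"
     "A \<subseteq> (\<Union>i\<in>C. cball i (5 * r i))"
  proof (rule Vitali_covering_lemma_cballs[where S = A and K = A and a = "\<lambda>i. i" and r = r and B = B])
    show "A \<subseteq> (\<Union>i\<in>A. cball i (r i))" using r by force
  qed (use r in auto)
  define e where "e = to_nat_on C"
  define d where "d = from_nat_into C"
  have de: "d (e i) = i" if "i \<in> C" for i
    using that C(1) by (simp add: d_def e_def)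
  define f where "f = (\<lambda>n. if n \<in> e ` C then cball (d n) (5 * r (d n)) else {})"
  define g where "g = (\<lambda>n. if n \<in> e ` C then cball (d n) (r (d n)) \<inter> S else {})"
  have g_sets: "g n \<in> sets borel" and f_sets: "f n \<in> sets borel" for n
    using sets by (auto simp: f_def g_def)
  have "A \<subseteq> (\<Union>n. f n)"
  proof
    fix x assume "x \<in> A"
    then obtain i where i: "i \<in> C" "x \<in> cball i (5 * r i)" using C(4) by auto
    then have "x \<in> f (e i)" by (simp add: f_def de)
    then show "x \<in> (\<Union>n. f n)" by blast
  qed
  moreover have "emeasure M (\<Union>n. f n) \<le> c * emeasure N (V \<inter> S)"
  proof -
    have "emeasure M (\<Union>n. f n) \<le> (\<Sum>n. emeasure M (f n))"
      by (rule emeasure_subadditive_countably) (use f_sets sets in auto)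
    also have "\<dots> \<le> (\<Sum>n. c * emeasure N (g n))"
    proof (intro suminf_le allI)
      fix n show "emeasure M (f n) \<le> c * emeasure N (g n)"
        using le C(2) by (auto simp: f_def g_def de)
    qed auto
    also have "\<dots> = c * (\<Sum>n. emeasure N (g n))" by simp
    also have "(\<Sum>n. emeasure N (g n)) = emeasure N (\<Union>n. g n)"
    proof (rule suminf_emeasure)
      show "disjoint_family g"
        unfolding disjoint_family_on_def
      proof (intro ballI impI)
        fix m n :: nat assume "m \<noteq> n"
        show "g m \<inter> g n = {}"
        proof (cases "m \<in> e ` C \<and> n \<in> e ` C")
          case True
          then obtain i j where "i \<in> C" "j \<in> C" "m = e i" "n = e j" by auto
          moreover have "i \<noteq> j" using calculation \<open>m \<noteq> n\<close> by auto
          ultimately show ?thesis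
            using C(3) by (auto simp: g_def de pairwise_def disjnt_def)
        qed (auto simp: g_def)
      qed
    qed (use g_sets sets in auto)
    also have "\<dots> \<le> emeasure N (V \<inter> S)"
    proof (rule emeasure_mono)
      show "(\<Union>n. g n) \<subseteq> V \<inter> S"
        using V C(2) by (auto simp: g_def de split: if_splits)
    qed (use sets in auto)
    finally show ?thesis by (simp add: mult_left_mono)
  qed
  moreover have "(\<Union>n. f n) \<in> sets borel" using f_sets by auto
  ultimately show ?thesis using that by blast
qed

lemma negligible_small_cover:
  fixes A :: "real set"
  assumes "\<And>e. e > 0 \<Longrightarrow> \<exists>T\<in>sets borel. A \<subseteq> T \<and> emeasure lborel T \<le> ennreal e"
  shows "negligible A"
  unfolding negligible_outer_le
proof (intro allI impI)
  fix e :: real assume e: "e > 0"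
  obtain T where T: "T \<in> sets borel" "A \<subseteq> T" "emeasure lborel T \<le> ennreal e"
    using assms[OF e] by blast
  then have "emeasure lebesgue T \<le> ennreal e" by simp
  then show "\<exists>T. A \<subseteq> T \<and> T \<in> lmeasurable \<and> measure lebesgue T \<le> e"
    using T e by (intro exI[of _ T]) (auto simp: fmeasurable_def measure_def enn2real_leI intro: order_le_less_trans)
qed

text \<open>The weak-type bound for the Hardy-Littlewood maximal function: for each \<open>k\<close>
  the exceptional set has outer measure at most 10/k times the total mass.\<close>

lemma maximal_function_finite_ae:
  fixes N :: "real measure"
  assumes sets: "sets N = sets borel" and fin: "emeasure N UNIV < \<infinity>"
  shows "negligible {y. \<forall>k::nat. \<exists>s>0. emeasure N (cball y s) > ennreal (real k * s)}" (is "negligible ?A")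
proof (rule negligible_small_cover)
  fix e :: real assume e: "e > 0"
  define m where "m = enn2real (emeasure N UNIV)"
  have m: "emeasure N UNIV = ennreal m" "m \<ge> 0" using fin by (simp_all add: m_def)
  \<comment> \<open>A ball of radius \<open>5 * r\<close> has length \<open>10 * r\<close>, which
    explains the 10.\<close>
  obtain k :: nat where k: "real k > 10 * m / e" "k > 0"
  proof -
    obtain k :: nat where "real k > max (10 * m / e) 0" using reals_Archimedean2 by blast
    then show ?thesis by (intro that[of k]) auto
  qed
  have "\<forall>y\<in>?A. \<exists>s>0. emeasure N (cball y s) > ennreal (real k * s)" by blast
  then obtain r where r0: "\<forall>y\<in>?A. r y > 0 \<and> emeasure N (cball y (r y)) > ennreal (real k * r y)"
    unfolding bchoice_iff by blast
  have r: "\<And>y. y \<in> ?A \<Longrightarrow> r y > 0 \<and> emeasure N (cball y (r y)) > ennreal (real k * r y)"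
    using r0 by blast
  obtain T where T: "T \<in> sets borel" "?A \<subseteq> T" "emeasure lborel T \<le> ennreal (10 / real k) * emeasure N (UNIV \<inter> UNIV)"
  proof (rule vitali_measure_bound[where M = lborel and N = N and S = UNIV and V = UNIV and A = ?A and r = r
        and c = "ennreal (10 / real k)" and B = "m / real k"])
    fix y assume y: "y \<in> ?A"
    have "ennreal (real k * r y) < ennreal m"
      using r[OF y] emeasure_mono[of "cball y (r y)" UNIV N] sets m by (auto intro: order.strict_trans2)
    then have "real k * r y < m"
      using r[OF y] ennreal_less_iff by simp
    \<comment> \<open>Vitali needs bounded radii; the finite total mass supplies the bound.\<close>
    then show "0 < r y \<and> r y \<le> m / real k"
      using r[OF y] k by (simp add: field_simps)
    have "emeasure lborel (cball y (5 * r y)) = ennreal (10 / real k) * ennreal (real k * r y)"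
      using r[OF y] k by (simp add: emeasure_lborel_cbox_eq cball_eq_atLeastAtMost flip: ennreal_mult')
    also have "\<dots> \<le> ennreal (10 / real k) * emeasure N (cball y (r y) \<inter> UNIV)"
      using r[OF y] by (intro mult_left_mono) auto
    finally show "emeasure lborel (cball y (5 * r y)) \<le> ennreal (10 / real k) * emeasure N (cball y (r y) \<inter> UNIV)" .
  qed (use sets in auto)
  have "10 / real k * m \<le> e" using k e m by (simp add: field_simps)
  then have "emeasure lborel T \<le> ennreal e"
    using T(3) m by (auto simp: ennreal_mult'[symmetric] intro: order_trans ennreal_leI)
  with T show "\<exists>T\<in>sets borel. ?A \<subseteq> T \<and> emeasure lborel T \<le> ennreal e" by blast
qed

text \<open>Points where the complement keeps a proportion \<open>e\<close> at small scales are
  covered by balls inside an open \<open>U\<close> that barely exceeds \<open>T\<close>; the Vitali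
  bound compares their length with that of \<open>U - T\<close>.\<close>

lemma lebesgue_density:
  fixes T :: "real set"
  assumes T: "T \<in> sets borel"
  shows "negligible {t \<in> T. \<not> (\<forall>e>0. \<exists>s0>0. \<forall>s. 0 < s \<and> s < s0 \<longrightarrow> emeasure lborel (cball t s - T) \<le> ennreal (e * s))}"
    (is "negligible ?A")
proof -
  define D where "D = (\<lambda>e. {t \<in> T. \<forall>s0>0. \<exists>s. 0 < s \<and> s < s0 \<and> emeasure lborel (cball t s - T) > ennreal (e * s)})"
  have "negligible (D e)" if e: "e > 0" for e
  proof (rule negligible_small_cover)
    fix \<eta> :: real assume \<eta>: "\<eta> > 0"
    \<comment> \<open>The excess is chosen to cancel the factor \<open>10 / e\<close> of the Vitali
      bound.\<close>
    obtain U where U: "open U" "T \<subseteq> U" "emeasure lborel (U - T) < ennreal (\<eta> * e / 10)"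
      using outer_regular_lborel[OF T, of "\<eta> * e / 10"] \<eta> e by auto
    have "\<exists>s. 0 < s \<and> s < 1 \<and> cball t s \<subseteq> U \<and> emeasure lborel (cball t s - T) > ennreal (e * s)" if "t \<in> D e" for t
    proof -
      have tU: "t \<in> U" using U(2) that by (auto simp: D_def)
      obtain s0 where s0: "s0 > 0" "cball t s0 \<subseteq> U"
        using bspec[OF U(1)[unfolded open_contains_cball] tU] by blast
      then obtain s where s: "0 < s" "s < min s0 1" "emeasure lborel (cball t s - T) > ennreal (e * s)"
      proof -
        have "min s0 1 > 0" using s0 by simp
        then show ?thesis using that \<open>t \<in> D e\<close> unfolding D_def by blast
      qed
      then have "cball t s \<subseteq> U" using s0 subset_cball[of s s0 t] by auto
      with s show ?thesis by auto
    qed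
    then have "\<forall>t\<in>D e. \<exists>s. 0 < s \<and> s < 1 \<and> cball t s \<subseteq> U \<and> emeasure lborel (cball t s - T) > ennreal (e * s)"
      by blast
    then obtain r where r0: "\<forall>t\<in>D e. 0 < r t \<and> r t < 1 \<and> cball t (r t) \<subseteq> U \<and> emeasure lborel (cball t (r t) - T) > ennreal (e * r t)"
      unfolding bchoice_iff by blast
    have r: "\<And>t. t \<in> D e \<Longrightarrow> 0 < r t \<and> r t < 1 \<and> cball t (r t) \<subseteq> U \<and> emeasure lborel (cball t (r t) - T) > ennreal (e * r t)"
      using r0 by blast
    obtain T' where T': "T' \<in> sets borel" "D e \<subseteq> T'" "emeasure lborel T' \<le> ennreal (10 / e) * emeasure lborel (U \<inter> (-T))"
    proof (rule vitali_measure_bound[where M = lborel and N = lborel and S = "-T" and V = U and A = "D e" and r = r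
        and c = "ennreal (10 / e)" and B = 1])
      fix t assume t: "t \<in> D e"
      show "0 < r t \<and> r t \<le> 1" "cball t (r t) \<subseteq> U" using r[OF t] by auto
      have "emeasure lborel (cball t (5 * r t)) = ennreal (10 / e) * ennreal (e * r t)"
        using r[OF t] e by (simp add: emeasure_lborel_cbox_eq cball_eq_atLeastAtMost flip: ennreal_mult')
      also have "\<dots> \<le> ennreal (10 / e) * emeasure lborel (cball t (r t) \<inter> - T)"
        using r[OF t] by (intro mult_left_mono) (auto simp: Diff_eq)
      finally show "emeasure lborel (cball t (5 * r t)) \<le> ennreal (10 / e) * emeasure lborel (cball t (r t) \<inter> - T)" .
    qed (use U T in auto)
    note T'(3)
    also have "ennreal (10 / e) * emeasure lborel (U \<inter> - T) \<le> ennreal (10 / e) * ennreal (\<eta> * e / 10)"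
      using U(3) by (intro mult_left_mono) (auto simp: Diff_eq)
    also have "\<dots> = ennreal \<eta>" using e \<eta> by (simp flip: ennreal_mult')
    finally show "\<exists>T'\<in>sets borel. D e \<subseteq> T' \<and> emeasure lborel T' \<le> ennreal \<eta>" using T' by blast
  qed
  then have "negligible (\<Union>n. D (1 / real (Suc n)))"
    by (intro negligible_Union_nat) auto
  moreover have "?A \<subseteq> (\<Union>n. D (1 / real (Suc n)))"
  proof clarsimp
    fix t e assume "t \<in> T" "e > 0" and e: "\<forall>s0>0. \<exists>s>0. s < s0 \<and> \<not> emeasure lborel (cball t s - T) \<le> ennreal (e * s)"
    obtain n where n: "1 / real (Suc n) < e" using \<open>e > 0\<close> nat_approx_posE by blast
    have "t \<in> D (1 / real (Suc n))"
      unfolding D_def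
    proof (intro CollectI conjI allI impI \<open>t \<in> T\<close>)
      fix s0 :: real assume "s0 > 0"
      then obtain s where s: "s > 0" "s < s0" "\<not> emeasure lborel (cball t s - T) \<le> ennreal (e * s)" using e by blast
      have "ennreal (1 / real (Suc n) * s) \<le> ennreal (e * s)"
        using n s(1) by (intro ennreal_leI mult_right_mono) auto
      then show "\<exists>s. 0 < s \<and> s < s0 \<and> ennreal (1 / real (Suc n) * s) < emeasure lborel (cball t s - T)"
        using s by (intro exI[of _ s]) (auto simp: not_le intro: le_less_trans)
    qed
    then show "\<exists>n. t \<in> D (1 / (1 + real n))" by (auto simp: add.commute)
  qed
  ultimately show ?thesis by (rule negligible_subset)
qed

text \<open>The covering intervals may share endpoints, so lengths are added through their disjoint
  open interiors.\<close>

lemma outer_interval_cover: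
  fixes Y :: "real set"
  assumes Y: "Y \<in> sets borel" "bounded Y" and c: "emeasure lborel Y < ennreal c"
  obtains a b :: "nat \<Rightarrow> real" where "\<And>i. a i \<le> b i" "Y \<subseteq> (\<Union>i. {a i..b i})" "(\<Sum>i. ennreal (b i - a i)) < ennreal c"
proof -
  obtain l u where lu: "Y \<subseteq> cbox l u"
    using bounded_subset_cbox_symmetric[OF Y(2)] by blast
  have Yl: "Y \<in> lmeasurable"
    using Y by (intro bounded_set_imp_lmeasurable) auto
  then have em: "emeasure lborel Y = ennreal (measure lebesgue Y)"
    using Y emeasure_eq_measure2[OF Yl] by simp
  then have mc: "measure lebesgue Y < c"
    using c by (simp add: ennreal_less_iff)
  obtain D where D: "countable D"
     "\<And>K. K \<in> D \<Longrightarrow> K \<subseteq> cbox l u \<and> K \<noteq> {} \<and> (\<exists>c d. K = cbox c d)"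
     "pairwise (\<lambda>A B. interior A \<inter> interior B = {}) D"
     "Y \<subseteq> \<Union>D" "\<Union>D \<in> lmeasurable" "measure lebesgue (\<Union>D) \<le> measure lebesgue Y + (c - measure lebesgue Y)/2"
  proof (rule measurable_outer_intervals_bounded[OF Yl lu, where e = "(c - measure lebesgue Y)/2"])
    show "0 < (c - measure lebesgue Y)/2" using mc by simp
  next
    fix D :: "real set set"
    assume "countable D" "\<And>K. K \<in> D \<Longrightarrow> K \<subseteq> cbox l u \<and> K \<noteq> {} \<and> (\<exists>c d. K = cbox c d)"
      "pairwise (\<lambda>A B. interior A \<inter> interior B = {}) D" "Y \<subseteq> \<Union>D" "\<Union>D \<in> lmeasurable"
      "measure lebesgue (\<Union>D) \<le> measure lebesgue Y + (c - measure lebesgue Y)/2"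
    then show thesis by (rule that)
  qed
  have "\<forall>K\<in>D. \<exists>x y. K = {x..y} \<and> x \<le> y"
    using D(2) by fastforce
  then obtain x y where xy: "\<And>K. K \<in> D \<Longrightarrow> K = {x K..y K} \<and> x K \<le> y K"
    by (auto simp: bchoice_iff)
  define e where "e = to_nat_on D"
  define d where "d = from_nat_into D"
  have de: "d (e i) = i" if "i \<in> D" for i
    using that D(1) by (simp add: d_def e_def)
  define a where "a = (\<lambda>n. if n \<in> e ` D then x (d n) else 0)"
  define b where "b = (\<lambda>n. if n \<in> e ` D then y (d n) else 0)"
  show ?thesis
  proof
    show "a i \<le> b i" for i using xy by (auto simp: a_def b_def de)
    show "Y \<subseteq> (\<Union>i. {a i..b i})"
    proof
      fix z assume "z \<in> Y"
      then obtain K where K: "K \<in> D" "z \<in> K" using D(4) by auto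
      then have "z \<in> {x K..y K}" using xy[OF K(1)] by blast
      then have "z \<in> {a (e K)..b (e K)}"
        using K by (auto simp: a_def b_def de)
      then show "z \<in> (\<Union>i. {a i..b i})" by blast
    qed
    have "(\<Sum>i. ennreal (b i - a i)) = (\<Sum>i. emeasure lborel {a i<..<b i})"
      using \<open>\<And>i. a i \<le> b i\<close> by simp
    also have "\<dots> = emeasure lborel (\<Union>i. {a i<..<b i})"
    proof (rule suminf_emeasure)
      show "disjoint_family (\<lambda>i. {a i<..<b i})"
        unfolding disjoint_family_on_def
      proof (intro ballI impI)
        fix m n :: nat assume "m \<noteq> n"
        show "{a m<..<b m} \<inter> {a n<..<b n} = {}"
        proof (cases "m \<in> e ` D \<and> n \<in> e ` D")
          case True
          then obtain i j where ij: "i \<in> D" "j \<in> D" "m = e i" "n = e j" by auto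
          moreover have "i \<noteq> j" using calculation \<open>m \<noteq> n\<close> by auto
          ultimately have "interior i \<inter> interior j = {}"
            using D(3) by (auto simp: pairwise_def)
          then have "interior {x i..y i} \<inter> interior {x j..y j} = {}"
            using xy[OF ij(1)] xy[OF ij(2)] by metis
          then show ?thesis using ij
            by (simp add: a_def b_def de)
        qed (auto simp: a_def b_def)
      qed
    qed auto
    also have "\<dots> = emeasure lebesgue (\<Union>i. {a i<..<b i})" by simp
    also have "\<dots> \<le> emeasure lebesgue (\<Union>D)"
    proof (rule emeasure_mono)
      show "(\<Union>i. {a i<..<b i}) \<subseteq> \<Union>D"
      proof clarsimp
        fix z i assume z: "a i < z" "z < b i"
        then have i: "i \<in> e ` D" by (auto simp: a_def b_def split: if_splits)
        then obtain K where K: "K \<in> D" "i = e K" by auto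
        then have "z \<in> {x K..y K}" using z by (auto simp: a_def b_def de)
        then have "z \<in> K" using xy[OF K(1)] by blast
        then show "\<exists>K\<in>D. z \<in> K" using K by blast
      qed
    qed (use D(5) in auto)
    also have "\<dots> = ennreal (measure lebesgue (\<Union>D))"
      using D(5) by (simp add: emeasure_eq_measure2)
    also have "\<dots> < ennreal c"
      using D(6) mc by (intro ennreal_lessI) (auto simp: field_simps intro: le_less_trans[OF measure_nonneg])
    finally show "(\<Sum>i. ennreal (b i - a i)) < ennreal c" .
  qed
qed

section \<open>Lipschitz maps, null sets and length\<close>

lemma outer_lipschitz_image:
  fixes f :: "real \<Rightarrow> real"
  assumes f: "\<And>x y. \<bar>f x - f y\<bar> \<le> L * \<bar>x - y\<bar>" and L: "L \<ge> 0"
    and S: "S \<in> sets borel" "bounded S" "emeasure lborel S < ennreal c"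
  obtains T where "T \<in> sets borel" "f ` S \<subseteq> T" "emeasure lborel T \<le> ennreal (2 * L * c)"
proof -
  obtain a b :: "nat \<Rightarrow> real" where ab: "\<And>i. a i \<le> b i" "S \<subseteq> (\<Union>i. {a i..b i})" "(\<Sum>i. ennreal (b i - a i)) < ennreal c"
    using outer_interval_cover[OF S] by metis
  \<comment> \<open>Centring at the image of an endpoint loses only a factor 2.\<close>
  define T where "T = (\<Union>i. cball (f (a i)) (L * (b i - a i)))"
  have "f ` S \<subseteq> T"
  proof
    fix y assume "y \<in> f ` S"
    then obtain x i where x: "y = f x" "x \<in> {a i..b i}" using ab(2) by blast
    have "\<bar>f (a i) - f x\<bar> \<le> L * \<bar>a i - x\<bar>" by (rule f)
    also have "\<dots> \<le> L * (b i - a i)" using x L by (intro mult_left_mono) auto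
    finally show "y \<in> T" using x by (auto simp: T_def dist_real_def)
  qed
  moreover have "T \<in> sets borel" by (auto simp: T_def)
  moreover have "emeasure lborel T \<le> ennreal (2 * L * c)"
  proof -
    have "emeasure lborel T \<le> (\<Sum>i. emeasure lborel (cball (f (a i)) (L * (b i - a i))))"
      unfolding T_def by (rule emeasure_subadditive_countably) auto
    also have "\<dots> = (\<Sum>i. ennreal (2 * L) * ennreal (b i - a i))"
      using ab(1) L by (intro suminf_cong) (simp add: cball_eq_atLeastAtMost flip: ennreal_mult')
    also have "\<dots> = ennreal (2 * L) * (\<Sum>i. ennreal (b i - a i))" by simp
    also have "\<dots> \<le> ennreal (2 * L) * ennreal c"
      using ab(3) by (intro mult_left_mono) auto
    finally show ?thesis using L by (simp flip: ennreal_mult')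
  qed
  ultimately show ?thesis using that by blast
qed

text \<open>McShane's formula: an infimum of Lipschitz cones placed over the graph keeps the
  constant \<open>L\<close>.\<close>

lemma lipschitz_extension_real:
  fixes g :: "real \<Rightarrow> real"
  assumes g: "\<And>x y. x \<in> Y \<Longrightarrow> y \<in> Y \<Longrightarrow> \<bar>g x - g y\<bar> \<le> L * \<bar>x - y\<bar>" and L: "L \<ge> 0" and "Y \<noteq> {}"
  obtains f where "\<And>x y. \<bar>f x - f y\<bar> \<le> L * \<bar>x - y\<bar>" "\<And>x. x \<in> Y \<Longrightarrow> f x = g x"
proof -
  define f where "f = (\<lambda>x. INF y\<in>Y. g y + L * \<bar>x - y\<bar>)"
  obtain y0 where y0: "y0 \<in> Y" using \<open>Y \<noteq> {}\<close> by blast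
  have bdd: "bdd_below ((\<lambda>y. g y + L * \<bar>x - y\<bar>) ` Y)" for x
  proof (rule bdd_belowI2)
    fix y assume y: "y \<in> Y"
    have "g y0 - g y \<le> L * \<bar>y0 - y\<bar>" using g[OF y0 y] by linarith
    also have "\<dots> \<le> L * (\<bar>x - y0\<bar> + \<bar>x - y\<bar>)" using L by (intro mult_left_mono) auto
    finally show "g y0 - L * \<bar>x - y0\<bar> \<le> g y + L * \<bar>x - y\<bar>" by (simp add: algebra_simps)
  qed
  have le: "f x \<le> f z + L * \<bar>x - z\<bar>" for x z
  proof -
    have "f x - L * \<bar>x - z\<bar> \<le> f z"
      unfolding f_def
    proof (rule cINF_greatest[OF \<open>Y \<noteq> {}\<close>])
      fix y assume y: "y \<in> Y"
      have "(INF y\<in>Y. g y + L * \<bar>x - y\<bar>) \<le> g y + L * \<bar>x - y\<bar>"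
        by (rule cINF_lower[OF bdd y])
      also have "L * \<bar>x - y\<bar> \<le> L * (\<bar>x - z\<bar> + \<bar>z - y\<bar>)" using L by (intro mult_left_mono) auto
      finally show "(INF y\<in>Y. g y + L * \<bar>x - y\<bar>) - L * \<bar>x - z\<bar> \<le> g y + L * \<bar>z - y\<bar>" by (simp add: algebra_simps)
    qed
    then show ?thesis by simp
  qed
  show ?thesis
  proof
    show "\<bar>f x - f y\<bar> \<le> L * \<bar>x - y\<bar>" for x y
      using le[of x y] le[of y x] by (simp add: abs_minus_commute abs_le_iff)
    fix x assume x: "x \<in> Y"
    have "f x \<le> g x + L * \<bar>x - x\<bar>" unfolding f_def by (rule cINF_lower[OF bdd x])
    moreover have "g x \<le> f x"
      unfolding f_def
    proof (rule cINF_greatest[OF \<open>Y \<noteq> {}\<close>])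
      fix y assume y: "y \<in> Y"
      show "g x \<le> g y + L * \<bar>x - y\<bar>" using g[OF x y] by linarith
    qed
    ultimately show "f x = g x" by simp
  qed
qed

lemma negligible_subset_null_borel:
  fixes Y :: "real set"
  assumes "negligible Y"
  obtains Y' where "Y' \<in> sets borel" "Y \<subseteq> Y'" "emeasure lborel Y' = 0"
proof -
  have "Y \<in> null_sets (completion lborel)" using assms negligible_iff_null_sets by auto
  then obtain N where "N \<in> null_sets lborel" "Y \<subseteq> N"
    unfolding null_sets_completion_iff2 by (rule bexE) (rule that)
  then show ?thesis using that[of N] by (auto simp: null_sets_def)
qed

text \<open>A Lipschitz function mapping a closed set \<open>K\<close> into a null set varies little around a density
  point of \<open>K\<close>, because the image of an interval is covered by the null set and the image of the
  small remainder of the interval. Two such functions cannot separate points near a density point.\<close>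

lemma lipschitz_null_image_flat:
  fixes f :: "real \<Rightarrow> real"
  assumes f: "\<And>x y. \<bar>f x - f y\<bar> \<le> L * \<bar>x - y\<bar>" and L: "L \<ge> 0"
    and K: "closed K" "f ` K \<subseteq> N" and N: "negligible N"
    and small: "emeasure lborel (cball x (\<bar>x - y\<bar>) - K) < ennreal c"
  shows "\<bar>f x - f y\<bar> \<le> 2 * L * c"
proof -
  let ?I = "closed_segment x y"
  have I: "?I \<subseteq> cball x (\<bar>x - y\<bar>)"
    using dist_in_closed_segment[of _ x y] by (auto simp: dist_real_def abs_minus_commute)
  have "emeasure lborel (?I - K) < ennreal c"
    using small I K by (intro le_less_trans[OF emeasure_mono small]) auto
  then obtain T where T: "T \<in> sets borel" "f ` (?I - K) \<subseteq> T" "emeasure lborel T \<le> ennreal (2 * L * c)"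
    using outer_lipschitz_image[OF f L, of "?I - K" c] K
    by (metis borel_closed bounded_closed_segment bounded_diff closed_segment sets.Diff)
  obtain N' where N': "N' \<in> sets borel" "N \<subseteq> N'" "emeasure lborel N' = 0"
    using negligible_subset_null_borel[OF N] by blast
  have cont: "continuous_on ?I f"
    by (rule lipschitz_on_continuous_on[of L]) (use f L in \<open>auto simp: lipschitz_on_def dist_real_def\<close>)
  \<comment> \<open>By the intermediate value theorem the image contains everything between
    \<open>f x\<close> and \<open>f y\<close>, so its outer measure bounds the increment.\<close>
  have "closed_segment (f x) (f y) \<subseteq> f ` ?I"
  proof -
    have "connected (f ` ?I)" using cont by (rule connected_continuous_image) auto
    then have "convex (f ` ?I)" by (simp add: connected_convex_1)
    then show ?thesis by (intro closed_segment_subset) auto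
  qed
  also have "\<dots> \<subseteq> N' \<union> T" using K N' T by blast
  finally have "emeasure lborel (closed_segment (f x) (f y)) \<le> emeasure lborel (N' \<union> T)"
    using N' T by (intro emeasure_mono) auto
  also have "\<dots> \<le> emeasure lborel N' + emeasure lborel T"
    using N' T by (intro emeasure_subadditive) auto
  also have "\<dots> \<le> ennreal (2 * L * c)" using N' T by simp
  finally have "ennreal \<bar>f x - f y\<bar> \<le> ennreal (2 * L * c)"
    by (simp add: closed_segment_eq_real_ivl abs_if split: if_splits)
  moreover have "0 < c" using small by (metis ennreal_neg not_less not_less_zero)
  ultimately show ?thesis using L by (simp add: ennreal_le_iff)
qed

lemma negligible_of_two_null_images:
  fixes g1 g2 :: "real \<Rightarrow> real"
  assumes g1: "\<And>x y. x \<in> Y \<Longrightarrow> y \<in> Y \<Longrightarrow> \<bar>g1 x - g1 y\<bar> \<le> L * \<bar>x - y\<bar>"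
    and g2: "\<And>x y. x \<in> Y \<Longrightarrow> y \<in> Y \<Longrightarrow> \<bar>g2 x - g2 y\<bar> \<le> L * \<bar>x - y\<bar>"
    and sep: "\<And>x y. x \<in> Y \<Longrightarrow> y \<in> Y \<Longrightarrow> \<bar>x - y\<bar> \<le> \<bar>g1 x - g1 y\<bar> + \<bar>g2 x - g2 y\<bar>"
    and N: "closed N1" "negligible N1" "g1 ` Y \<subseteq> N1" "closed N2" "negligible N2" "g2 ` Y \<subseteq> N2"
    and L: "L > 0"
  shows "negligible Y"
proof (cases "Y = {}")
  case False
  obtain f1 where f1: "\<And>x y. \<bar>f1 x - f1 y\<bar> \<le> L * \<bar>x - y\<bar>" "\<And>x. x \<in> Y \<Longrightarrow> f1 x = g1 x"
    using lipschitz_extension_real[of Y g1 L] g1 L False by (metis less_imp_le)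
  obtain f2 where f2: "\<And>x y. \<bar>f2 x - f2 y\<bar> \<le> L * \<bar>x - y\<bar>" "\<And>x. x \<in> Y \<Longrightarrow> f2 x = g2 x"
    using lipschitz_extension_real[of Y g2 L] g2 L False by (metis less_imp_le)
  \<comment> \<open>\<open>Y\<close> need not be measurable. Passing to the closure is harmless: the
    extensions are continuous, the targets are closed, and the separation inequality is a closed
    condition.\<close>
  define K where "K = closure Y"
  have c1: "continuous_on UNIV f1"
    by (rule lipschitz_on_continuous_on[of L]) (use f1 L in \<open>auto simp: lipschitz_on_def dist_real_def\<close>)
  have c2: "continuous_on UNIV f2"
    by (rule lipschitz_on_continuous_on[of L]) (use f2 L in \<open>auto simp: lipschitz_on_def dist_real_def\<close>)
  have K1: "f1 ` K \<subseteq> N1" unfolding K_def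
    by (rule image_closure_subset) (use c1 N f1 in \<open>auto intro: continuous_on_subset\<close>)
  have K2: "f2 ` K \<subseteq> N2" unfolding K_def
    by (rule image_closure_subset) (use c2 N f2 in \<open>auto intro: continuous_on_subset\<close>)
  have sepK: "\<bar>x - y\<bar> \<le> \<bar>f1 x - f1 y\<bar> + \<bar>f2 x - f2 y\<bar>" if "x \<in> K" "y \<in> K" for x y
  proof -
    let ?S = "{p :: real \<times> real. \<bar>fst p - snd p\<bar> \<le> \<bar>f1 (fst p) - f1 (snd p)\<bar> + \<bar>f2 (fst p) - f2 (snd p)\<bar>}"
    have "closed ?S"
      by (intro closed_Collect_le continuous_intros continuous_on_compose2[OF c1] continuous_on_compose2[OF c2]) auto
    moreover have "Y \<times> Y \<subseteq> ?S" using sep f1 f2 by auto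
    ultimately have "closure (Y \<times> Y) \<subseteq> ?S" by (rule closure_minimal[rotated])
    then show ?thesis using that by (auto simp: closure_Times K_def)
  qed
  \<comment> \<open>Flatness is applied with \<open>c = 2 * \<eta> * \<bar>x - y\<bar>\<close>; the
    two functions together then move at most \<open>8 * L * \<eta> * \<bar>x - y\<bar>\<close>, less
    than separation demands.\<close>
  define \<eta> where "\<eta> = 1 / (8 * (L + 1))"
  have \<eta>: "\<eta> > 0" "8 * L * \<eta> < 1" using L by (auto simp: \<eta>_def field_simps)
  let ?dens = "\<lambda>t. \<forall>e>0. \<exists>s0>0. \<forall>s. 0 < s \<and> s < s0 \<longrightarrow> emeasure lborel (cball t s - K) \<le> ennreal (e * s)"
  have "\<not> ?dens x" if x: "x \<in> K" for x
  proof
    assume "?dens x"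
    then obtain s0 where s0: "s0 > 0" "\<And>s. 0 < s \<Longrightarrow> s < s0 \<Longrightarrow> emeasure lborel (cball x s - K) \<le> ennreal (\<eta> * s)"
      using \<eta> by meson
    \<comment> \<open>A density point would thus be isolated in \<open>K\<close>, yet the complement
      of \<open>K\<close> would be thin around it.\<close>
    have only: "y = x" if y: "y \<in> K" "\<bar>x - y\<bar> < s0" for y
    proof (rule ccontr)
      assume "y \<noteq> x"
      then have pos: "\<bar>x - y\<bar> > 0" by simp
      have "emeasure lborel (cball x \<bar>x - y\<bar> - K) < ennreal (2 * \<eta> * \<bar>x - y\<bar>)"
        by (rule le_less_trans[OF s0(2)[OF pos y(2)]]) (use pos \<eta> in \<open>auto intro!: ennreal_lessI\<close>)
      note lipschitz_null_image_flat[OF f1(1) _ _ K1 N(2) this] lipschitz_null_image_flat[OF f2(1) _ _ K2 N(5) this]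
      then have "\<bar>x - y\<bar> \<le> 8 * L * \<eta> * \<bar>x - y\<bar>"
        using sepK[OF x y(1)] L by (simp add: K_def)
      then show False using \<eta> pos by simp
    qed
    define s where "s = s0 / 2"
    have s: "0 < s" "s < s0" using s0 by (auto simp: s_def)
    have "cball x s - {x} \<subseteq> cball x s - K"
      using only s by (auto simp: dist_real_def)
    then have "emeasure lborel (cball x s - {x}) \<le> emeasure lborel (cball x s - K)"
      by (intro emeasure_mono) (auto simp: K_def)
    also have "\<dots> \<le> ennreal (\<eta> * s)" using s0 s by auto
    also have "emeasure lborel (cball x s - {x}) = ennreal (2 * s)"
      using s by (subst emeasure_Diff) (auto simp: cball_eq_atLeastAtMost)
    finally have "2 * s \<le> \<eta> * s" using s \<eta> by simp
    moreover have "\<eta> < 1" using L by (auto simp: \<eta>_def)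
    ultimately show False using s by simp
  qed
  then have "K \<subseteq> {t \<in> K. \<not> ?dens t}" by blast
  moreover have "negligible {t \<in> K. \<not> ?dens t}" by (rule lebesgue_density) (simp add: K_def)
  ultimately have "negligible K" by (rule negligible_subset[rotated])
  then show ?thesis using closure_subset negligible_subset unfolding K_def by blast
qed simp

lemma hausdorff_measure_lipschitz_image_null:
  fixes h :: "real \<Rightarrow> 'a::real_normed_vector"
  assumes h: "\<And>x y. x \<in> Y \<Longrightarrow> y \<in> Y \<Longrightarrow> dist (h x) (h y) \<le> L * \<bar>x - y\<bar>" and L: "L > 0"
    and Y: "negligible Y" "bounded Y"
  shows "hausdorff_measure 1 (h ` Y) = 0"
proof -
  obtain Y0 where Y0: "Y0 \<in> sets borel" "Y \<subseteq> Y0" "emeasure lborel Y0 = 0"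
    using negligible_subset_null_borel[OF Y(1)] by blast
  obtain M where M: "Y \<subseteq> cbox (-M) M"
    using bounded_subset_cbox_symmetric[OF Y(2)] by blast
  have "hausdorff_content 1 \<delta> (h ` Y) \<le> ennreal e" if e: "e > 0" and \<delta>: "\<delta> > 0" for e \<delta> :: real
  proof -
    \<comment> \<open>A total length below \<open>c\<close> also bounds each single interval, so one
      choice controls both the sum and the diameters.\<close>
    define c where "c = min (e / L) (\<delta> / L)"
    have c: "c > 0" "L * c \<le> e" "L * c \<le> \<delta>" using e \<delta> L by (auto simp: c_def min_def field_simps)
    have "emeasure lborel (Y0 \<inter> cbox (-M) M) \<le> emeasure lborel Y0"
      using Y0 by (intro emeasure_mono) auto
    then have "emeasure lborel (Y0 \<inter> cbox (-M) M) < ennreal c"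
      using Y0 c by simp
    then obtain a b :: "nat \<Rightarrow> real" where ab: "\<And>i. a i \<le> b i" "Y0 \<inter> cbox (-M) M \<subseteq> (\<Union>i. {a i..b i})" "(\<Sum>i. ennreal (b i - a i)) < ennreal c"
      using Y0 by (elim outer_interval_cover[rotated 2]) (auto intro: bounded_subset)
    define U where "U = (\<lambda>i. h ` (Y \<inter> {a i..b i}))"
    have len: "b i - a i < c" for i
      using ennreal_suminf_lessD[OF ab(3), of i] ab(1)[of i] by (simp add: ennreal_less_iff)
    have d: "dist x y \<le> L * (b i - a i)" if "x \<in> U i" "y \<in> U i" for x y i
    proof -
      obtain x' y' where xy: "x = h x'" "y = h y'" "x' \<in> Y" "y' \<in> Y" "x' \<in> {a i..b i}" "y' \<in> {a i..b i}"
        using \<open>x \<in> U i\<close> \<open>y \<in> U i\<close> unfolding U_def by blast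
      have "dist x y \<le> L * \<bar>x' - y'\<bar>" using h[OF xy(3,4)] xy(1,2) by simp
      also have "\<dots> \<le> L * (b i - a i)" using xy L by (intro mult_left_mono) auto
      finally show ?thesis .
    qed
    have bU: "bounded (U i)" for i
    proof (cases "U i = {}")
      case False
      then obtain x where x: "x \<in> U i" by blast
      show ?thesis unfolding bounded_def
        by (intro exI[of _ x] exI[of _ "L * (b i - a i)"] ballI d x)
    qed simp
    have diam: "diameter (U i) \<le> L * (b i - a i)" for i
      by (rule diameter_le) (use d[of _ i] ab(1)[of i] L in \<open>auto simp: dist_norm\<close>)
    have "hausdorff_content 1 \<delta> (h ` Y) \<le> (\<Sum>i. ennreal (diameter (U i) powr 1))"
    proof (rule hausdorff_content_le_suminf)
      have "Y \<subseteq> (\<Union>i. {a i..b i})" using ab(2) Y0(2) M by (meson Int_greatest order_trans)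
      then show "h ` Y \<subseteq> (\<Union>i. U i)" unfolding U_def by (simp flip: image_UN Int_UN_distrib add: Int_absorb2)
      fix i
      have "L * (b i - a i) \<le> L * c" using len[of i] L by (intro mult_left_mono) auto
      then show "diameter (U i) \<le> \<delta>"
        using diam[of i] c by linarith
    qed (rule bU)
    also have "\<dots> \<le> (\<Sum>i. ennreal L * ennreal (b i - a i))"
      using diam diameter_ge_0[OF bU] L ab(1) by (intro suminf_le) (auto simp: ennreal_mult'[symmetric] intro!: ennreal_leI)
    also have "\<dots> = ennreal L * (\<Sum>i. ennreal (b i - a i))" by simp
    also have "\<dots> \<le> ennreal L * ennreal c" using ab(3) by (intro mult_left_mono) auto
    also have "\<dots> \<le> ennreal e" using c L by (simp add: ennreal_mult'[symmetric] ennreal_leI)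
    finally show ?thesis .
  qed
  then have "hausdorff_content 1 \<delta> (h ` Y) = 0" if "\<delta> > 0" for \<delta>
    using that by (metis ennreal_le_epsilon add_0 le_zero_eq)
  then have "hausdorff_measure 1 (h ` Y) \<le> 0"
    unfolding hausdorff_measure_def by (intro SUP_least) auto
  then show ?thesis by simp
qed

text \<open>Each image of a covering set fits into a ball of radius \<open>c\<close> times its
  diameter, hence the factor \<open>2 * c\<close>. The outer measure is used because the image is
  not assumed measurable.\<close>

lemma outer_measure_lipschitz_image_le:
  fixes f :: "'a::metric_space \<Rightarrow> real"
  assumes f: "\<And>x y. \<bar>f x - f y\<bar> \<le> c * dist x y" and c: "c > 0" and fin: "hausdorff_measure 1 A < top"
  shows "outer_measure_of lborel (f ` A) \<le> ennreal (2 * c) * hausdorff_measure 1 A"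
proof (rule ennreal_le_epsilon)
  fix e :: real assume e: "e > 0"
  have "hausdorff_content 1 1 A \<le> hausdorff_measure 1 A" by (rule hausdorff_content_le_measure) simp
  also have "\<dots> < hausdorff_measure 1 A + ennreal (e / (2 * c))"
    using fin e c by (auto simp: less_top)
  finally obtain U where U: "A \<subseteq> (\<Union>i. U i)" "\<And>i::nat. bounded (U i)"
    "(\<Sum>i. ennreal (diameter (U i) powr 1)) < hausdorff_measure 1 A + ennreal (e / (2 * c))"
    using hausdorff_content_cover by metis
  define T where "T = (\<lambda>i. if U i = {} then {} else cball (f (SOME x. x \<in> U i)) (c * diameter (U i)))"
  have "f ` A \<subseteq> (\<Union>i. T i)"
  proof
    fix y assume "y \<in> f ` A"
    then obtain x i where x: "y = f x" "x \<in> U i" using U(1) by blast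
    have s: "(SOME x. x \<in> U i) \<in> U i" using x(2) by (rule someI)
    have "\<bar>f (SOME x. x \<in> U i) - f x\<bar> \<le> c * dist (SOME x. x \<in> U i) x" by (rule f)
    also have "\<dots> \<le> c * diameter (U i)"
      using c diameter_bounded_bound[OF U(2) s x(2)] by (intro mult_left_mono) auto
    finally show "y \<in> (\<Union>i. T i)" using x by (auto simp: T_def dist_real_def)
  qed
  then have "outer_measure_of lborel (f ` A) \<le> emeasure lborel (\<Union>i. T i)"
    unfolding outer_measure_of_def by (intro INF_lower) (auto simp: T_def)
  also have "\<dots> \<le> (\<Sum>i. emeasure lborel (T i))"
    by (rule emeasure_subadditive_countably) (auto simp: T_def)
  also have "\<dots> \<le> (\<Sum>i. ennreal (2 * c) * ennreal (diameter (U i) powr 1))"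
  proof (intro suminf_le allI)
    fix i show "emeasure lborel (T i) \<le> ennreal (2 * c) * ennreal (diameter (U i) powr 1)"
      using c diameter_ge_0[OF U(2)[of i]]
      by (auto simp: T_def cball_eq_atLeastAtMost simp flip: ennreal_mult')
  qed auto
  also have "\<dots> = ennreal (2 * c) * (\<Sum>i. ennreal (diameter (U i) powr 1))" by simp
  also have "\<dots> \<le> ennreal (2 * c) * (hausdorff_measure 1 A + ennreal (e / (2 * c)))"
    using U(3) by (intro mult_left_mono) auto
  also have "\<dots> = ennreal (2 * c) * hausdorff_measure 1 A + ennreal e"
    using c e by (simp add: distrib_left ennreal_mult'[symmetric])
  finally show "outer_measure_of lborel (f ` A) \<le> ennreal (2 * c) * hausdorff_measure 1 A + ennreal e" .
qed

lemma negligible_lipschitz_image_hausdorff_null: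
  fixes f :: "'a::metric_space \<Rightarrow> real"
  assumes "\<And>x y. \<bar>f x - f y\<bar> \<le> c * dist x y" "c > 0" "hausdorff_measure 1 A = 0"
  shows "negligible (f ` A)"
proof -
  have "outer_measure_of lborel (f ` A) \<le> 0"
    using outer_measure_lipschitz_image_le[OF assms(1,2), of A] assms(3) by simp
  then obtain T where "T \<in> sets borel" "f ` A \<subseteq> T" "emeasure lborel T = 0"
    using outer_measure_of_attain[of "f ` A" lborel] by auto
  then show ?thesis
    by (intro negligible_small_cover bexI[of _ T]) auto
qed

section \<open>Projections of sets of finite length\<close>

text \<open>For \<open>p = (v, a)\<close> this is \<open>a + t v\<close>, the position at height
  \<open>t\<close> of the line with slope \<open>v\<close> and foot \<open>a\<close>; up to scaling
  it is an orthogonal projection of the plane.\<close>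

definition proj :: "real \<Rightarrow> real \<times> real \<Rightarrow> real" where
  "proj t p = snd p + t * fst p"

lemma proj_diff: "proj t q - proj t p = (snd q - snd p) + t * (fst q - fst p)"
  by (simp add: proj_def algebra_simps)

lemma continuous_on_proj [continuous_intros]:
  "continuous_on A f \<Longrightarrow> continuous_on A g \<Longrightarrow> continuous_on A (\<lambda>x. proj (f x) (g x))"
  unfolding proj_def by (intro continuous_intros)

lemma proj_lipschitz:
  assumes "t \<in> {0..1}"
  shows "\<bar>proj t x - proj t y\<bar> \<le> 2 * dist x y"
proof -
  have le: "\<bar>fst x - fst y\<bar> \<le> dist x y" "\<bar>snd x - snd y\<bar> \<le> dist x y"
    using dist_fst_le[of x y] dist_snd_le[of x y] by (auto simp: dist_real_def)
  have "\<bar>t * (fst x - fst y)\<bar> \<le> 1 * dist x y"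
    unfolding abs_mult using assms le by (intro mult_mono) auto
  then have "\<bar>snd x - snd y\<bar> + \<bar>t * (fst x - fst y)\<bar> \<le> 2 * dist x y"
    using le by simp
  then show ?thesis
    unfolding proj_diff by (rule order_trans[OF abs_triangle_ineq])
qed

definition strip :: "real \<Rightarrow> real \<Rightarrow> real \<Rightarrow> (real \<times> real) set" where
  "strip t y s = {q. \<bar>proj t q - y\<bar> \<le> s}"

text \<open>A truncated double cone around the fibre of \<open>proj t\<close> through
  \<open>p\<close>. Horizontal distance can measure size, because on the fibre, and in the cone, the
  second coordinate is controlled by the first; equal first coordinates force
  \<open>q = p\<close>.\<close>

definition slope_cone :: "real \<times> real \<Rightarrow> real \<Rightarrow> real \<Rightarrow> real \<Rightarrow> (real \<times> real) set" where
  "slope_cone p r t s = {q. \<bar>fst q - fst p\<bar> \<le> r \<and> \<bar>proj t q - proj t p\<bar> \<le> s * \<bar>fst q - fst p\<bar>}"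

lemma closed_strip: "closed (strip t y s)"
  unfolding strip_def by (intro closed_Collect_le continuous_intros)

lemma closed_slope_cone: "closed (slope_cone p r t s)"
  unfolding slope_cone_def by (intro closed_Collect_conj closed_Collect_le continuous_intros)

section \<open>Strips, cones and the Borel sets of good and bad directions\<close>

locale besicovitch =
  fixes C :: "(real \<times> real) set"
  assumes comp: "compact C"
    and H1_finite: "hausdorff_measure 1 C < top"
begin

text \<open>One-dimensional Hausdorff measure on the plane is not sigma-finite; its restriction to a
  set of finite length is finite, as Fubini requires.\<close>

definition mu :: "(real \<times> real) measure" where
  "mu = density (hausdorff_borel 1) (indicator C)"

lemma sets_mu [simp, measurable_cong]: "sets mu = sets borel"
  by (simp add: mu_def)

lemma space_mu [simp]: "space mu = UNIV"
  by (simp add: mu_def)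

lemma C_borel [measurable]: "C \<in> sets borel"
  using comp by (simp add: compact_imp_closed)

lemma emeasure_mu: "A \<in> sets borel \<Longrightarrow> emeasure mu A = hausdorff_measure 1 (C \<inter> A)"
  unfolding mu_def
  by (subst emeasure_density) (auto simp: emeasure_hausdorff_borel simp flip: indicator_inter_arith)

lemma emeasure_mu_UNIV: "emeasure mu UNIV < top"
  using H1_finite by (simp add: emeasure_mu)

sublocale mu: finite_measure mu
  by (rule finite_measureI) (use emeasure_mu_UNIV in auto)

lemma emeasure_mu_ennreal: "emeasure mu A = ennreal (measure mu A)"
  by (rule mu.emeasure_eq_measure)

sublocale pair: pair_sigma_finite mu lborel
  by unfold_locales

lemma sets_pair: "sets (mu \<Otimes>\<^sub>M lborel) = sets (borel :: ((real \<times> real) \<times> real) measure)"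
proof -
  have "sets (mu \<Otimes>\<^sub>M lborel) = sets ((borel :: (real \<times> real) measure) \<Otimes>\<^sub>M (borel :: real measure))"
    by (rule sets_pair_measure_cong) simp_all
  then show ?thesis by (simp only: borel_prod)
qed

lemma emeasure_mu_section_measurable:
  fixes Q :: "(((real \<times> real) \<times> real) \<times> (real \<times> real)) set"
  assumes "closed Q"
  shows "(\<lambda>x. emeasure mu (Pair x -` Q)) \<in> borel_measurable borel"
proof (rule mu.measurable_emeasure_Pair)
  have "sets ((borel :: ((real \<times> real) \<times> real) measure) \<Otimes>\<^sub>M mu) = sets (borel \<Otimes>\<^sub>M (borel :: (real \<times> real) measure))"
    by (rule sets_pair_measure_cong) simp_all
  also have "\<dots> = sets borel" by (simp only: borel_prod)
  finally show "Q \<in> sets (borel \<Otimes>\<^sub>M mu)" using assms by simp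
qed

lemma strip_measure_measurable [measurable]:
  "(\<lambda>(p, t). emeasure mu (strip t (proj t p) s)) \<in> borel_measurable borel"
proof -
  have "closed {z :: ((real \<times> real) \<times> real) \<times> (real \<times> real).
      \<bar>proj (snd (fst z)) (snd z) - proj (snd (fst z)) (fst (fst z))\<bar> \<le> s}"
    by (intro closed_Collect_le continuous_intros)
  from emeasure_mu_section_measurable[OF this] show ?thesis
    by (rule measurable_cong[THEN iffD1, rotated]) (auto simp: strip_def vimage_def intro!: arg_cong[where f = "emeasure mu"])
qed

lemma slope_cone_measure_measurable [measurable]:
  "(\<lambda>(p, t). emeasure mu (slope_cone p r t s)) \<in> borel_measurable borel"
proof -
  have "closed {z :: ((real \<times> real) \<times> real) \<times> (real \<times> real).
      \<bar>fst (snd z) - fst (fst (fst z))\<bar> \<le> r \<and>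
      \<bar>proj (snd (fst z)) (snd z) - proj (snd (fst z)) (fst (fst z))\<bar> \<le> s * \<bar>fst (snd z) - fst (fst (fst z))\<bar>}"
    by (intro closed_Collect_conj closed_Collect_le continuous_intros)
  from emeasure_mu_section_measurable[OF this] show ?thesis
    by (rule measurable_cong[THEN iffD1, rotated]) (auto simp: slope_cone_def vimage_def intro!: arg_cong[where f = "emeasure mu"])
qed

text \<open>Pairs for which the fibre through \<open>p\<close> returns to \<open>C\<close> nearby. A
  point with finite fibre avoids \<open>meets k\<close> for all large \<open>k\<close>.\<close>

definition meets :: "nat \<Rightarrow> ((real \<times> real) \<times> real) set" where
  "meets k = {(p, t). p \<in> C \<and> t \<in> {0..1} \<and>
     (\<exists>q\<in>C. 0 < \<bar>fst q - fst p\<bar> \<and> \<bar>fst q - fst p\<bar> \<le> 1 / real (k+1) \<and> proj t q = proj t p)}"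

text \<open>Rational widths make the condition a countable intersection of Borel sets;
  \<open>regular_strip\<close> recovers real widths at the cost of a factor 2.\<close>

definition regular :: "nat \<Rightarrow> ((real \<times> real) \<times> real) set" where
  "regular k = {(p, t). p \<in> C \<and> t \<in> {0..1} \<and> (p, t) \<notin> meets k \<and>
     (\<forall>s\<in>\<rat>. 0 < s \<longrightarrow> emeasure mu (strip t (proj t p) s) \<le> ennreal (real (k+1) * s))}"

text \<open>With aperture \<open>s = 1 / real (j+1)\<close> the mass allowed is
  \<open>r * s / 10000\<close>: small compared with the width of the cone, not merely with its
  radius. One parameter serves as both aperture and largest radius.\<close>

definition sparse :: "nat \<Rightarrow> ((real \<times> real) \<times> real) set" where
  "sparse j = {(p, t). p \<in> C \<and> t \<in> {0..1} \<and>
     (\<forall>r\<in>\<rat>. 0 < r \<and> r \<le> 1 / real (j+1) \<longrightarrow>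
        emeasure mu (slope_cone p r t (1 / real (j+1))) \<le> ennreal (r / (10000 * real (j+1))))}"

text \<open>Bounding the horizontal distance below by \<open>1 / real (j+1)\<close> turns the
  existential into a projection of a compact set, so \<open>meets k\<close> is a countable union of
  compact sets.\<close>

lemma meets_borel [measurable]: "meets k \<in> sets borel"
proof -
  define Q where "Q = (\<lambda>j::nat. {z :: ((real \<times> real) \<times> real) \<times> (real \<times> real).
     1 / real (j+1) \<le> \<bar>fst (snd z) - fst (fst (fst z))\<bar> \<and> \<bar>fst (snd z) - fst (fst (fst z))\<bar> \<le> 1 / real (k+1) \<and>
     proj (snd (fst z)) (snd z) = proj (snd (fst z)) (fst (fst z))})"
  have "closed (Q j)" for j
    unfolding Q_def by (intro closed_Collect_conj closed_Collect_le closed_Collect_eq continuous_intros)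
  then have cp: "compact (((C \<times> {0..1}) \<times> C) \<inter> Q j)" for j
    by (intro compact_Int_closed compact_Times comp compact_Icc)
  have "compact (fst ` (((C \<times> {0..1}) \<times> C) \<inter> Q j))" for j
    by (rule compact_continuous_image[OF _ cp]) (intro continuous_intros)
  then have "fst ` (((C \<times> {0..1}) \<times> C) \<inter> Q j) \<in> sets borel" for j
    by (intro borel_closed compact_imp_closed)
  moreover have "meets k = (\<Union>j. fst ` (((C \<times> {0..1}) \<times> C) \<inter> Q j))"
  proof (intro equalityI subsetI)
    fix x assume "x \<in> meets k"
    then obtain p t q where x: "x = (p, t)" "p \<in> C" "t \<in> {0..1}" "q \<in> C" "0 < \<bar>fst q - fst p\<bar>"
      "\<bar>fst q - fst p\<bar> \<le> 1 / real (k+1)" "proj t q = proj t p"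
      by (auto simp: meets_def)
    obtain j where "1 / real (Suc j) < \<bar>fst q - fst p\<bar>" using x(5) nat_approx_posE by blast
    then have "((p, t), q) \<in> ((C \<times> {0..1}) \<times> C) \<inter> Q j"
      using x by (auto simp: Q_def)
    then show "x \<in> (\<Union>j. fst ` (((C \<times> {0..1}) \<times> C) \<inter> Q j))" using x(1) by force
  next
    fix x assume "x \<in> (\<Union>j. fst ` (((C \<times> {0..1}) \<times> C) \<inter> Q j))"
    then obtain j p t q where x: "x = (p, t)" "p \<in> C" "t \<in> {0..1}" "q \<in> C" "((p, t), q) \<in> Q j"
      by force
    have "0 < 1 / real (j+1)" by simp
    moreover have "1 / real (j+1) \<le> \<bar>fst q - fst p\<bar>" using x(5) by (simp add: Q_def)
    ultimately have "0 < \<bar>fst q - fst p\<bar>" by (rule less_le_trans)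
    then show "x \<in> meets k" using x by (auto simp: meets_def Q_def)
  qed
  ultimately show ?thesis by simp
qed

lemma base_borel [measurable]: "(C \<times> {0..1::real}) \<in> sets borel"
  using comp by (intro borel_closed closed_Times compact_imp_closed) auto

lemma regular_borel [measurable]: "regular k \<in> sets borel"
proof -
  have "{x. (case x of (p, t) \<Rightarrow> emeasure mu (strip t (proj t p) s)) \<le> ennreal (real (k+1) * s)} \<in> sets borel" for s
    using borel_measurable_le[OF strip_measure_measurable[of s] measurable_const[of "ennreal (real (k+1) * s)"]]
    by simp
  then have "(\<Inter>s\<in>{s\<in>\<rat>. 0 < s}. {x. (case x of (p, t) \<Rightarrow> emeasure mu (strip t (proj t p) s)) \<le> ennreal (real (k+1) * s)}) \<in> sets borel"
    by (intro sets.countable_INT'') (auto intro: countable_subset[OF _ countable_rat])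
  moreover have "regular k = ((C \<times> {0..1}) - meets k) \<inter>
    (\<Inter>s\<in>{s\<in>\<rat>. 0 < s}. {x. (case x of (p, t) \<Rightarrow> emeasure mu (strip t (proj t p) s)) \<le> ennreal (real (k+1) * s)})"
    by (auto simp: regular_def)
  ultimately show ?thesis by simp
qed

lemma sparse_borel [measurable]: "sparse j \<in> sets borel"
proof -
  have "{x. (case x of (p, t) \<Rightarrow> emeasure mu (slope_cone p r t (1 / real (j+1)))) \<le> ennreal (r / (10000 * real (j+1)))} \<in> sets borel" for r
    using borel_measurable_le[OF slope_cone_measure_measurable[of r "1 / real (j+1)"] measurable_const[of "ennreal (r / (10000 * real (j+1)))"]]
    by simp
  then have "(\<Inter>r\<in>{r\<in>\<rat>. 0 < r \<and> r \<le> 1 / real (j+1)}. {x. (case x of (p, t) \<Rightarrow> emeasure mu (slope_cone p r t (1 / real (j+1)))) \<le> ennreal (r / (10000 * real (j+1)))}) \<in> sets borel"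
    by (intro sets.countable_INT'') (auto intro: countable_subset[OF _ countable_rat])
  moreover have "sparse j = (C \<times> {0..1}) \<inter>
    (\<Inter>r\<in>{r\<in>\<rat>. 0 < r \<and> r \<le> 1 / real (j+1)}. {x. (case x of (p, t) \<Rightarrow> emeasure mu (slope_cone p r t (1 / real (j+1)))) \<le> ennreal (r / (10000 * real (j+1)))})"
    by (auto simp: sparse_def)
  ultimately show ?thesis by simp
qed

lemma regular_strip:
  assumes "(p, t) \<in> regular k" "s > 0"
  shows "emeasure mu (strip t (proj t p) s) \<le> ennreal (2 * real (k+1) * s)"
proof -
  obtain s' where s': "s' \<in> \<rat>" "s < s'" "s' < 2 * s"
    using Rats_dense_in_real[of s "2 * s"] assms(2) by auto
  have "emeasure mu (strip t (proj t p) s) \<le> emeasure mu (strip t (proj t p) s')"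
    by (rule emeasure_mono) (use s' closed_strip in \<open>auto simp: strip_def\<close>)
  also have "\<dots> \<le> ennreal (real (k+1) * s')"
    using assms s' by (auto simp: regular_def)
  also have "\<dots> \<le> ennreal (2 * real (k+1) * s)"
  proof (rule ennreal_leI)
    have "real (k+1) * s' \<le> real (k+1) * (2 * s)" using s' by (intro mult_left_mono) auto
    then show "real (k+1) * s' \<le> 2 * real (k+1) * s" by (simp only: mult_ac)
  qed
  finally show ?thesis .
qed

lemma negligible_proj_maximal:
  assumes t: "t \<in> {0..1}"
  shows "negligible {y. \<forall>k::nat. \<exists>s>0. emeasure mu (strip t y s) > ennreal (real k * s)}"
proof -
  let ?N = "distr mu borel (proj t)"
  have m: "proj t \<in> borel_measurable mu"
    unfolding measurable_cong_sets[OF sets_mu refl]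
    by (rule borel_measurable_continuous_onI) (intro continuous_intros)
  have "emeasure ?N (cball y s) = emeasure mu (strip t y s)" for y s
    by (subst emeasure_distr[OF m]) (auto simp: strip_def vimage_def dist_real_def abs_minus_commute intro!: arg_cong[where f = "emeasure mu"])
  moreover have "emeasure ?N UNIV < \<infinity>"
    using emeasure_mu_UNIV by (subst emeasure_distr[OF m]) auto
  ultimately show ?thesis
    using maximal_function_finite_ae[of ?N] by simp
qed

text \<open>Eilenberg's inequality: a fibre with infinitely many points meets arbitrarily many of the
  vertical slabs of width \<open>1/2^k\<close>, while the projections of the slabs have bounded total length.\<close>

lemma negligible_infinite_fibres:
  assumes t: "t \<in> {0..1}" and C01: "fst ` C \<subseteq> {0..1}"
  shows "negligible {y. infinite {p \<in> C. proj t p = y}}" (is "negligible ?Y")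
proof -
  \<comment> \<open>Half-open slabs, hence disjoint; the index reaches \<open>2^k\<close> because
    the first coordinate may equal 1.\<close>
  define S where "S = (\<lambda>k i. {p \<in> C. \<lfloor>2 ^ k * fst p\<rfloor> = int i})"
  have S_borel: "S k i \<in> sets borel" for k i
  proof -
    have "S k i = C \<inter> (\<lambda>p. \<lfloor>2 ^ k * fst p\<rfloor>) -` {int i} \<inter> space borel" by (auto simp: S_def)
    moreover have "(\<lambda>p :: real \<times> real. \<lfloor>2 ^ k * fst p\<rfloor>) \<in> measurable borel (count_space UNIV)"
      by (rule measurable_compose[OF _ measurable_real_floor], rule borel_measurable_continuous_onI)
         (intro continuous_intros)
    ultimately show ?thesis
      using measurable_sets[of "\<lambda>p :: real \<times> real. \<lfloor>2 ^ k * fst p\<rfloor>" borel "count_space UNIV" "{int i}"] C_borel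
      by (simp add: Int_assoc)
  qed
  have "\<exists>T\<in>sets borel. proj t ` S k i \<subseteq> T \<and> emeasure lborel T \<le> 4 * emeasure mu (S k i)" for k i
  proof -
    have SC: "C \<inter> S k i = S k i" by (auto simp: S_def)
    have "hausdorff_measure 1 (S k i) < top"
      using hausdorff_measure_mono[of "S k i" C 1] H1_finite by (auto simp: S_def intro: le_less_trans)
    then have "outer_measure_of lborel (proj t ` S k i) \<le> ennreal (2 * 2) * hausdorff_measure 1 (S k i)"
      by (intro outer_measure_lipschitz_image_le proj_lipschitz t) auto
    moreover obtain E where "E \<in> sets borel" "proj t ` S k i \<subseteq> E" "outer_measure_of lborel (proj t ` S k i) = emeasure lborel E"
      using outer_measure_of_attain[of "proj t ` S k i" lborel] by auto
    ultimately show ?thesis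
      using S_borel[of k i] by (intro bexI[of _ E]) (simp_all add: emeasure_mu SC)
  qed
  then obtain T where T: "\<And>k i. T k i \<in> sets borel" "\<And>k i. proj t ` S k i \<subseteq> T k i"
      "\<And>k i. emeasure lborel (T k i) \<le> 4 * emeasure mu (S k i)"
    by metis
  \<comment> \<open>Counts the slabs whose enclosed projection contains \<open>y\<close>; the factor
    4 in its integral is twice the Lipschitz constant 2 of \<open>proj t\<close>.\<close>
  define g where "g = (\<lambda>k y. \<Sum>i\<le>2^k. indicator (T k i) y :: ennreal)"
  have g_meas [measurable]: "g k \<in> borel_measurable borel" for k
    unfolding g_def using T(1) by measurable
  have int_g: "(\<integral>\<^sup>+y. g k y \<partial>lborel) \<le> 4 * emeasure mu UNIV" for k
  proof -
    have "(\<integral>\<^sup>+y. g k y \<partial>lborel) = (\<Sum>i\<le>2^k. emeasure lborel (T k i))"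
      unfolding g_def using T(1) by (subst nn_integral_sum) auto
    also have "\<dots> \<le> (\<Sum>i\<le>2^k. 4 * emeasure mu (S k i))" by (intro sum_mono T)
    also have "\<dots> = 4 * (\<Sum>i\<le>2^k. emeasure mu (S k i))" by (simp add: sum_distrib_left)
    also have "(\<Sum>i\<le>2^k. emeasure mu (S k i)) = emeasure mu (\<Union>i\<le>2^k. S k i)"
      by (rule sum_emeasure) (use S_borel in \<open>auto simp: disjoint_family_on_def S_def\<close>)
    also have "\<dots> \<le> emeasure mu UNIV" by (intro emeasure_mono) auto
    finally show ?thesis by (simp add: mult_left_mono)
  qed
  \<comment> \<open>Fatou's lemma: the counts have bounded integrals, so their lower limit is finite
    almost everywhere.\<close>
  have "(\<integral>\<^sup>+y. liminf (\<lambda>k. g k y) \<partial>lborel) \<le> liminf (\<lambda>k. \<integral>\<^sup>+y. g k y \<partial>lborel)"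
    by (rule nn_integral_liminf) measurable
  also have "\<dots> \<le> 4 * emeasure mu UNIV"
  proof -
    have "liminf (\<lambda>k. \<integral>\<^sup>+y. g k y \<partial>lborel) \<le> liminf (\<lambda>k::nat. 4 * emeasure mu UNIV)"
      by (rule Liminf_mono) (use int_g in auto)
    also have "\<dots> = 4 * emeasure mu UNIV" by (rule Liminf_const) simp
    finally show ?thesis .
  qed
  also have "\<dots> < \<infinity>" using emeasure_mu_UNIV by (simp add: ennreal_mult_less_top)
  finally have fin: "(\<integral>\<^sup>+y. liminf (\<lambda>k. g k y) \<partial>lborel) < \<infinity>" .
  have "AE y in lborel. liminf (\<lambda>k. g k y) \<noteq> \<infinity>"
    by (rule nn_integral_PInf_AE) (use fin in auto)
  moreover have "liminf (\<lambda>k. g k y) = \<infinity>" if y: "y \<in> ?Y" for y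
  proof -
    have big: "of_nat N \<le> liminf (\<lambda>k. g k y)" for N :: nat
    proof -
      obtain P where P: "finite P" "card P = N" "P \<subseteq> {p \<in> C. proj t p = y}"
        using infinite_arbitrarily_large[of "{p \<in> C. proj t p = y}" N] y by auto
      \<comment> \<open>On one fibre the first coordinate determines the point, so finitely many
        fibre points are horizontally separated and eventually occupy different slabs.\<close>
      have inj: "inj_on fst P"
      proof (rule inj_onI)
        fix p q assume pq: "p \<in> P" "q \<in> P" "fst p = fst q"
        then have "proj t p = proj t q" using P(3) by auto
        then show "p = q" using pq(3) by (simp add: proj_def prod_eq_iff)
      qed
      have "\<exists>e>0. \<forall>p\<in>P. \<forall>q\<in>P. p \<noteq> q \<longrightarrow> e \<le> \<bar>fst p - fst q\<bar>"
      proof -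
        let ?D = "(\<lambda>(p, q). \<bar>fst p - fst q\<bar>) ` {(p, q) \<in> P \<times> P. p \<noteq> q}"
        have "finite {(p, q) \<in> P \<times> P. p \<noteq> q}"
          by (rule finite_subset[of _ "P \<times> P"]) (use P(1) in auto)
        then have "finite ?D" by (rule finite_imageI)
        moreover have "\<forall>d\<in>?D. d > 0"
        proof
          fix d assume "d \<in> ?D"
          then obtain z where z: "d = (case z of (p, q) \<Rightarrow> \<bar>fst p - fst q\<bar>)" "z \<in> {(p, q) \<in> P \<times> P. p \<noteq> q}"
            by (rule imageE)
          have "fst z \<in> P" "snd z \<in> P" "fst z \<noteq> snd z" using z(2) by (simp_all add: case_prod_beta mem_Times_iff)
          then have "fst (fst z) \<noteq> fst (snd z)" using inj_onD[OF inj] by blast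
          then show "d > 0" using z(1) by (simp add: case_prod_beta)
        qed
        ultimately have "0 < Min (insert 1 ?D)" by (subst Min_gr_iff) auto
        moreover have "Min (insert 1 ?D) \<le> \<bar>fst p - fst q\<bar>" if "p \<in> P" "q \<in> P" "p \<noteq> q" for p q
          using \<open>finite ?D\<close> that by (intro Min_le) auto
        ultimately show ?thesis by blast
      qed
      then obtain e where e: "e > 0" "\<And>p q. p \<in> P \<Longrightarrow> q \<in> P \<Longrightarrow> p \<noteq> q \<Longrightarrow> e \<le> \<bar>fst p - fst q\<bar>" by blast
      obtain k0 :: nat where k0: "(1/2::real) ^ k0 < e" using real_arch_pow_inv[of e "1/2"] e by auto
      have "of_nat N \<le> g k y" if k: "k \<ge> k0" for k
      proof -
        define ix where "ix = (\<lambda>p :: real \<times> real. nat \<lfloor>2 ^ k * fst p\<rfloor>)"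
        have range01: "0 \<le> fst p \<and> fst p \<le> 1" if "p \<in> P" for p
        proof -
          have "fst p \<in> {0..1}" using that P(3) C01 by blast
          then show ?thesis by simp
        qed
        have small: "(1/2::real) ^ k < e"
          by (rule le_less_trans[OF power_decreasing k0]) (use k in auto)
        have inj_ix: "inj_on ix P"
        proof (rule inj_onI, rule ccontr)
          fix p q assume pq: "p \<in> P" "q \<in> P" "ix p = ix q" "p \<noteq> q"
          then have "\<lfloor>2 ^ k * fst p\<rfloor> = \<lfloor>2 ^ k * fst q\<rfloor>"
            using range01[of p] range01[of q] by (auto simp: ix_def nat_eq_iff)
          then have "\<bar>2 ^ k * fst p - 2 ^ k * fst q\<bar> < 1" by linarith
          also have "\<bar>2 ^ k * fst p - 2 ^ k * fst q\<bar> = 2 ^ k * \<bar>fst p - fst q\<bar>"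
            by (simp add: abs_mult flip: right_diff_distrib)
          finally have "\<bar>fst p - fst q\<bar> < (1/2) ^ k" by (simp add: field_simps)
          then show False using e(2)[OF pq(1,2,4)] small by linarith
        qed
        have sub: "ix ` P \<subseteq> {i. i \<le> 2 ^ k \<and> y \<in> T k i}"
        proof safe
          fix p assume p: "p \<in> P"
          have "2 ^ k * fst p \<le> 2 ^ k" using range01[OF p] by simp
          then have "of_int \<lfloor>2 ^ k * fst p\<rfloor> \<le> (2 ^ k :: real)" using of_int_floor_le order_trans by blast
          then have "\<lfloor>2 ^ k * fst p\<rfloor> \<le> 2 ^ k" by (metis of_int_le_iff of_int_numeral of_int_power)
          then show "ix p \<le> 2 ^ k" by (simp add: ix_def nat_le_iff)
          have "p \<in> S k (ix p)" using p P(3) range01[OF p] by (auto simp: S_def ix_def)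
          then show "y \<in> T k (ix p)" using T(2)[of k "ix p"] p P(3) by auto
        qed
        have "N = card (ix ` P)" using P(2) card_image[OF inj_ix] by simp
        also have "\<dots> \<le> card {i. i \<le> 2 ^ k \<and> y \<in> T k i}" by (rule card_mono[OF _ sub]) auto
        finally have "of_nat N \<le> (of_nat (card {i. i \<le> 2 ^ k \<and> y \<in> T k i}) :: ennreal)" by simp
        also have "\<dots> = g k y"
          unfolding g_def by (simp add: indicator_def sum.If_cases Int_def)
        finally show ?thesis .
      qed
      then show ?thesis
        by (intro Liminf_bounded) (auto simp: eventually_sequentially)
    qed
    show ?thesis
    proof (rule ccontr)
      assume "liminf (\<lambda>k. g k y) \<noteq> \<infinity>"
      then obtain N :: nat where "liminf (\<lambda>k. g k y) < of_nat N"
        using ennreal_Ex_less_of_nat by (auto simp: less_top)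
      then show False using big[of N] by simp
    qed
  qed
  ultimately have "AE y in lborel. y \<notin> ?Y" by (auto elim: eventually_mono)
  then obtain N where "N \<in> null_sets lborel" "{y \<in> space lborel. \<not> y \<notin> ?Y} \<subseteq> N"
    by (rule AE_E3) auto
  then show ?thesis
    by (intro negligible_small_cover bexI[of _ N]) (auto simp: null_sets_def)
qed

end

section \<open>From regular directions to null projections\<close>

lemma hausdorff_measure_singleton [simp]: "hausdorff_measure 1 {x} = 0"
proof -
  have "hausdorff_content 1 \<delta> {x} \<le> 0" if "\<delta> > 0" for \<delta>
    using hausdorff_content_le_suminf[of "{x}" "\<lambda>_. {x}" \<delta> 1] that by simp
  then have "hausdorff_measure 1 {x} \<le> 0"
    unfolding hausdorff_measure_def by (intro SUP_least) auto
  then show ?thesis by simp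
qed

context besicovitch
begin

lemma slice_borel:
  fixes A :: "((real \<times> real) \<times> real) set"
  assumes "A \<in> sets borel"
  shows "{t. (p, t) \<in> A} \<in> sets borel" "{p. (p, t) \<in> A} \<in> sets borel"
proof -
  have "(\<lambda>t. (p, t)) \<in> borel_measurable borel" "(\<lambda>p. (p, t)) \<in> borel_measurable borel"
    by (auto intro!: borel_measurable_continuous_onI continuous_intros)
  from measurable_sets[OF this(1) assms] measurable_sets[OF this(2) assms]
  show "{t. (p, t) \<in> A} \<in> sets borel" "{p. (p, t) \<in> A} \<in> sets borel"
    by (simp_all add: vimage_def)
qed

text \<open>At a density point \<open>t\<close> of the regular directions at \<open>p\<close>, a thin cone around \<open>t\<close> carries no mass
  in regular directions, and the remaining directions are covered by a small total length of
  intervals, each comparable to an interval centred at a regular direction.\<close>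

lemma sparse_at_density_point:
  assumes t: "(p, t) \<in> regular k"
    and dens: "\<And>e. e > 0 \<Longrightarrow> \<exists>s0>0. \<forall>s. 0 < s \<and> s < s0 \<longrightarrow>
      emeasure lborel (cball t s - {t. (p, t) \<in> regular k}) \<le> ennreal (e * s)"
  shows "\<exists>j. (p, t) \<in> sparse j"
proof -
  define T where "T = {t. (p, t) \<in> regular k}"
  have T_borel: "T \<in> sets borel" unfolding T_def by (rule slice_borel) measurable
  \<comment> \<open>280000 is 14 * 2 * 10000: the factor 14 comes from the strip bound below, 2 from
    \<open>JF\<close>, and 10000 from \<open>sparse\<close>.\<close>
  define e where "e = 1 / (280000 * real (k+1))"
  have e: "0 < e" "e < 1" by (auto simp: e_def field_simps)
  obtain s0 where s0: "s0 > 0" "\<And>s. 0 < s \<Longrightarrow> s < s0 \<Longrightarrow> emeasure lborel (cball t s - T) \<le> ennreal (e * s)"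
    using dens[OF e(1)] unfolding T_def by blast
  obtain j0 :: nat where j0: "1 / real (Suc j0) < s0" using s0(1) nat_approx_posE by blast
  \<comment> \<open>\<open>j0\<close> makes the aperture a scale at which density holds;
    \<open>k\<close> keeps the cone within the radius where \<open>meets k\<close> is
    excluded.\<close>
  define j where "j = max j0 k"
  define s where "s = 1 / real (j+1)"
  have "1 / real (j+1) \<le> 1 / real (Suc j0)" by (intro divide_left_mono) (auto simp: j_def)
  then have s: "0 < s" "s < s0" using j0 by (auto simp: s_def)
  have sk: "s \<le> 1 / real (k+1)" unfolding s_def by (intro divide_left_mono) (auto simp: j_def)
  define J where "J = cball t s"
  \<comment> \<open>A closed inner approximation, so that every direction outside \<open>F\<close>
    has positive distance to it.\<close>
  obtain F where F: "closed F" "F \<subseteq> J \<inter> T" "emeasure lebesgue (J \<inter> T - F) < ennreal (e * s)"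
  proof (rule sets_lebesgue_inner_closed[of "J \<inter> T" "e * s"])
    show "J \<inter> T \<in> sets lebesgue" using T_borel by (simp add: J_def)
    show "0 < e * s" using e s by simp
  qed (rule that)
  have J_borel: "J \<in> sets borel" by (simp add: J_def)
  have JF: "emeasure lborel (J - F) \<le> ennreal (2 * e * s)"
  proof -
    have "emeasure lborel (J - F) \<le> emeasure lborel ((J - T) \<union> (J \<inter> T - F))"
      using T_borel J_borel F by (intro emeasure_mono) auto
    also have "\<dots> \<le> emeasure lborel (J - T) + emeasure lborel (J \<inter> T - F)"
      using T_borel J_borel F by (intro emeasure_subadditive) auto
    also have "\<dots> \<le> ennreal (e * s) + ennreal (e * s)"
      using s0(2)[OF s] F T_borel J_borel by (intro add_mono) (auto simp: J_def)
    also have "\<dots> = ennreal (2 * e * s)" using e s by (simp flip: ennreal_plus)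
    finally show ?thesis .
  qed
  have "F \<noteq> {}"
  proof
    assume "F = {}"
    then have "ennreal (2 * s) \<le> ennreal (2 * e * s)"
      using JF s by (simp add: J_def cball_eq_atLeastAtMost)
    then show False using e s by simp
  qed
  have pC: "p \<in> C" "t \<in> {0..1}" using t by (auto simp: regular_def)
  have "emeasure mu (slope_cone p r t s) \<le> ennreal (r / (10000 * real (j+1)))" if r: "0 < r" "r \<le> s" for r
  proof -
    define A0 where "A0 = {q :: real \<times> real. 0 < \<bar>fst q - fst p\<bar> \<and> \<bar>fst q - fst p\<bar> \<le> r}"
    \<comment> \<open>The direction in which \<open>p\<close> and \<open>q\<close> have the same
      projection.\<close>
    define sl where "sl = (\<lambda>q :: real \<times> real. - (snd q - snd p) / (fst q - fst p))"
    have A0_borel: "A0 \<in> sets borel"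
      unfolding A0_def Collect_conj_eq
      by (intro sets.Int borel_open borel_closed open_Collect_less closed_Collect_le continuous_intros)
    have sl_meas: "sl \<in> borel_measurable borel"
      unfolding sl_def
      by (intro borel_measurable_divide borel_measurable_continuous_onI continuous_intros)
    \<comment> \<open>The mass of \<open>C\<close> near \<open>p\<close>, distributed according to
      the direction in which it is seen from \<open>p\<close>.\<close>
    define M where "M = distr (density mu (indicator A0)) borel sl"
    have emM: "emeasure M B = emeasure mu (A0 \<inter> sl -` B)" if "B \<in> sets borel" for B
    proof -
      have "sl -` B \<in> sets borel" using measurable_sets[OF sl_meas that] by simp
      then show ?thesis
        unfolding M_def using sl_meas that A0_borel
        by (subst emeasure_distr) (auto simp: emeasure_density simp flip: indicator_inter_arith)
    qed
    have sl_eq: "proj \<tau> q - proj \<tau> p = (\<tau> - sl q) * (fst q - fst p)" if "fst q \<noteq> fst p" for \<tau> q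
      using that by (simp add: proj_diff sl_def field_simps)
    \<comment> \<open>A point of \<open>C\<close> seen in a regular direction would lie on the same
      fibre within \<open>1 / real (k+1)\<close>, which \<open>regular\<close> forbids.\<close>
    have MF: "emeasure M F = 0"
    proof -
      have "C \<inter> (A0 \<inter> sl -` F) = {}"
      proof (rule equals0I)
        fix q assume q: "q \<in> C \<inter> (A0 \<inter> sl -` F)"
        then have "(p, sl q) \<in> regular k" using F(2) by (auto simp: T_def)
        moreover have "proj (sl q) q = proj (sl q) p"
          using sl_eq[of q "sl q"] q by (auto simp: A0_def)
        ultimately show False
          using q r sk by (auto simp: regular_def meets_def A0_def)
      qed
      then show ?thesis
        using F(1) A0_borel measurable_sets[OF sl_meas, of F] by (simp add: emM emeasure_mu)
    qed
    have MJF: "emeasure M (J - F) \<le> ennreal (14 * real (k+1) * r) * ennreal (2 * e * s)"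
    proof -
      \<comment> \<open>The nearest regular direction is at distance \<open>2 * d \<tau>\<close>, so
        the fivefold ball lies within \<open>7 * d \<tau>\<close> of it and its mass sits in a strip
        of half-width \<open>7 * d \<tau> * r\<close>.\<close>
      define d where "d = (\<lambda>\<tau>. infdist \<tau> F / 2)"
      obtain T' where T': "T' \<in> sets borel" "J - F \<subseteq> T'"
        "emeasure M T' \<le> ennreal (14 * real (k+1) * r) * emeasure lborel (UNIV \<inter> (J - F))"
      proof (rule vitali_measure_bound[where M = M and N = lborel and A = "J - F" and S = "J - F" and V = UNIV
              and r = d and B = s and c = "ennreal (14 * real (k+1) * r)"])
        show "sets M = sets borel" by (simp add: M_def)
        fix \<tau> assume \<tau>: "\<tau> \<in> J - F"
        obtain \<tau>' where \<tau>': "\<tau>' \<in> F" "infdist \<tau> F = dist \<tau> \<tau>'"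
          using infdist_attains_inf[OF F(1) \<open>F \<noteq> {}\<close>] by blast
        have pos: "infdist \<tau> F > 0"
          using \<tau> F(1) \<open>F \<noteq> {}\<close> by (intro infdist_pos_not_in_closed) auto
        have "\<tau>' \<in> J" using \<tau>' F by auto
        then have "dist \<tau> \<tau>' \<le> 2 * s"
          using \<tau> by (auto simp: J_def dist_real_def)
        then show d: "0 < d \<tau> \<and> d \<tau> \<le> s" using pos \<tau>' by (auto simp: d_def)
        have cbF: "cball \<tau> (d \<tau>) \<inter> F = {}"
        proof (rule equals0I)
          fix x assume x: "x \<in> cball \<tau> (d \<tau>) \<inter> F"
          then have "infdist \<tau> F \<le> dist \<tau> x" by (intro infdist_le) auto
          then show False using x pos by (auto simp: d_def)
        qed
        \<comment> \<open>The half of the small interval pointing towards the centre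
          \<open>t\<close> stays in \<open>J\<close>, and it misses \<open>F\<close>.\<close>
        have "ennreal (d \<tau>) \<le> emeasure lborel (cball \<tau> (d \<tau>) \<inter> (J - F))"
        proof (cases "\<tau> \<le> t")
          case True
          have "{\<tau>..\<tau> + d \<tau>} \<subseteq> cball \<tau> (d \<tau>) \<inter> (J - F)"
          proof
            fix x assume x: "x \<in> {\<tau>..\<tau> + d \<tau>}"
            then have 1: "x \<in> cball \<tau> (d \<tau>)" by (simp add: dist_real_def)
            have 2: "x \<in> J" using x True \<tau> d unfolding J_def by (simp add: dist_real_def abs_le_iff)
            show "x \<in> cball \<tau> (d \<tau>) \<inter> (J - F)" using 1 2 cbF by blast
          qed
          then have "emeasure lborel {\<tau>..\<tau> + d \<tau>} \<le> emeasure lborel (cball \<tau> (d \<tau>) \<inter> (J - F))"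
            using F by (intro emeasure_mono) (auto simp: J_def)
          then show ?thesis using d by simp
        next
          case False
          have "{\<tau> - d \<tau>..\<tau>} \<subseteq> cball \<tau> (d \<tau>) \<inter> (J - F)"
          proof
            fix x assume x: "x \<in> {\<tau> - d \<tau>..\<tau>}"
            then have 1: "x \<in> cball \<tau> (d \<tau>)" by (simp add: dist_real_def)
            have 2: "x \<in> J" using x False \<tau> d unfolding J_def by (simp add: dist_real_def abs_le_iff)
            show "x \<in> cball \<tau> (d \<tau>) \<inter> (J - F)" using 1 2 cbF by blast
          qed
          then have "emeasure lborel {\<tau> - d \<tau>..\<tau>} \<le> emeasure lborel (cball \<tau> (d \<tau>) \<inter> (J - F))"
            using F by (intro emeasure_mono) (auto simp: J_def)
          then show ?thesis using d by simp
        qed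
        moreover have "emeasure M (cball \<tau> (5 * d \<tau>)) \<le> ennreal (14 * real (k+1) * r) * ennreal (d \<tau>)"
        proof -
          have "emeasure M (cball \<tau> (5 * d \<tau>)) = emeasure mu (A0 \<inter> sl -` cball \<tau> (5 * d \<tau>))"
            by (rule emM) simp
          also have "\<dots> \<le> emeasure mu (strip \<tau>' (proj \<tau>' p) (7 * d \<tau> * r))"
          proof (rule emeasure_mono)
            show "A0 \<inter> sl -` cball \<tau> (5 * d \<tau>) \<subseteq> strip \<tau>' (proj \<tau>' p) (7 * d \<tau> * r)"
            proof
              fix q assume q: "q \<in> A0 \<inter> sl -` cball \<tau> (5 * d \<tau>)"
              then have q1: "fst q \<noteq> fst p" "\<bar>fst q - fst p\<bar> \<le> r" "\<bar>\<tau> - sl q\<bar> \<le> 5 * d \<tau>"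
                by (auto simp: A0_def dist_real_def)
              have "\<bar>\<tau> - \<tau>'\<bar> = 2 * d \<tau>" using \<tau>' by (simp add: d_def dist_real_def)
              then have "\<bar>\<tau>' - sl q\<bar> \<le> 7 * d \<tau>" using q1(3) by linarith
              then have "\<bar>(\<tau>' - sl q) * (fst q - fst p)\<bar> \<le> 7 * d \<tau> * r"
                unfolding abs_mult using q1(2) d by (intro mult_mono) auto
              then show "q \<in> strip \<tau>' (proj \<tau>' p) (7 * d \<tau> * r)"
                using sl_eq[OF q1(1), of \<tau>'] by (simp add: strip_def)
            qed
          qed (use closed_strip in auto)
          also have "\<dots> \<le> ennreal (2 * real (k+1) * (7 * d \<tau> * r))"
            using \<tau>' F(2) d r by (intro regular_strip) (auto simp: T_def)
          also have "2 * real (k+1) * (7 * d \<tau> * r) = 14 * real (k+1) * r * d \<tau>" by simp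
          also have "ennreal \<dots> = ennreal (14 * real (k+1) * r) * ennreal (d \<tau>)"
            using r d by (intro ennreal_mult) auto
          finally show ?thesis .
        qed
        ultimately show "emeasure M (cball \<tau> (5 * d \<tau>)) \<le> ennreal (14 * real (k+1) * r) * emeasure lborel (cball \<tau> (d \<tau>) \<inter> (J - F))"
          by (meson mult_left_mono order_trans zero_le)
      qed (use F J_borel in auto)
      have "emeasure M (J - F) \<le> emeasure M T'"
        using T' by (intro emeasure_mono) (auto simp: M_def)
      also note T'(3)
      also have "ennreal (14 * real (k+1) * r) * emeasure lborel (UNIV \<inter> (J - F)) \<le> ennreal (14 * real (k+1) * r) * ennreal (2 * e * s)"
        using JF by (intro mult_left_mono) auto
      finally show ?thesis .
    qed
    have sub: "slope_cone p r t s \<subseteq> {p} \<union> ((A0 \<inter> sl -` F) \<union> (A0 \<inter> sl -` (J - F)))"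
    proof
      fix q assume q: "q \<in> slope_cone p r t s"
      show "q \<in> {p} \<union> ((A0 \<inter> sl -` F) \<union> (A0 \<inter> sl -` (J - F)))"
      proof (cases "fst q = fst p")
        case True
        then have "q = p" using q by (auto simp: slope_cone_def proj_def prod_eq_iff)
        then show ?thesis by simp
      next
        case False
        then have "\<bar>t - sl q\<bar> * \<bar>fst q - fst p\<bar> \<le> s * \<bar>fst q - fst p\<bar>"
          using q sl_eq[OF False, of t] by (simp add: slope_cone_def abs_mult)
        then have "\<bar>t - sl q\<bar> \<le> s" using False by simp
        then show ?thesis using q False by (auto simp: J_def A0_def slope_cone_def dist_real_def)
      qed
    qed
    have b: "A0 \<inter> sl -` F \<in> sets borel" "A0 \<inter> sl -` (J - F) \<in> sets borel"
      using measurable_sets[OF sl_meas, of F] measurable_sets[OF sl_meas, of "J - F"] F(1) J_borel A0_borel by auto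
    have "emeasure mu (slope_cone p r t s) \<le> emeasure mu ({p} \<union> ((A0 \<inter> sl -` F) \<union> (A0 \<inter> sl -` (J - F))))"
      using b by (intro emeasure_mono sub) auto
    also have "\<dots> \<le> emeasure mu {p} + (emeasure mu (A0 \<inter> sl -` F) + emeasure mu (A0 \<inter> sl -` (J - F)))"
      using b by (intro order_trans[OF emeasure_subadditive] add_mono order_refl) auto
    also have "emeasure mu {p} = 0" using pC by (simp add: emeasure_mu)
    also have "emeasure mu (A0 \<inter> sl -` F) = 0" using MF F(1) by (simp add: emM)
    also have "emeasure mu (A0 \<inter> sl -` (J - F)) = emeasure M (J - F)" using F(1) J_borel by (simp add: emM)
    also have "0 + (0 + emeasure M (J - F)) \<le> ennreal (14 * real (k+1) * r) * ennreal (2 * e * s)" using MJF by simp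
    also have "\<dots> = ennreal (14 * real (k+1) * r * (2 * e * s))"
      using r e s by (simp add: ennreal_mult)
    also have "14 * real (k+1) * r * (2 * e * s) = r / (10000 * real (j+1))"
    proof -
      have "14 * K * r * (2 * (1 / (280000 * K)) * (1 / N)) = r / (10000 * N)" if "K > 0" "N > 0" for K N :: real
        using that by (simp add: field_simps)
      from this[of "real (k+1)" "real (j+1)"] show ?thesis unfolding e_def s_def by (simp only: of_nat_0_less_iff add_gr_0 zero_less_one disj_not1 simp_thms)
    qed
    finally show ?thesis .
  qed
  then have "(p, t) \<in> sparse j"
    using pC by (auto simp: sparse_def s_def)
  then show ?thesis ..
qed

lemma regular_not_sparse_negligible:
  "negligible {t. (p, t) \<in> regular k - (\<Union>j. sparse j)}"
proof -
  have "{t. (p, t) \<in> regular k} \<in> sets borel" by (rule slice_borel) measurable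
  from lebesgue_density[OF this] show ?thesis
    by (rule negligible_subset) (use sparse_at_density_point[of p _ k] in blast)
qed

text \<open>Some cover of \<open>E\<close> has total diameter below twice its length. If every
  member carried mass at most half its diameter, the total mass would be too small. Closures make
  the pieces Borel.\<close>

lemma dense_piece:
  assumes E: "E \<in> sets borel" "E \<subseteq> C" "emeasure mu E \<noteq> 0" and "\<delta> > 0"
  obtains U where "closed U" "bounded U" "0 < diameter U" "diameter U \<le> \<delta>"
    "ennreal (diameter U / 2) < emeasure mu (E \<inter> U)"
proof -
  have CE: "C \<inter> E = E" using E by auto
  define h where "h = measure mu E"
  have h: "hausdorff_measure 1 E = ennreal h" "h > 0" "emeasure mu E = ennreal h"
    using E emeasure_mu[OF E(1)] emeasure_mu_ennreal[of E] unfolding CE h_def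
    by (auto simp: zero_less_measure_iff)
  have "hausdorff_content 1 \<delta> E \<le> hausdorff_measure 1 E" by (rule hausdorff_content_le_measure[OF \<open>\<delta> > 0\<close>])
  also have "\<dots> < ennreal (2 * h)" using h by (auto intro: ennreal_lessI)
  finally obtain U where U: "E \<subseteq> (\<Union>i. U i)" "\<And>i::nat. bounded (U i)" "\<And>i. diameter (U i) \<le> \<delta>"
    "(\<Sum>i. ennreal (diameter (U i) powr 1)) < ennreal (2 * h)"
    using hausdorff_content_cover by metis
  have "\<exists>i. ennreal (diameter (U i) / 2) < emeasure mu (E \<inter> closure (U i))"
  proof (rule ccontr)
    assume "\<not> ?thesis"
    then have le: "emeasure mu (E \<inter> closure (U i)) \<le> ennreal (diameter (U i) / 2)" for i
      by (auto simp: not_less)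
    have "E \<subseteq> (\<Union>i. E \<inter> closure (U i))"
    proof
      fix x assume x: "x \<in> E"
      then obtain i where "x \<in> U i" using U(1) by blast
      then have "x \<in> closure (U i)" by (rule subsetD[OF closure_subset])
      then show "x \<in> (\<Union>i. E \<inter> closure (U i))" using x by blast
    qed
    then have "emeasure mu E \<le> emeasure mu (\<Union>i. E \<inter> closure (U i))"
      using E(1) by (intro emeasure_mono) auto
    then have "ennreal 2 * emeasure mu E \<le> ennreal 2 * emeasure mu (\<Union>i. E \<inter> closure (U i))"
      by (intro mult_left_mono) auto
    also have "\<dots> \<le> ennreal 2 * (\<Sum>i. emeasure mu (E \<inter> closure (U i)))"
      using E by (intro mult_left_mono emeasure_subadditive_countably) auto
    also have "\<dots> \<le> ennreal 2 * (\<Sum>i. ennreal (diameter (U i) / 2))"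
      by (intro mult_left_mono suminf_le le) auto
    also have "\<dots> = (\<Sum>i. ennreal 2 * ennreal (diameter (U i) / 2))" by simp
    also have "\<dots> = (\<Sum>i. ennreal (diameter (U i) powr 1))"
      using diameter_ge_0[OF U(2)] by (intro suminf_cong) (simp add: ennreal_mult[symmetric] del: ennreal_numeral)
    also have "\<dots> < ennreal (2 * h)" by (rule U(4))
    finally show False using h by (simp add: ennreal_mult)
  qed
  then obtain i where i: "ennreal (diameter (U i) / 2) < emeasure mu (E \<inter> closure (U i))" ..
  have dc: "diameter (closure (U i)) = diameter (U i)" using U(2) by (rule diameter_closure)
  have bc: "bounded (closure (U i))" using U(2) by (rule bounded_closure)
  have "0 < diameter (U i)"
  proof (rule ccontr)
    assume "\<not> 0 < diameter (U i)"
    then have d0: "diameter (closure (U i)) = 0" using diameter_ge_0[OF U(2)] dc by (metis antisym_conv2)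
    have "emeasure mu (E \<inter> closure (U i)) = 0"
    proof (cases "E \<inter> closure (U i) = {}")
      case False
      then obtain x where x: "x \<in> closure (U i)" by blast
      have "closure (U i) \<subseteq> {x}"
        using diameter_bounded_bound[OF bc x] d0 by fastforce
      then have "emeasure mu (E \<inter> closure (U i)) \<le> emeasure mu {x}" by (intro emeasure_mono) auto
      also have "\<dots> = 0"
      proof -
        have "hausdorff_measure 1 (C \<inter> {x}) \<le> hausdorff_measure 1 {x}" by (rule hausdorff_measure_mono) auto
        then show ?thesis by (simp add: emeasure_mu)
      qed
      finally show ?thesis by simp
    qed simp
    then show False using i by simp
  qed
  then show ?thesis
    using that[of "closure (U i)"] i dc bc U(3)[of i] by simp
qed

text \<open>In the coordinates \<open>v + a\<close> and \<open>v - a\<close> the set \<open>C\<close> lies in a product of two null sets, while \<open>G\<close>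
  is a Lipschitz graph over its projection.\<close>

lemma empty_cone_null:
  assumes N: "negligible ((\<lambda>p. fst p + snd p) ` C)" "negligible ((\<lambda>p. fst p - snd p) ` C)"
    and t: "t \<in> {0..1}" and s: "s > 0" and G: "G \<subseteq> C"
    and sec: "\<And>p q. p \<in> G \<Longrightarrow> q \<in> G \<Longrightarrow> p \<noteq> q \<Longrightarrow> s * \<bar>fst q - fst p\<bar> < \<bar>proj t q - proj t p\<bar>"
  shows "hausdorff_measure 1 G = 0"
proof -
  define Y where "Y = proj t ` G"
  define h where "h = inv_into G (proj t)"
  \<comment> \<open>The empty cone bounds the horizontal increment by
    \<open>\<bar>x - y\<bar> / s\<close>, and the vertical one by \<open>\<bar>x - y\<bar>\<close>
    plus that.\<close>
  define L where "L = 1 + 2 / s"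
  have L: "L > 0" using s by (simp add: L_def add_pos_pos)
  have inj: "inj_on (proj t) G"
  proof (rule inj_onI, rule ccontr)
    fix p q assume pq: "p \<in> G" "q \<in> G" "proj t p = proj t q" "p \<noteq> q"
    have "s * \<bar>fst q - fst p\<bar> < 0" using sec[OF pq(1,2,4)] pq(3) by simp
    moreover have "0 \<le> s * \<bar>fst q - fst p\<bar>" using s by simp
    ultimately show False by linarith
  qed
  have hG: "h y \<in> G" "proj t (h y) = y" if "y \<in> Y" for y
    using that by (auto simp: Y_def h_def inv_into_into f_inv_into_f)
  have GY: "G = h ` Y" using inj by (auto simp: Y_def h_def)
  have lip: "\<bar>fst (h x) - fst (h y)\<bar> + \<bar>snd (h x) - snd (h y)\<bar> \<le> L * \<bar>x - y\<bar>" if "x \<in> Y" "y \<in> Y" for x y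
  proof (cases "h x = h y")
    case False
    define u w where "u = fst (h x) - fst (h y)" and "w = snd (h x) - snd (h y)"
    have "s * \<bar>u\<bar> < \<bar>x - y\<bar>" using sec[OF hG(1)[OF that(2)] hG(1)[OF that(1)]] False hG(2) that by (auto simp: u_def)
    then have u: "\<bar>u\<bar> \<le> \<bar>x - y\<bar> / s" using s by (simp add: field_simps)
    have "x - y = w + t * u" using proj_diff[of t "h x" "h y"] hG(2) that by (simp add: u_def w_def)
    moreover have "\<bar>t * u\<bar> \<le> 1 * \<bar>u\<bar>" unfolding abs_mult using t by (intro mult_right_mono) auto
    ultimately have "\<bar>w\<bar> \<le> \<bar>x - y\<bar> + \<bar>u\<bar>" by linarith
    then have "\<bar>u\<bar> + \<bar>w\<bar> \<le> \<bar>x - y\<bar> + 2 * (\<bar>x - y\<bar> / s)" using u by linarith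
    then show ?thesis by (simp add: u_def w_def L_def algebra_simps)
  next
    case True
    then show ?thesis using L by simp
  qed
  have negY: "negligible Y"
  proof (rule negligible_of_two_null_images[where L = L and ?g1.0 = "\<lambda>y. fst (h y) + snd (h y)" and ?g2.0 = "\<lambda>y. fst (h y) - snd (h y)"
        and ?N1.0 = "(\<lambda>p. fst p + snd p) ` C" and ?N2.0 = "(\<lambda>p. fst p - snd p) ` C"])
    fix x y assume xy: "x \<in> Y" "y \<in> Y"
    show "\<bar>fst (h x) + snd (h x) - (fst (h y) + snd (h y))\<bar> \<le> L * \<bar>x - y\<bar>"
         "\<bar>fst (h x) - snd (h x) - (fst (h y) - snd (h y))\<bar> \<le> L * \<bar>x - y\<bar>"
      using lip[OF xy] by linarith+
    define u w where "u = fst (h x) - fst (h y)" and "w = snd (h x) - snd (h y)"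
    have "x - y = w + t * u" using proj_diff[of t "h x" "h y"] hG(2) xy by (simp add: u_def w_def)
    moreover have "\<bar>t * u\<bar> \<le> 1 * \<bar>u\<bar>" unfolding abs_mult using t by (intro mult_right_mono) auto
    \<comment> \<open>The sum and difference coordinates together dominate
      \<open>\<bar>w\<bar> + \<bar>u\<bar>\<close>; this is why two null projections
      suffice.\<close>
    ultimately have "\<bar>x - y\<bar> \<le> \<bar>w + u\<bar> + \<bar>u - w\<bar>" by linarith
    then show "\<bar>x - y\<bar> \<le> \<bar>fst (h x) + snd (h x) - (fst (h y) + snd (h y))\<bar> + \<bar>fst (h x) - snd (h x) - (fst (h y) - snd (h y))\<bar>"
      unfolding u_def w_def by (simp add: algebra_simps)
  next
    show "closed ((\<lambda>p. fst p + snd p) ` C)" "closed ((\<lambda>p. fst p - snd p) ` C)"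
      using comp by (auto intro!: compact_imp_closed compact_continuous_image continuous_intros)
  qed (use N hG(1) G L in \<open>auto simp: subset_eq\<close>)
  have "bounded Y"
  proof -
    have "compact (proj t ` C)" by (intro compact_continuous_image comp continuous_intros)
    then show ?thesis using G by (auto simp: Y_def intro: bounded_subset compact_imp_bounded)
  qed
  have "hausdorff_measure 1 (h ` Y) = 0"
  proof (rule hausdorff_measure_lipschitz_image_null[OF _ L negY \<open>bounded Y\<close>])
    fix x y assume xy: "x \<in> Y" "y \<in> Y"
    have "dist (h x) (h y) \<le> \<bar>fst (h x) - fst (h y)\<bar> + \<bar>snd (h x) - snd (h y)\<bar>"
      unfolding dist_prod_def dist_real_def by (rule sqrt_sum_squares_le_sum_abs[THEN order_trans]) simp
    then show "dist (h x) (h y) \<le> L * \<bar>x - y\<bar>" using lip[OF xy] by linarith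
  qed
  then show ?thesis using GY by simp
qed

text \<open>If the cone at \<open>p\<close> contains other points of \<open>F\<close>, a nearly farthest one \<open>q\<close> at distance \<open>h\<close> controls
  the whole strip of width comparable to \<open>s h\<close>: its points lie in the cone at \<open>p\<close> or in the one at \<open>q\<close>.\<close>

lemma strip_subset_two_cones:
  assumes pq: "\<bar>proj t q - proj t p\<bar> \<le> s / 4 * \<bar>fst q - fst p\<bar>" and s: "0 < s"
    and far: "\<And>u. u \<in> F \<Longrightarrow> \<bar>proj t u - proj t p\<bar> \<le> s / 4 * \<bar>fst u - fst p\<bar> \<Longrightarrow> \<bar>fst u - fst p\<bar> \<le> 2 * \<bar>fst q - fst p\<bar>"
    and r: "2 * \<bar>fst q - fst p\<bar> \<le> r"
  shows "F \<inter> strip t (proj t p) (s * \<bar>fst q - fst p\<bar> / 8) \<subseteq> slope_cone p r t s \<union> slope_cone q r t s"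
proof
  fix u assume u: "u \<in> F \<inter> strip t (proj t p) (s * \<bar>fst q - fst p\<bar> / 8)"
  define h where "h = \<bar>fst q - fst p\<bar>"
  have xu: "\<bar>proj t u - proj t p\<bar> \<le> s * h / 8" using u by (simp add: strip_def h_def)
  show "u \<in> slope_cone p r t s \<union> slope_cone q r t s"
  proof (cases "h / 2 \<le> \<bar>fst u - fst p\<bar>")
    case True
    \<comment> \<open>The strip width was fitted to this: \<open>s * h / 8\<close> is the
      half-opening of the narrow cone at distance \<open>h / 2\<close>.\<close>
    have "s / 4 * (h / 2) \<le> s / 4 * \<bar>fst u - fst p\<bar>" using True s by (intro mult_left_mono) auto
    moreover have "s / 4 * (h / 2) = s * h / 8" by simp
    ultimately have n: "\<bar>proj t u - proj t p\<bar> \<le> s / 4 * \<bar>fst u - fst p\<bar>" using xu by linarith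
    then have "\<bar>fst u - fst p\<bar> \<le> r" using far[of u] u r by auto
    moreover have "s / 4 * \<bar>fst u - fst p\<bar> \<le> s * \<bar>fst u - fst p\<bar>" using s by (intro mult_right_mono) auto
    ultimately show ?thesis unfolding slope_cone_def using order_trans[OF n] by blast
  next
    case False
    \<comment> \<open>A point near \<open>p\<close> is far from \<open>q\<close>, and the errors
      \<open>s * h / 8\<close> and \<open>s * h / 4\<close> stay below
      \<open>s * (h / 2)\<close>.\<close>
    then have z: "h / 2 \<le> \<bar>fst u - fst q\<bar>" "\<bar>fst u - fst q\<bar> \<le> r"
      using r unfolding h_def by (smt (verit) field_sum_of_halves)+
    have "\<bar>proj t u - proj t q\<bar> \<le> s * h / 8 + s / 4 * h"
      using xu pq unfolding h_def by linarith
    also have "\<dots> \<le> s * (h / 2)" using s by (simp add: h_def field_simps)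
    also have "\<dots> \<le> s * \<bar>fst u - fst q\<bar>" using z s by (intro mult_left_mono) auto
    finally show ?thesis using z by (simp add: slope_cone_def)
  qed
qed

text \<open>A dense piece \<open>F\<close> of diameter \<open>d\<close> has mass above
  \<open>d / 2\<close>. Its points with an empty narrow cone are null, and the others project into
  intervals whose strips are too light: together they carry at most
  \<open>3 * d / 10\<close>.\<close>

lemma sparse_null:
  assumes N: "negligible ((\<lambda>p. fst p + snd p) ` C)" "negligible ((\<lambda>p. fst p - snd p) ` C)"
    and t: "t \<in> {0..1}"
  shows "emeasure mu {p. (p, t) \<in> sparse j} = 0"
proof (rule ccontr)
  define E where "E = {p. (p, t) \<in> sparse j}"
  define s where "s = 1 / real (j+1)"
  assume "emeasure mu {p. (p, t) \<in> sparse j} \<noteq> 0"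
  then have E0: "emeasure mu E \<noteq> 0" by (simp add: E_def)
  have E: "E \<in> sets borel" unfolding E_def by (rule slice_borel) measurable
  have EC: "E \<subseteq> C" by (auto simp: E_def sparse_def)
  have s: "0 < s" "s \<le> 1" by (auto simp: s_def)
  \<comment> \<open>The diameter \<open>s / 8\<close> keeps the later radius
    \<open>r < 3 * h y\<close> below \<open>s\<close>, where sparseness applies.\<close>
  obtain U where U: "closed U" "bounded U" "0 < diameter U" "diameter U \<le> s / 8"
    "ennreal (diameter U / 2) < emeasure mu (E \<inter> U)"
    using dense_piece[OF E EC E0, of "s / 8"] s by auto
  define d where "d = diameter U"
  define F where "F = E \<inter> U"
  have d: "0 < d" "d \<le> s / 8" using U by (auto simp: d_def)
  have F_borel: "F \<in> sets borel" using E U by (auto simp: F_def)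
  have FC: "F \<subseteq> C" using EC by (auto simp: F_def)
  have distF: "dist x y \<le> d" if "x \<in> F" "y \<in> F" for x y
    unfolding d_def using that by (intro diameter_bounded_bound U) (auto simp: F_def)
  define nar where "nar = (\<lambda>p q. \<bar>proj t q - proj t p\<bar> \<le> s / 4 * \<bar>fst q - fst p\<bar>)"
  define G where "G = {p \<in> F. \<forall>q\<in>F. q \<noteq> p \<longrightarrow> \<not> nar p q}"
  have G0: "hausdorff_measure 1 G = 0"
    by (rule empty_cone_null[OF N t, of "s / 4"]) (use s FC in \<open>auto simp: G_def nar_def\<close>)
  \<comment> \<open>\<open>F\<close> need not be closed, so a farthest point of the narrow cone may
    be missing; more than half the supremum is enough.\<close>
  have ex: "\<exists>q\<in>F. 0 < \<bar>fst q - fst p\<bar> \<and> nar p q \<and> (\<forall>u\<in>F. nar p u \<longrightarrow> \<bar>fst u - fst p\<bar> \<le> 2 * \<bar>fst q - fst p\<bar>)"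
    if p: "p \<in> F - G" for p
  proof -
    define Z where "Z = (\<lambda>u. \<bar>fst u - fst p\<bar>) ` {u \<in> F. nar p u}"
    obtain q0 where q0: "q0 \<in> F" "q0 \<noteq> p" "nar p q0" using p by (auto simp: G_def)
    have "fst q0 \<noteq> fst p"
    proof
      assume "fst q0 = fst p"
      then have "q0 = p" using q0(3) by (auto simp: nar_def proj_def prod_eq_iff)
      then show False using q0(2) by simp
    qed
    then have pos: "0 < \<bar>fst q0 - fst p\<bar>" by simp
    have bdd: "bdd_above Z"
      unfolding Z_def
    proof (rule bdd_aboveI2)
      fix u assume "u \<in> {u \<in> F. nar p u}"
      then have "dist u p \<le> d" using distF[of u p] p by simp
      then show "\<bar>fst u - fst p\<bar> \<le> d" using dist_fst_le[of u p] by (simp add: dist_real_def)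
    qed
    have le: "\<bar>fst u - fst p\<bar> \<le> Sup Z" if "u \<in> F" "nar p u" for u
      using that bdd by (intro cSup_upper) (auto simp: Z_def)
    have "0 < Sup Z" using le[OF q0(1,3)] pos by linarith
    then have "Sup Z / 2 < Sup Z" by simp
    moreover have "Z \<noteq> {}" using q0(1,3) unfolding Z_def by blast
    ultimately obtain z where z: "z \<in> Z" "Sup Z / 2 < z" using less_cSupD by blast
    then obtain q where q: "q \<in> F" "nar p q" "Sup Z / 2 < \<bar>fst q - fst p\<bar>"
      unfolding Z_def by blast
    show ?thesis
      using q le \<open>0 < Sup Z\<close> by (intro bexI[of _ q]) force+
  qed
  define X where "X = proj t ` (F - G)"
  have "\<forall>y\<in>X. \<exists>p q. p \<in> F \<and> q \<in> F \<and> proj t p = y \<and> 0 < \<bar>fst q - fst p\<bar> \<and> nar p q \<and>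
      (\<forall>u\<in>F. nar p u \<longrightarrow> \<bar>fst u - fst p\<bar> \<le> 2 * \<bar>fst q - fst p\<bar>)"
    using ex unfolding X_def by blast
  then obtain P Q where PQ: "\<forall>y\<in>X. P y \<in> F \<and> Q y \<in> F \<and> proj t (P y) = y \<and> 0 < \<bar>fst (Q y) - fst (P y)\<bar> \<and> nar (P y) (Q y) \<and>
      (\<forall>u\<in>F. nar (P y) u \<longrightarrow> \<bar>fst u - fst (P y)\<bar> \<le> 2 * \<bar>fst (Q y) - fst (P y)\<bar>)"
    unfolding bchoice_iff by blast
  define h where "h = (\<lambda>y. \<bar>fst (Q y) - fst (P y)\<bar>)"
  \<comment> \<open>Then \<open>5 * w y = s * h y / 8\<close>, the width controlled by two
    cones.\<close>
  define w where "w = (\<lambda>y. s * h y / 40)"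
  have pm: "proj t \<in> borel_measurable borel"
    by (rule borel_measurable_continuous_onI) (intro continuous_intros)
  define M where "M = distr (density mu (indicator F)) borel (proj t)"
  have emM: "emeasure M B = emeasure mu (F \<inter> proj t -` B)" if "B \<in> sets borel" for B
  proof -
    have "proj t -` B \<in> sets borel" using measurable_sets[OF pm that] by simp
    then show ?thesis
      unfolding M_def using pm that F_borel
      by (subst emeasure_distr) (auto simp: emeasure_density simp flip: indicator_inter_arith)
  qed
  obtain p0 where p0: "p0 \<in> F" using U(5) by (cases "F = {}") (auto simp: F_def)
  \<comment> \<open>The projection of \<open>F\<close> stays within \<open>2 * d\<close> of
    \<open>proj t p0\<close>, and the intervals add at most \<open>d / 40\<close>.\<close>
  define V where "V = cball (proj t p0) (3 * d)"
  obtain T where T: "T \<in> sets borel" "X \<subseteq> T" "emeasure M T \<le> ennreal (1/20) * emeasure lborel (V \<inter> UNIV)"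
  proof (rule vitali_measure_bound[where M = M and N = lborel and A = X and S = UNIV and V = V and r = w and B = d and c = "ennreal (1/20)"])
    fix y assume y: "y \<in> X"
    have y': "P y \<in> F" "Q y \<in> F" "proj t (P y) = y" "0 < h y" "nar (P y) (Q y)"
      using PQ y by (auto simp: h_def)
    have far: "\<bar>fst u - fst (P y)\<bar> \<le> 2 * h y" if "u \<in> F" "nar (P y) u" for u
      using PQ y that by (auto simp: h_def)
    have hd: "h y \<le> d" using distF[OF y'(2,1)] dist_fst_le[of "Q y" "P y"] by (simp add: h_def dist_real_def)
    have "s * h y \<le> 1 * d" using s hd y' by (intro mult_mono) auto
    then have wd: "w y \<le> d / 40" by (simp add: w_def)
    have wpos: "0 < w y" using s y' by (simp add: w_def)
    show "0 < w y \<and> w y \<le> d" using wd wpos d by auto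
    have "\<bar>y - proj t p0\<bar> \<le> 2 * d" using proj_lipschitz[OF t, of "P y" p0] distF[OF y'(1) p0] y' by simp
    then show "cball y (w y) \<subseteq> V" using wd d by (auto simp: V_def dist_real_def)
    obtain r where r: "r \<in> \<rat>" "2 * h y < r" "r < 3 * h y" using Rats_dense_in_real[of "2 * h y" "3 * h y"] y' by auto
    have "r \<le> s" using r hd d s by linarith
    then have rs: "0 < r" "r \<le> 1 / real (j+1)" using r y' by (simp_all add: s_def)
    have cn: "emeasure mu (slope_cone p r t s) \<le> ennreal (r * s / 10000)" if "p \<in> F" for p
    proof -
      have "(p, t) \<in> sparse j" using that by (simp add: F_def E_def)
      then have "emeasure mu (slope_cone p r t s) \<le> ennreal (r / (10000 * real (j+1)))"
        using r rs unfolding sparse_def s_def by blast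
      also have "r / (10000 * real (j+1)) = r * s / 10000" by (simp add: s_def)
      finally show ?thesis .
    qed
    have "emeasure M (cball y (5 * w y)) = emeasure mu (F \<inter> strip t (proj t (P y)) (s * \<bar>fst (Q y) - fst (P y)\<bar> / 8))"
      using y' by (subst emM) (auto simp: strip_def w_def h_def dist_real_def abs_minus_commute intro!: arg_cong[where f = "emeasure mu"])
    also have "\<dots> \<le> emeasure mu (slope_cone (P y) r t s \<union> slope_cone (Q y) r t s)"
      using y' far r s by (intro emeasure_mono strip_subset_two_cones) (auto simp: nar_def h_def closed_slope_cone)
    also have "\<dots> \<le> emeasure mu (slope_cone (P y) r t s) + emeasure mu (slope_cone (Q y) r t s)"
      by (intro emeasure_subadditive) (auto simp: closed_slope_cone)
    also have "\<dots> \<le> ennreal (r * s / 10000) + ennreal (r * s / 10000)"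
      by (intro add_mono cn y')
    also have "\<dots> = ennreal (r * s / 5000)" using rs s by (simp flip: ennreal_plus)
    also have "\<dots> \<le> ennreal (w y / 10)"
    proof (rule ennreal_leI)
      have "r * s \<le> 3 * h y * s" using r s by (intro mult_right_mono) auto
      then show "r * s / 5000 \<le> w y / 10" using y' s by (simp add: w_def field_simps)
    qed
    also have "\<dots> = ennreal (1/20) * emeasure lborel (cball y (w y) \<inter> UNIV)"
      using wpos by (simp add: cball_eq_atLeastAtMost flip: ennreal_mult')
    finally show "emeasure M (cball y (5 * w y)) \<le> ennreal (1/20) * emeasure lborel (cball y (w y) \<inter> UNIV)" .
  qed (auto simp: M_def V_def)
  have pT: "F \<inter> proj t -` T \<in> sets borel" using measurable_sets[OF pm T(1)] F_borel by auto
  have "emeasure mu F = hausdorff_measure 1 F"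
    using FC F_borel by (simp add: emeasure_mu Int_absorb1)
  also have "\<dots> \<le> hausdorff_measure 1 (G \<union> (F \<inter> proj t -` T))"
    using T(2) by (intro hausdorff_measure_mono) (auto simp: X_def)
  also have "\<dots> \<le> hausdorff_measure 1 G + hausdorff_measure 1 (F \<inter> proj t -` T)" by (rule hausdorff_measure_Un)
  also have "\<dots> = emeasure mu (F \<inter> proj t -` T)"
  proof -
    have "C \<inter> (F \<inter> proj t -` T) = F \<inter> proj t -` T" using FC by auto
    then show ?thesis using G0 emeasure_mu[OF pT] by simp
  qed
  also have "\<dots> = emeasure M T" using T(1) by (simp add: emM)
  also have "\<dots> \<le> ennreal (1/20) * emeasure lborel V" using T(3) by simp
  also have "\<dots> = ennreal (3 * d / 10)" using d by (simp add: V_def cball_eq_atLeastAtMost flip: ennreal_mult')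
  also have "\<dots> \<le> ennreal (d / 2)" using d by (intro ennreal_leI) auto
  finally show False using U(5) by (simp add: F_def d_def)
qed

theorem negligible_projections:
  assumes N: "negligible ((\<lambda>p. fst p + snd p) ` C)" "negligible ((\<lambda>p. fst p - snd p) ` C)"
    and C01: "fst ` C \<subseteq> {0..1}"
  shows "negligible {t \<in> {0..1}. \<not> negligible (proj t ` C)}"
proof -
  define R where "R = (\<lambda>k. regular k - (\<Union>j. sparse j))"
  have R_borel: "R k \<in> sets borel" for k unfolding R_def by measurable
  \<comment> \<open>For each fixed \<open>p\<close> the exceptional directions are negligible;
    Fubini turns this into a statement about almost every point in almost every direction.\<close>
  have "AE t in lborel. AE p in mu. (p, t) \<notin> R k" for k
  proof -
    have "AE p in mu. AE t in lborel. (p, t) \<notin> R k"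
    proof (rule AE_I2)
      fix p
      have "{t. (p, t) \<in> R k} \<in> null_sets lebesgue"
        using regular_not_sparse_negligible[of p k] by (simp add: R_def negligible_iff_null_sets)
      then have "{t. (p, t) \<in> R k} \<in> null_sets lborel"
        using slice_borel(1)[OF R_borel, of p k] by (auto simp: null_sets_def)
      then show "AE t in lborel. (p, t) \<notin> R k"
        by (rule AE_I') auto
    qed
    moreover have "{x \<in> space (mu \<Otimes>\<^sub>M lborel). (fst x, snd x) \<notin> R k} \<in> sets (mu \<Otimes>\<^sub>M lborel)"
    proof -
      have eq: "{x \<in> space (mu \<Otimes>\<^sub>M lborel). (fst x, snd x) \<notin> R k} = - R k"
        by (auto simp: space_pair_measure)
      show ?thesis unfolding eq sets_pair by (rule borel_comp[OF R_borel])
    qed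
    ultimately show ?thesis using pair.AE_commute[of "\<lambda>p t. (p, t) \<notin> R k"] by simp
  qed
  then have "AE t in lborel. \<forall>k. AE p in mu. (p, t) \<notin> R k" by (simp add: AE_all_countable)
  then obtain Z where Z: "Z \<in> null_sets lborel" "{t \<in> space lborel. \<not> (\<forall>k. AE p in mu. (p, t) \<notin> R k)} \<subseteq> Z"
    by (rule AE_E3) auto
  have "negligible (proj t ` C)" if t: "t \<in> {0..1}" "t \<notin> Z" for t
  proof -
    define W where "W = (\<lambda>k. {p. (p, t) \<in> regular k})"
    have W_borel: "W k \<in> sets borel" for k unfolding W_def by (rule slice_borel) measurable
    have WC: "W k \<subseteq> C" for k by (auto simp: W_def regular_def)
    have "negligible (proj t ` W k)" for k
    proof (rule negligible_lipschitz_image_hausdorff_null[OF proj_lipschitz[OF t(1)]])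
      have "AE p in mu. \<forall>j. (p, t) \<notin> sparse j"
        unfolding AE_all_countable
      proof
        fix j
        have "{p. (p, t) \<in> sparse j} \<in> null_sets mu"
          using sparse_null[OF N t(1), of j] slice_borel(2)[OF sparse_borel, of t j] by (auto simp: null_sets_def)
        then show "AE p in mu. (p, t) \<notin> sparse j" by (rule AE_I') auto
      qed
      moreover have "AE p in mu. (p, t) \<notin> R k" using Z(2) t(2) by auto
      ultimately have "AE p in mu. p \<notin> W k" by eventually_elim (auto simp: R_def W_def)
      then have "emeasure mu (W k) = 0"
        using W_borel by (subst (asm) AE_iff_measurable[of "W k"]) auto
      then show "hausdorff_measure 1 (W k) = 0"
        using WC[of k] W_borel[of k] by (simp add: emeasure_mu Int_absorb1)
    qed simp
    \<comment> \<open>For this \<open>t\<close>, a value of the projection is exceptional on the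
      line or comes from a regular point, and the regular points are \<open>mu\<close>-null.\<close>
    then have "negligible ((\<Union>k. proj t ` W k) \<union> ({y. infinite {p \<in> C. proj t p = y}} \<union> {y. \<forall>k::nat. \<exists>s>0. emeasure mu (strip t y s) > ennreal (real k * s)}))"
      by (intro negligible_Un negligible_Union_nat negligible_infinite_fibres negligible_proj_maximal t C01)
    then show ?thesis
    proof (rule negligible_subset, intro subsetI)
      fix y assume "y \<in> proj t ` C"
      then obtain p where p: "p \<in> C" "y = proj t p" by blast
      show "y \<in> (\<Union>k. proj t ` W k) \<union> ({y. infinite {p \<in> C. proj t p = y}} \<union> {y. \<forall>k::nat. \<exists>s>0. emeasure mu (strip t y s) > ennreal (real k * s)})"
      proof (cases "infinite {p \<in> C. proj t p = y} \<or> (\<forall>k::nat. \<exists>s>0. emeasure mu (strip t y s) > ennreal (real k * s))")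
        case False
        then obtain k1 :: nat where k1: "\<And>s. s > 0 \<Longrightarrow> emeasure mu (strip t y s) \<le> ennreal (real k1 * s)"
          by (meson not_less)
        \<comment> \<open>The element 1 keeps the minimum meaningful when the fibre is a single
          point; 0, the distance of \<open>p\<close> to itself, is removed.\<close>
        define D where "D = insert 1 ((\<lambda>q. \<bar>fst q - fst p\<bar>) ` {q \<in> C. proj t q = y} - {0})"
        have finD: "finite D" using False by (auto simp: D_def)
        have "0 < Min D" using finD by (subst Min_gr_iff) (auto simp: D_def)
        then obtain k2 where k2: "1 / real (Suc k2) < Min D" using nat_approx_posE by blast
        define k where "k = max k1 k2"
        have "1 / real (k+1) \<le> 1 / real (Suc k2)" by (intro divide_left_mono) (auto simp: k_def)
        then have kD: "1 / real (k+1) < Min D" using k2 by linarith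
        have "(p, t) \<notin> meets k"
        proof
          assume "(p, t) \<in> meets k"
          then obtain q where q: "q \<in> C" "0 < \<bar>fst q - fst p\<bar>" "\<bar>fst q - fst p\<bar> \<le> 1 / real (k+1)" "proj t q = proj t p"
            by (auto simp: meets_def)
          then have "\<bar>fst q - fst p\<bar> \<in> D" using p by (auto simp: D_def)
          then have "Min D \<le> \<bar>fst q - fst p\<bar>" using finD by (rule Min_le[rotated])
          then show False using q(3) kD by linarith
        qed
        moreover have "emeasure mu (strip t (proj t p) s) \<le> ennreal (real (k+1) * s)" if "s > 0" for s
        proof -
          have "ennreal (real k1 * s) \<le> ennreal (real (k+1) * s)"
            using that by (intro ennreal_leI mult_right_mono) (auto simp: k_def)
          then show ?thesis using k1[OF that] p(2) by (auto intro: order_trans)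
        qed
        ultimately have "p \<in> W k" using p t by (auto simp: W_def regular_def)
        then show ?thesis using p by blast
      qed auto
    qed
  qed
  then have "{t \<in> {0..1}. \<not> negligible (proj t ` C)} \<subseteq> Z" by blast
  then show ?thesis
    using Z(1) by (intro negligible_small_cover bexI[of _ Z]) (auto simp: null_sets_def)
qed

end

section \<open>The Cantor set\<close>

lemma NN_Suc: "NN n (Suc m) = NN n m + n (Suc m)"
  by (simp add: NN_def)

lemma grid_square_subsquare:
  assumes "p \<in> subsquares k q"
  shows "grid_square (N + k) p \<subseteq> grid_square N q"
proof -
  have bounds: "real a / 4 ^ N \<le> real i / 4 ^ (N + k)" "real (i + 1) / 4 ^ (N + k) \<le> real (a + 1) / 4 ^ N"
    if "i div 4 ^ k = a" for i a
  proof -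
    have "a * 4 ^ k \<le> i" using that by (metis div_times_less_eq_dividend)
    then have "real (a * 4 ^ k) \<le> real i" by (rule of_nat_mono)
    then show "real a / 4 ^ N \<le> real i / 4 ^ (N + k)" by (simp add: power_add field_simps)
    have "i < (a + 1) * 4 ^ k"
      using that dividend_less_div_times[of "4 ^ k" i] by simp
    then have "real (i + 1) \<le> real ((a + 1) * 4 ^ k)" by (intro of_nat_mono) simp
    from mult_right_mono[OF this, of "4 ^ N"]
    show "real (i + 1) / 4 ^ (N + k) \<le> real (a + 1) / 4 ^ N" by (simp add: power_add field_simps)
  qed
  have "fst p div 4 ^ k = fst q" "snd p div 4 ^ k = snd q"
    using assms by (auto simp: subsquares_def)
  then show ?thesis
    unfolding grid_square_def
    using bounds[of "fst p" "fst q"] bounds[of "snd p" "snd q"] by (simp add: cbox_Pair_eq Times_subset_cancel2 Sigma_mono)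
qed

lemma finite_subsquares: "finite (subsquares k q)"
proof (rule finite_subset)
  show "subsquares k q \<subseteq> {..(fst q + 1) * 4 ^ k} \<times> {..(snd q + 1) * 4 ^ k}"
  proof
    fix p assume "p \<in> subsquares k q"
    then have "fst p div 4 ^ k = fst q" "snd p div 4 ^ k = snd q" by (auto simp: subsquares_def)
    moreover have "i \<le> (i div 4 ^ k + 1) * 4 ^ k" for i :: nat
      using dividend_less_div_times[of "4 ^ k" i] by simp
    ultimately show "p \<in> {..(fst q + 1) * 4 ^ k} \<times> {..(snd q + 1) * 4 ^ k}"
      by (metis atMost_iff mem_Times_iff)
  qed
qed simp

lemma cantor_construction_parent:
  assumes "cantor_construction n Cs" "p \<in> Cs (Suc m)"
  obtains q where "q \<in> Cs m" "p \<in> subsquares (n (Suc m)) q"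
proof (cases "even m")
  case True
  then obtain k where "m = 2 * k" by (elim evenE)
  then have "Cs (Suc m) \<subseteq> (\<Union>q\<in>Cs m. subsquares (n (Suc m)) q)"
    using assms(1) unfolding cantor_construction_def by simp
  then show ?thesis using assms(2) that by blast
next
  case False
  then obtain k where "m = 2 * k + 1" by (elim oddE)
  then have "Cs (Suc m) \<subseteq> (\<Union>q\<in>Cs m. subsquares (n (Suc m)) q)"
    using assms(1) unfolding cantor_construction_def by simp
  then show ?thesis using assms(2) that by blast
qed

lemma cantor_construction_finite:
  assumes "cantor_construction n Cs"
  shows "finite (Cs m)"
proof (induction m)
  case 0
  then show ?case using assms by (simp add: cantor_construction_def)
next
  case (Suc m)
  have "Cs (Suc m) \<subseteq> (\<Union>q\<in>Cs m. subsquares (n (Suc m)) q)"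
    using cantor_construction_parent[OF assms] by blast
  then show ?case
    by (rule finite_subset) (use Suc finite_subsquares in blast)
qed

text \<open>Only even stages appear, because the condition that every column of a square is hit
  relates stage \<open>2*k\<close> to stage \<open>2*k+2\<close>.\<close>

lemma cantor_construction_column:
  assumes "cantor_construction n Cs" "c < 4 ^ NN n (2 * k)"
  shows "\<exists>p\<in>Cs (2 * k). fst p = c"
  using assms(2)
proof (induction k arbitrary: c)
  case 0
  then show ?case using assms(1) by (auto simp: cantor_construction_def NN_def)
next
  case (Suc k)
  define d where "d = n (2*k+1) + n (2*k+2)"
  have "NN n (2 * Suc k) = NN n (2 * k) + d" by (simp add: d_def NN_Suc)
  then have "c div 4 ^ d < 4 ^ NN n (2 * k)"
    using Suc.prems by (simp add: less_mult_imp_div_less power_add)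
  then obtain q where q: "q \<in> Cs (2 * k)" "fst q = c div 4 ^ d" using Suc.IH by blast
  have "\<forall>c. c div 4 ^ (n (2*k+1) + n (2*k+2)) = fst q \<longrightarrow>
      (\<exists>p\<in>Cs (2*k+2) \<inter> subsquares (n (2*k+1) + n (2*k+2)) q. fst p = c)"
    using assms(1) q(1) unfolding cantor_construction_def Let_def by blast
  then show ?case using q(2) unfolding d_def by fastforce
qed

text \<open>Above each \<open>v\<close> every even stage has a point, and compactness of the nested
  stages yields a point of the limit set.\<close>

lemma
  assumes constr: "cantor_construction n Cs"
  shows compact_cantor_set: "compact (cantor_set n Cs)"
    and fst_cantor_set: "fst ` cantor_set n Cs = {0..1}"
proof -
  define K where "K = (\<lambda>m. \<Union>q\<in>Cs m. grid_square (NN n m) q)"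
  have C: "cantor_set n Cs = (\<Inter>m. K m)" by (simp add: cantor_set_def K_def)
  have cK: "compact (K m)" for m
    unfolding K_def using cantor_construction_finite[OF constr]
    by (intro compact_UN) (auto simp: grid_square_def)
  show comp: "compact (cantor_set n Cs)"
    unfolding C by (rule compact_Inter) (use cK in auto)
  have "K 0 = {0..1} \<times> {0..1}"
    using constr by (simp add: K_def cantor_construction_def grid_square_def NN_def cbox_Pair_eq)
  then have sub: "cantor_set n Cs \<subseteq> {0..1} \<times> {0..1}" unfolding C by blast
  have "K (Suc m) \<subseteq> K m" for m
  proof
    fix x assume "x \<in> K (Suc m)"
    then obtain p where p: "p \<in> Cs (Suc m)" "x \<in> grid_square (NN n (Suc m)) p" by (auto simp: K_def)
    obtain q where q: "q \<in> Cs m" "p \<in> subsquares (n (Suc m)) q"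
      using cantor_construction_parent[OF constr p(1)] by blast
    have "x \<in> grid_square (NN n m) q"
      using grid_square_subsquare[OF q(2), of "NN n m"] p(2) by (auto simp: NN_Suc)
    then show "x \<in> K m" using q by (auto simp: K_def)
  qed
  then have anti: "K j \<subseteq> K i" if "i \<le> j" for i j
    using that by (rule lift_Suc_antimono_le)
  have "v \<in> fst ` cantor_set n Cs" if v: "v \<in> {0..1}" for v
  proof -
    define F where "F = (\<lambda>m. K m \<inter> ({v} \<times> {0..1}))"
    have "\<Inter>(range F) \<noteq> {}"
    proof (rule compact_nest)
      show "compact (F m)" for m unfolding F_def by (intro compact_Int cK compact_Times) auto
      show "F j \<subseteq> F i" if "i \<le> j" for i j using anti[OF that] by (auto simp: F_def)
      fix m
      define N where "N = NN n (2 * m)"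
      \<comment> \<open>The minimum assigns \<open>v = 1\<close> to the last column instead of a
        nonexistent next one.\<close>
      define c where "c = min (nat \<lfloor>v * 4 ^ N\<rfloor>) (4 ^ N - 1)"
      have "c \<le> 4 ^ N - 1" by (simp add: c_def)
      moreover have "0 < (4 :: nat) ^ N" by simp
      ultimately have "c < 4 ^ N" by linarith
      then obtain p where p: "p \<in> Cs (2 * m)" "fst p = c"
        using cantor_construction_column[OF constr] unfolding N_def by blast
      have "real c \<le> v * 4 ^ N"
      proof -
        have "real c \<le> real (nat \<lfloor>v * 4 ^ N\<rfloor>)" by (simp add: c_def)
        also have "\<dots> \<le> v * 4 ^ N" using v by simp
        finally show ?thesis .
      qed
      moreover have "v * 4 ^ N \<le> real (c + 1)"
      proof (cases "nat \<lfloor>v * 4 ^ N\<rfloor> \<le> 4 ^ N - 1")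
        case True
        then have "c = nat \<lfloor>v * 4 ^ N\<rfloor>" unfolding c_def by (rule min_absorb1)
        moreover have "0 \<le> v * 4 ^ N" using v by simp
        ultimately have "real c = of_int \<lfloor>v * 4 ^ N\<rfloor>" by simp
        then show ?thesis by linarith
      next
        case False
        then have "c = 4 ^ N - 1" by (simp add: c_def)
        then have "c + 1 = 4 ^ N" by simp
        then have "real (c + 1) = 4 ^ N" by (metis of_nat_numeral of_nat_power)
        moreover have "v * 4 ^ N \<le> 1 * 4 ^ N" using v by (intro mult_right_mono) auto
        ultimately show ?thesis by simp
      qed
      ultimately have *: "real c / 4 ^ N \<le> v" "v \<le> real (c + 1) / 4 ^ N" by (simp_all add: field_simps)
      define y where "y = real (snd p) / 4 ^ N"
      have "(v, y) \<in> grid_square N p"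
        using * p(2) by (simp add: grid_square_def cbox_Pair_eq y_def divide_right_mono)
      then have K2: "(v, y) \<in> K (2 * m)" using p(1) by (auto simp: K_def N_def)
      then have "(v, y) \<in> K 0" using anti[of 0 "2 * m"] by blast
      then have "y \<in> {0..1}" using \<open>K 0 = {0..1} \<times> {0..1}\<close> by blast
      then have "(v, y) \<in> F m" using K2 anti[of m "2 * m"] by (auto simp: F_def)
      then show "F m \<noteq> {}" by blast
    qed
    then obtain x where "x \<in> \<Inter>(range F)" by blast
    then have "x \<in> cantor_set n Cs" "fst x = v" unfolding C F_def by auto
    then show ?thesis by force
  qed
  then show "fst ` cantor_set n Cs = {0..1}" using sub by fastforce
qed

section \<open>The Kakeya set\<close>

text \<open>Because the index set is a full power of \<open>C\<close>, the coordinates decouple: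
  membership becomes a condition on each pair of height and one horizontal coordinate.\<close>

lemma K0_iff:
  fixes x :: "real^('m::finite option)"
  shows "x \<in> K0 C \<longleftrightarrow> x $ None \<in> {0..1} \<and> (\<forall>i. x $ Some i \<in> proj (x $ None) ` C)"
proof
  assume "x \<in> K0 C"
  then obtain v a t where vat: "\<forall>i. (v $ i, a $ i) \<in> C" "t \<in> {0..1}" "x = lift_pt a 0 + t *\<^sub>R lift_pt v 1"
    by (auto simp: K0_def)
  then show "x $ None \<in> {0..1} \<and> (\<forall>i. x $ Some i \<in> proj (x $ None) ` C)"
    by (auto simp: lift_pt_def proj_def intro!: image_eqI[where x = "(v $ i, a $ i)" for i])
next
  assume x: "x $ None \<in> {0..1} \<and> (\<forall>i. x $ Some i \<in> proj (x $ None) ` C)"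
  then have "\<forall>i. \<exists>p. p \<in> C \<and> x $ Some i = proj (x $ None) p" by blast
  then obtain p where p: "\<And>i. p i \<in> C" "\<And>i. x $ Some i = proj (x $ None) (p i)"
    by metis
  define v a :: "real^'m" where "v = (\<chi> i. fst (p i))" and "a = (\<chi> i. snd (p i))"
  have "x = lift_pt a 0 + (x $ None) *\<^sub>R lift_pt v 1"
    unfolding vec_eq_iff
  proof
    fix j show "x $ j = (lift_pt a 0 + (x $ None) *\<^sub>R lift_pt v 1) $ j"
      using p(2) by (cases j) (auto simp: lift_pt_def proj_def v_def a_def)
  qed
  moreover have "\<forall>i. (v $ i, a $ i) \<in> C" using p(1) by (simp add: v_def a_def)
  ultimately show "x \<in> K0 C" using x unfolding K0_def by blast
qed

lemma compact_K0:
  assumes "compact C"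
  shows "compact (K0 C :: (real^('m::finite option)) set)"
proof -
  have cl: "closed (K0 C :: (real^('m option)) set)"
  proof -
    have "K0 C = (\<Inter>i. {x :: real^('m option). (x $ None, x $ Some i) \<in> (\<lambda>(t, p). (t, proj t p)) ` ({0..1} \<times> C)})"
      by (auto simp: K0_iff image_iff)
    moreover have "closed {x :: real^('m option). (x $ None, x $ Some i) \<in> (\<lambda>(t, p). (t, proj t p)) ` ({0..1} \<times> C)}" for i
    proof -
      have "compact ((\<lambda>(t, p). (t, proj t p)) ` ({0..1::real} \<times> C))"
        by (intro compact_continuous_image compact_Times assms compact_Icc)
           (auto simp: case_prod_beta intro!: continuous_intros)
      then have "closed ((\<lambda>x :: real^('m option). (x $ None, x $ Some i)) -` ((\<lambda>(t, p). (t, proj t p)) ` ({0..1} \<times> C)))"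
        by (intro closed_vimage compact_imp_closed) (auto intro!: continuous_intros)
      then show ?thesis by (simp add: vimage_def)
    qed
    ultimately show ?thesis by auto
  qed
  obtain B where B: "\<And>p. p \<in> C \<Longrightarrow> norm p \<le> B"
    using compact_imp_bounded[OF assms] by (auto simp: bounded_iff)
  have "norm x \<le> real CARD('m option) * (1 + 2 * \<bar>B\<bar>)" if x: "x \<in> K0 C" for x :: "real^('m option)"
  proof -
    have t: "x $ None \<in> {0..1}" using x by (simp add: K0_iff)
    have "\<bar>x $ j\<bar> \<le> 1 + 2 * \<bar>B\<bar>" for j
    proof (cases j)
      case None
      then show ?thesis using t by auto
    next
      case (Some i)
      have "x $ Some i \<in> proj (x $ None) ` C" using x by (simp add: K0_iff)
      then obtain p where p: "p \<in> C" "x $ j = proj (x $ None) p" using Some by blast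
      have "\<bar>proj (x $ None) p - proj (x $ None) 0\<bar> \<le> 2 * dist p 0" by (rule proj_lipschitz[OF t])
      then show ?thesis using B[OF p(1)] p(2) by (simp add: proj_def)
    qed
    then have "(\<Sum>j\<in>UNIV. \<bar>x $ j\<bar>) \<le> of_nat (card (UNIV :: 'm option set)) * (1 + 2 * \<bar>B\<bar>)"
      by (intro sum_bounded_above) auto
    then show ?thesis using norm_le_l1_cart[of x] by simp
  qed
  then have "bounded (K0 C :: (real^('m option)) set)" by (auto simp: bounded_iff)
  with cl show ?thesis by (simp add: compact_eq_bounded_closed)
qed

text \<open>Two coordinates suffice: \<open>K0 C\<close> lies in a cylinder over the planar set
  \<open>S\<close>, whose sections at almost every height are null.\<close>

lemma K0_null:
  assumes C: "compact C" and null: "negligible {t \<in> {0..1}. \<not> negligible (proj t ` C)}"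
  shows "emeasure lborel (K0 C :: (real^('m::finite option)) set) = 0"
proof -
  let ?M = "\<lambda>_ :: real^('m option). lborel :: real measure"
  interpret product_sigma_finite ?M ..
  \<comment> \<open>The height and one arbitrary horizontal direction; \<open>undefined\<close>
    merely names an index.\<close>
  define b1 b2 :: "real^('m option)" where "b1 = axis None 1" and "b2 = axis (Some undefined) 1"
  have b: "b1 \<in> Basis" "b2 \<in> Basis" "b1 \<noteq> b2"
    by (auto simp: b1_def b2_def axis_in_Basis_iff axis_eq_axis)
  define S :: "(real \<times> real) set" where "S = (\<lambda>(t, p). (t, proj t p)) ` ({0..1} \<times> C)"
  have "compact S" unfolding S_def
    by (intro compact_continuous_image compact_Times C compact_Icc)
       (auto simp: case_prod_beta intro!: continuous_intros)
  then have S: "S \<in> sets borel" by (simp add: compact_imp_closed)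
  define I where "I = (Basis :: (real^('m option)) set) - {b2}"
  define I' where "I' = I - {b1}"
  have I: "finite I" "b2 \<notin> I" "Basis = insert b2 I" "finite I'" "b1 \<notin> I'" "I = insert b1 I'"
    using b by (auto simp: I_def I'_def)
  define \<phi> :: "(real^('m option) \<Rightarrow> real) \<Rightarrow> real^('m option)" where "\<phi> = (\<lambda>f. \<Sum>b\<in>Basis. f b *\<^sub>R b)"
  have lb: "lborel = distr (Pi\<^sub>M Basis ?M) borel \<phi>" unfolding \<phi>_def by (rule lborel_eq)
  have \<phi>: "\<phi> \<in> Pi\<^sub>M Basis ?M \<rightarrow>\<^sub>M borel" unfolding \<phi>_def by measurable
  have comp: "\<phi> f $ None = f b1" "\<phi> f $ Some undefined = f b2" for f
  proof -
    have "\<phi> f \<bullet> b1 = f b1" "\<phi> f \<bullet> b2 = f b2" using b by (simp_all add: \<phi>_def inner_sum_left_Basis)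
    then show "\<phi> f $ None = f b1" "\<phi> f $ Some undefined = f b2" by (simp_all add: b1_def b2_def inner_axis)
  qed
  define A where "A = {f \<in> space (Pi\<^sub>M Basis ?M). (f b1, f b2) \<in> S}"
  have pr: "(\<lambda>f. (f b1, f b2)) \<in> Pi\<^sub>M Basis ?M \<rightarrow>\<^sub>M borel"
    unfolding borel_prod[symmetric] using b by measurable
  then have A: "A \<in> sets (Pi\<^sub>M Basis ?M)"
    unfolding A_def using S by measurable
  have "emeasure lborel (K0 C :: (real^('m option)) set) = emeasure (Pi\<^sub>M Basis ?M) (\<phi> -` K0 C \<inter> space (Pi\<^sub>M Basis ?M))"
    using compact_K0[OF C, where ?'m = 'm] by (subst lb, subst emeasure_distr[OF \<phi>]) (auto simp: compact_imp_closed)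
  also have "\<dots> \<le> emeasure (Pi\<^sub>M Basis ?M) A"
  proof (rule emeasure_mono[OF _ A], intro subsetI)
    fix f assume f: "f \<in> \<phi> -` K0 C \<inter> space (Pi\<^sub>M Basis ?M)"
    then have "f b1 \<in> {0..1} \<and> (\<forall>i. \<phi> f $ Some i \<in> proj (f b1) ` C)"
      by (simp add: K0_iff comp(1))
    then have "f b1 \<in> {0..1}" "f b2 \<in> proj (f b1) ` C" using comp(2)[of f] by metis+
    then obtain p where p: "p \<in> C" "f b2 = proj (f b1) p" by blast
    have "(f b1, f b2) \<in> S"
      unfolding S_def by (rule image_eqI[where x = "(f b1, p)"]) (use p \<open>f b1 \<in> {0..1}\<close> in auto)
    then show "f \<in> A" using f by (simp add: A_def)
  qed
  also have "\<dots> = (\<integral>\<^sup>+f. indicator A f \<partial>Pi\<^sub>M (insert b2 I) ?M)" using A I by simp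
  also have "\<dots> = (\<integral>\<^sup>+f. (\<integral>\<^sup>+y. indicator A (f(b2 := y)) \<partial>lborel) \<partial>Pi\<^sub>M I ?M)"
    by (rule product_nn_integral_insert) (use I A in auto)
  also have "\<dots> = (\<integral>\<^sup>+f. emeasure lborel (Pair (f b1) -` S) \<partial>Pi\<^sub>M I ?M)"
  proof (rule nn_integral_cong)
    fix f assume f: "f \<in> space (Pi\<^sub>M I ?M)"
    have "indicator A (f(b2 := y)) = (indicator (Pair (f b1) -` S) y :: ennreal)" for y
    proof -
      have "f(b2 := y) \<in> space (Pi\<^sub>M Basis ?M)"
        using f I by (auto simp: space_PiM PiE_def extensional_def)
      then show ?thesis using b(3) by (auto simp: A_def indicator_def)
    qed
    moreover have "Pair (f b1) -` S \<in> sets borel"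
    proof -
      have "S \<in> sets (borel \<Otimes>\<^sub>M borel)" unfolding borel_prod by (rule S)
      then show ?thesis by (rule sets_Pair1)
    qed
    ultimately show "(\<integral>\<^sup>+y. indicator A (f(b2 := y)) \<partial>lborel) = emeasure lborel (Pair (f b1) -` S)" by simp
  qed
  also have "\<dots> = (\<integral>\<^sup>+f. (\<integral>\<^sup>+t. emeasure lborel (Pair ((f(b1 := t)) b1) -` S) \<partial>lborel) \<partial>Pi\<^sub>M I' ?M)"
    unfolding I(6)
  proof (rule product_nn_integral_insert)
    have "(\<lambda>t. emeasure lborel (Pair t -` S)) \<in> borel_measurable lborel"
    proof (rule lborel.measurable_emeasure_Pair)
      have "S \<in> sets (borel \<Otimes>\<^sub>M borel)" unfolding borel_prod by (rule S)
      then show "S \<in> sets (lborel \<Otimes>\<^sub>M lborel)" by (simp cong: sets_pair_measure_cong)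
    qed
    then show "(\<lambda>f. emeasure lborel (Pair (f b1) -` S)) \<in> borel_measurable (Pi\<^sub>M (insert b1 I') ?M)"
      by (rule measurable_compose[rotated]) (rule measurable_component_singleton, simp)
  qed (use I in auto)
  also have "\<dots> = (\<integral>\<^sup>+f. 0 \<partial>Pi\<^sub>M I' ?M)"
  proof (rule nn_integral_cong)
    fix f
    obtain Z where Z: "Z \<in> sets borel" "{t \<in> {0..1}. \<not> negligible (proj t ` C)} \<subseteq> Z" "emeasure lborel Z = 0"
      using negligible_subset_null_borel[OF null] by blast
    have zero: "emeasure lborel (Pair t -` S) = 0" if "t \<notin> Z" for t
    proof (cases "t \<in> {0..1}")
      case True
      have "(t, proj t p) \<in> S" if "p \<in> C" for p
        unfolding S_def by (rule image_eqI[where x = "(t, p)"]) (use True that in auto)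
      then have "Pair t -` S = proj t ` C" by (auto simp: S_def)
      moreover have "negligible (proj t ` C)" using that True Z(2) by blast
      moreover have "proj t ` C \<in> sets borel"
        using C by (auto intro!: borel_closed compact_imp_closed compact_continuous_image continuous_intros)
      ultimately show ?thesis by (simp add: negligible_iff_null_sets null_sets_def)
    next
      case False
      then have "Pair t -` S = {}" by (auto simp: S_def)
      then show ?thesis by simp
    qed
    have "AE t in lborel. emeasure lborel (Pair t -` S) = 0"
      by (rule AE_I'[of Z]) (use Z zero in \<open>auto simp: null_sets_def\<close>)
    then have "(\<integral>\<^sup>+t. emeasure lborel (Pair t -` S) \<partial>lborel) = (\<integral>\<^sup>+t. 0 \<partial>(lborel :: real measure))"
      by (rule nn_integral_cong_AE)
    then show "(\<integral>\<^sup>+t. emeasure lborel (Pair ((f(b1 := t)) b1) -` S) \<partial>lborel) = 0" by simp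
  qed
  finally show ?thesis by simp
qed

text \<open>The strict inequalities make the cone of directions \<open>(v, 1)\<close> open. In
  dimension at least 2 rotations act transitively on the sphere, so rotated cones cover it and
  compactness leaves finitely many.\<close>

lemma finite_rotation_cover:
  obtains R :: "((real^('m::finite option)) \<Rightarrow> real^('m option)) set"
  where "finite R" "id \<in> R" "\<And>\<rho>. \<rho> \<in> R \<Longrightarrow> rotation \<rho>"
    "\<And>e. norm e = 1 \<Longrightarrow> \<exists>\<rho>\<in>R. \<exists>c v. 0 < c \<and> c \<le> 1 \<and> (\<forall>i. v $ i \<in> {0..1}) \<and> e = \<rho> (c *\<^sub>R lift_pt v 1)"
proof -
  define O' :: "(real^('m option)) set" where "O' = {w. \<forall>i. 0 < w $ Some i \<and> w $ Some i < w $ None}"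
  have open_O: "open O'"
  proof -
    have "O' = (\<Inter>i. {w. 0 < w $ Some i} \<inter> {w. w $ Some i < w $ None})" by (auto simp: O'_def)
    moreover have "open ({w :: real^('m option). 0 < w $ Some i} \<inter> {w. w $ Some i < w $ None})" for i
      by (intro open_Int open_Collect_less continuous_intros)
    ultimately show ?thesis by (simp add: open_INT)
  qed
  define u0 :: "real^('m option)" where "u0 = (\<chi> j. case j of None \<Rightarrow> 2 | Some i \<Rightarrow> 1)"
  define u where "u = u0 /\<^sub>R norm u0"
  have "u0 \<noteq> 0" by (auto simp: vec_eq_iff u0_def intro!: exI[of _ None])
  then have u: "norm u = 1" "u \<in> O'" by (auto simp: u_def O'_def u0_def)
  have card2: "2 \<le> CARD('m option)" using zero_less_card_finite[where 'a = 'm] by (simp add: card_UNIV_option)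
  have rot_open: "open (\<rho> ` O')" if "rotation \<rho>" for \<rho> :: "real^('m option) \<Rightarrow> real^('m option)"
    using that open_O unfolding rotation_def
    by (intro open_surjective_linear_image) (auto simp: orthogonal_transformation_linear orthogonal_transformation_surj)
  have "\<exists>\<rho>. rotation \<rho> \<and> \<rho> u = e" if "norm e = 1" for e :: "real^('m option)"
    using rotation_exists[OF card2, of u e] that u unfolding rotation_def by metis
  then have cov: "sphere 0 1 \<subseteq> (\<Union>\<rho>\<in>{\<rho>. rotation \<rho>}. \<rho> ` O')"
    using u by (fastforce simp: dist_norm)
  obtain F where F: "F \<subseteq> {\<rho>. rotation \<rho>}" "finite F" "sphere 0 1 \<subseteq> (\<Union>\<rho>\<in>F. \<rho> ` O')"
    using compactE_image[OF compact_sphere _ cov] rot_open by (metis mem_Collect_eq)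
  show ?thesis
  \<comment> \<open>The identity is added so that the union contains \<open>K0\<close> itself, from
    which non-stickiness and the dimension bound are read off.\<close>
  proof (rule that[of "insert id F"])
    show "finite (insert id F)" "id \<in> insert id F" using F by auto
    have "rotation (id :: real^('m option) \<Rightarrow> real^('m option))"
      unfolding rotation_def
    proof
      show "orthogonal_transformation (id :: real^('m option) \<Rightarrow> real^('m option))"
        using orthogonal_transformation_id by (simp add: id_def)
      show "det (matrix (id :: real^('m option) \<Rightarrow> real^('m option))) = 1"
        by (metis matrix_id_mat_1 det_I)
    qed
    then show "rotation \<rho>" if "\<rho> \<in> insert id F" for \<rho>
      using that F(1) by auto
    fix e :: "real^('m option)" assume e: "norm e = 1"
    then have "e \<in> sphere 0 1" by simp
    then obtain \<rho> w where w: "\<rho> \<in> F" "w \<in> O'" "e = \<rho> w" using F(3) by blast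
    have "norm w = 1"
      using w F(1) e orthogonal_transformation_norm[of \<rho> w] by (auto simp: rotation_def)
    define c where "c = w $ None"
    define v :: "real^'m" where "v = (\<chi> i. w $ Some i / c)"
    have wi: "0 < w $ Some i" "w $ Some i < c" for i using w(2) by (auto simp: O'_def c_def)
    have c0: "0 < c" using wi[of undefined] by linarith
    have "c \<le> 1" using component_le_norm_cart[of w None] \<open>norm w = 1\<close> by (simp add: c_def)
    moreover have "v $ i \<in> {0..1}" for i using wi[of i] c0 by (simp add: v_def)
    moreover have "w = c *\<^sub>R lift_pt v 1"
      unfolding vec_eq_iff
    proof
      fix j show "w $ j = (c *\<^sub>R lift_pt v 1) $ j"
        using c0 by (cases j) (auto simp: lift_pt_def v_def c_def)
    qed
    ultimately show "\<exists>\<rho>\<in>insert id F. \<exists>c v. 0 < c \<and> c \<le> 1 \<and> (\<forall>i. v $ i \<in> {0..1}) \<and> e = \<rho> (c *\<^sub>R lift_pt v 1)"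
      using w c0 by (intro bexI[of _ \<rho>] exI[of _ c] exI[of _ v]) auto
  qed
qed

lemma segment_in_K0:
  fixes v a :: "real^'m::finite"
  assumes "\<And>i. (v $ i, a $ i) \<in> C" "0 \<le> c" "c \<le> 1"
  shows "closed_segment (lift_pt a 0) (lift_pt a 0 + c *\<^sub>R lift_pt v 1) \<subseteq> K0 C"
proof
  fix x assume "x \<in> closed_segment (lift_pt a 0) (lift_pt a 0 + c *\<^sub>R lift_pt v 1)"
  then obtain s where s: "0 \<le> s" "s \<le> 1" "x = (1 - s) *\<^sub>R lift_pt a 0 + s *\<^sub>R (lift_pt a 0 + c *\<^sub>R lift_pt v 1)"
    by (auto simp: closed_segment_def)
  then have "x = lift_pt a 0 + (s * c) *\<^sub>R lift_pt v 1" by (simp add: algebra_simps)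
  moreover have "s * c \<in> {0..1}" using s assms by (auto intro: mult_le_one)
  ultimately show "x \<in> K0 C" using assms(1) unfolding K0_def by blast
qed

lemma kakeya_rotated_K0:
  fixes R :: "((real^('m::finite option)) \<Rightarrow> real^('m option)) set"
  assumes C: "compact C" "fst ` C = {0..1}" and R: "finite R" "\<And>\<rho>. \<rho> \<in> R \<Longrightarrow> rotation \<rho>"
    and cover: "\<And>e. norm e = 1 \<Longrightarrow> \<exists>\<rho>\<in>R. \<exists>c v. 0 < c \<and> c \<le> 1 \<and> (\<forall>i. v $ i \<in> {0..1}) \<and> e = \<rho> (c *\<^sub>R lift_pt v 1)"
  shows "kakeya_set (\<Union>\<rho>\<in>R. \<rho> ` K0 C)"
  unfolding kakeya_set_def
proof (intro conjI allI impI)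
  have lin: "linear \<rho>" if "\<rho> \<in> R" for \<rho>
    using R(2)[OF that] by (simp add: rotation_def orthogonal_transformation_linear)
  show "compact (\<Union>\<rho>\<in>R. \<rho> ` K0 C)"
    using R(1) lin by (intro compact_UN compact_continuous_image linear_continuous_on compact_K0 C)
      (auto simp: linear_conv_bounded_linear)
  fix e :: "real^('m option)" assume "norm e = 1"
  then obtain \<rho> c v where *: "\<rho> \<in> R" "0 < c" "c \<le> 1" "\<And>i. v $ i \<in> {0..1}" "e = \<rho> (c *\<^sub>R lift_pt v 1)"
    using cover by blast
  have "\<forall>i. \<exists>y. (v $ i, y) \<in> C"
  proof
    fix i
    have "v $ i \<in> fst ` C" using * C(2) by simp
    then show "\<exists>y. (v $ i, y) \<in> C" by force
  qed
  then obtain y where y: "\<And>i. (v $ i, y i) \<in> C" by metis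
  define a :: "real^'m" where "a = (\<chi> i. y i)"
  interpret linear \<rho> by (rule lin[OF *(1)])
  have "closed_segment (\<rho> (lift_pt a 0)) (\<rho> (lift_pt a 0) + e) = \<rho> ` closed_segment (lift_pt a 0) (lift_pt a 0 + c *\<^sub>R lift_pt v 1)"
    using closed_segment_linear_image[OF lin[OF *(1)], of "lift_pt a 0" "lift_pt a 0 + c *\<^sub>R lift_pt v 1"] *(5)
    by (simp only: add)
  also have "\<dots> \<subseteq> \<rho> ` K0 C"
    using y * by (intro image_mono segment_in_K0) (auto simp: a_def)
  finally show "\<exists>x. closed_segment x (x + e) \<subseteq> (\<Union>\<rho>\<in>R. \<rho> ` K0 C)" using *(1) by blast
qed

text \<open>The segment over heights 0 to 1 has length \<open>norm (lift_pt v 1)\<close>, which is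
  at least 1, so a unit piece of it stays in \<open>K\<close>.\<close>

lemma A_set_K0:
  fixes K :: "(real^('m::finite option)) set"
  assumes "K0 C \<subseteq> K"
  shows "{(v, a). \<forall>i. (v $ i, a $ i) \<in> C} \<subseteq> A_set K"
proof clarify
  fix v a :: "real^'m" assume va: "\<forall>i. (v $ i, a $ i) \<in> C"
  define d where "d = lift_pt v 1"
  have d: "1 \<le> norm d" using component_le_norm_cart[of d None] by (simp add: d_def lift_pt_def)
  define c where "c = 1 / norm d"
  have "0 < norm d" using d by linarith
  then have c: "0 \<le> c" "c \<le> 1" "norm (c *\<^sub>R d) = 1" using d by (auto simp: c_def field_simps)
  let ?x = "lift_pt a 0" and ?y = "lift_pt a 0 + c *\<^sub>R d"
  have "closed_segment ?x ?y \<subseteq> line_va v a"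
  proof
    fix z assume "z \<in> closed_segment ?x ?y"
    then obtain s where "z = (1 - s) *\<^sub>R ?x + s *\<^sub>R ?y" by (auto simp: closed_segment_def)
    then have "z = ?x + (s * c) *\<^sub>R lift_pt v 1" by (simp add: algebra_simps d_def)
    then show "z \<in> line_va v a" unfolding line_va_def by blast
  qed
  moreover have "closed_segment ?x ?y \<subseteq> K"
    using segment_in_K0[of v a C c] va c assms unfolding d_def by blast
  moreover have "dist ?x ?y = 1" using c(3) by (simp add: dist_norm)
  ultimately show "(v, a) \<in> A_set K" unfolding A_set_def contains_unit_segment_def by blast
qed

section \<open>Packing dimension\<close>

lemma packing_pre_finite:
  fixes w :: "'i \<Rightarrow> 'a::metric_space"
  assumes I: "finite I" and w: "\<And>i. i \<in> I \<Longrightarrow> w i \<in> A" and \<rho>: "\<And>i. i \<in> I \<Longrightarrow> 0 < \<rho> i \<and> \<rho> i \<le> \<delta>"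
    and disj: "\<And>i j. i \<in> I \<Longrightarrow> j \<in> I \<Longrightarrow> i \<noteq> j \<Longrightarrow> cball (w i) (\<rho> i) \<inter> cball (w j) (\<rho> j) = {}"
    and \<delta>: "0 \<le> \<delta>"
  shows "(\<Sum>i\<in>I. ennreal ((2 * \<rho> i) powr s)) \<le> packing_pre s \<delta> A"
proof -
  obtain h where h: "bij_betw h {..<card I} I"
    using ex_bij_betw_nat_finite[OF I] by (auto simp: atLeast0LessThan)
  have hI: "h k \<in> I" if "k < card I" for k using h that by (auto simp: bij_betw_def)
  define xr where "xr = (\<lambda>k. if k < card I then (w (h k), \<rho> (h k)) else (undefined, 0))"
  have "(\<Sum>i\<in>I. ennreal ((2 * \<rho> i) powr s)) = (\<Sum>k<card I. ennreal ((2 * \<rho> (h k)) powr s))"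
    using sum.reindex_bij_betw[OF h] by (rule sym)
  also have "\<dots> = (\<Sum>k<card I. ennreal (if snd (xr k) = 0 then 0 else (2 * snd (xr k)) powr s))"
    using \<rho>[OF hI] by (intro sum.cong) (auto simp: xr_def)
  also have "\<dots> = (\<Sum>k. ennreal (if snd (xr k) = 0 then 0 else (2 * snd (xr k)) powr s))"
    by (rule suminf_finite[symmetric]) (auto simp: xr_def)
  also have "\<dots> \<le> packing_pre s \<delta> A"
    unfolding packing_pre_def
  proof (rule SUP_upper, intro CollectI conjI allI impI)
    fix i j :: nat
    show "0 \<le> snd (xr i)" "snd (xr i) \<le> \<delta>" using \<rho>[OF hI, of i] \<delta> by (auto simp: xr_def)
    show "fst (xr i) \<in> A" if "0 < snd (xr i)" using that w[OF hI, of i] by (auto simp: xr_def split: if_splits)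
    assume ij: "i \<noteq> j" "0 < snd (xr i)" "0 < snd (xr j)"
    then have "i < card I" "j < card I" by (auto simp: xr_def split: if_splits)
    moreover have "h i \<noteq> h j" using h ij calculation by (auto simp: bij_betw_def inj_on_def)
    ultimately show "cball (fst (xr i)) (snd (xr i)) \<inter> cball (fst (xr j)) (snd (xr j)) = {}"
      using disj hI by (simp add: xr_def)
  qed
  finally show ?thesis .
qed

text \<open>The series is a supremum of partial sums, and dummy radii drop out, so finite honest
  packings decide the bound.\<close>

lemma packing_pre_leI:
  fixes A :: "'a::metric_space set"
  assumes "\<And>(x :: nat \<Rightarrow> 'a) r I. finite I \<Longrightarrow> (\<And>i. i \<in> I \<Longrightarrow> 0 < r i \<and> r i \<le> \<delta> \<and> x i \<in> A) \<Longrightarrow>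
     (\<And>i j. i \<in> I \<Longrightarrow> j \<in> I \<Longrightarrow> i \<noteq> j \<Longrightarrow> cball (x i) (r i) \<inter> cball (x j) (r j) = {}) \<Longrightarrow>
     (\<Sum>i\<in>I. ennreal ((2 * r i) powr s)) \<le> c"
  shows "packing_pre s \<delta> A \<le> c"
  unfolding packing_pre_def
proof (rule SUP_least)
  fix xr :: "nat \<Rightarrow> 'a \<times> real"
  assume xr: "xr \<in> {xr. (\<forall>i. 0 \<le> snd (xr i) \<and> snd (xr i) \<le> \<delta> \<and> (0 < snd (xr i) \<longrightarrow> fst (xr i) \<in> A)) \<and>
                  (\<forall>i j. i \<noteq> j \<longrightarrow> 0 < snd (xr i) \<longrightarrow> 0 < snd (xr j) \<longrightarrow>
                      cball (fst (xr i)) (snd (xr i)) \<inter> cball (fst (xr j)) (snd (xr j)) = {})}"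
  show "(\<Sum>i. ennreal (if snd (xr i) = 0 then 0 else (2 * snd (xr i)) powr s)) \<le> c"
  proof (rule suminf_le_const)
    fix N
    define I where "I = {i. i < N \<and> 0 < snd (xr i)}"
    have "(\<Sum>i<N. ennreal (if snd (xr i) = 0 then 0 else (2 * snd (xr i)) powr s)) = (\<Sum>i\<in>I. ennreal ((2 * snd (xr i)) powr s))"
    proof (rule sum.mono_neutral_cong_right)
      show "\<forall>i\<in>{..<N} - I. ennreal (if snd (xr i) = 0 then 0 else (2 * snd (xr i)) powr s) = 0"
        using xr by (auto simp: I_def order_less_le)
    qed (auto simp: I_def)
    also have "\<dots> \<le> c"
      by (rule assms[of I "\<lambda>i. snd (xr i)" "\<lambda>i. fst (xr i)"]) (use xr in \<open>auto simp: I_def\<close>)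
    finally show "(\<Sum>i<N. ennreal (if snd (xr i) = 0 then 0 else (2 * snd (xr i)) powr s)) \<le> c" .
  qed simp
qed

lemma packing_premeasure_empty [simp]: "packing_premeasure s ({} :: 'a::metric_space set) = 0"
proof -
  have "packing_pre s 1 ({} :: 'a set) \<le> 0"
  proof (rule packing_pre_leI)
    fix x :: "nat \<Rightarrow> 'a" and r :: "nat \<Rightarrow> real" and I :: "nat set"
    assume "\<And>i. i \<in> I \<Longrightarrow> 0 < r i \<and> r i \<le> 1 \<and> x i \<in> {}"
    then have "I = {}" by blast
    then show "(\<Sum>i\<in>I. ennreal ((2 * r i) powr s)) \<le> 0" by simp
  qed
  moreover have "packing_premeasure s ({} :: 'a set) \<le> packing_pre s 1 ({} :: 'a set)"
    unfolding packing_premeasure_def by (rule INF_lower) simp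
  ultimately show ?thesis by simp
qed

lemma packing_measure_mono:
  "A \<subseteq> B \<Longrightarrow> packing_measure s A \<le> packing_measure s B"
  unfolding packing_measure_def by (rule INF_superset_mono) auto

lemma packing_measure_le_premeasure: "packing_measure s A \<le> packing_premeasure s A"
proof -
  have "packing_measure s A \<le> (\<Sum>i. packing_premeasure s (if i = 0 then A else {}))"
    unfolding packing_measure_def by (rule INF_lower) auto
  also have "\<dots> = (\<Sum>i\<in>{0::nat}. packing_premeasure s (if i = 0 then A else {}))"
    by (rule suminf_finite) auto
  finally show ?thesis by simp
qed

lemma packing_measure_UN_null:
  fixes A :: "nat \<Rightarrow> 'a::metric_space set"
  assumes "\<And>n. packing_measure s (A n) = 0"
  shows "packing_measure s (\<Union>n. A n) = 0"
proof -
  have le: "packing_measure s (\<Union>n. A n) \<le> 0 + ennreal e" if e: "e > 0" for e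
  proof -
    have "\<exists>B. A n \<subseteq> (\<Union>i. B i) \<and> (\<Sum>i::nat. packing_premeasure s (B i)) < ennreal (e * (1/2) ^ Suc n)" for n
    proof -
      have "packing_measure s (A n) < ennreal (e * (1/2) ^ Suc n)" using assms e by simp
      then show ?thesis unfolding packing_measure_def INF_less_iff by auto
    qed
    then obtain B where B: "\<And>n. A n \<subseteq> (\<Union>i. B n i)"
      "\<And>n. (\<Sum>i::nat. packing_premeasure s (B n i)) < ennreal (e * (1/2) ^ Suc n)" by metis
    define V where "V = case_prod B \<circ> prod_decode"
    have "(\<Union>n. A n) \<subseteq> (\<Union>i. V i)"
      using B(1) by (auto simp: V_def subset_eq) (metis prod.case prod_encode_inverse)
    then have "packing_measure s (\<Union>n. A n) \<le> (\<Sum>i. packing_premeasure s (V i))"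
      unfolding packing_measure_def by (intro INF_lower) auto
    also have "\<dots> = (\<Sum>n. \<Sum>i. packing_premeasure s (B n i))"
      unfolding V_def comp_def
      by (rule suminf_ennreal_2dimen[where f = "\<lambda>p. packing_premeasure s (case_prod B p)"]) simp
    also have "\<dots> \<le> (\<Sum>n. 0 + ennreal (e * (1/2) ^ Suc n))"
      using B(2) by (intro suminf_le) (auto intro: less_imp_le)
    also have "\<dots> = (\<Sum>n::nat. 0) + ennreal e" by (rule suminf_ennreal_add_geometric[OF e])
    finally show ?thesis by simp
  qed
  have "packing_measure s (\<Union>n. A n) \<le> 0"
    by (rule ennreal_le_epsilon) (rule le)
  then show ?thesis by simp
qed

lemma packing_measure_countable_UN_null:
  assumes "countable I" "\<And>i. i \<in> I \<Longrightarrow> packing_measure s (A i) = 0"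
  shows "packing_measure s (\<Union>i\<in>I. A i) = 0"
proof (cases "I = {}")
  case True
  then show ?thesis
    using packing_measure_le_premeasure[of s "{} :: 'b set"] by simp
next
  case False
  have "(\<Union>i\<in>I. A i) = (\<Union>n. A (from_nat_into I n))"
    using range_from_nat_into[OF False assms(1)] by (metis UN_extend_simps(10) image_image)
  then show ?thesis
    using packing_measure_UN_null[of s "\<lambda>n. A (from_nat_into I n)"] assms(2) from_nat_into[OF False] by simp
qed

lemma packing_measure_Un_null:
  assumes "packing_measure s A = 0" "packing_measure s B = 0"
  shows "packing_measure s (A \<union> B) = 0"
proof -
  have "packing_measure s (\<Union>X\<in>{A, B}. X) = 0"
    by (rule packing_measure_countable_UN_null) (use assms in auto)
  then show ?thesis by simp
qed

lemma ennreal_le_powr_imp_zero: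
  fixes x :: ennreal
  assumes le: "\<And>\<delta>. 0 < \<delta> \<Longrightarrow> \<delta> < \<delta>0 \<Longrightarrow> x \<le> ennreal (V * \<delta> powr g)" and g: "g > 0" and \<delta>0: "\<delta>0 > 0"
  shows "x = 0"
proof -
  have "((\<lambda>\<delta>. ennreal (V * \<delta> powr g)) \<longlongrightarrow> ennreal (V * 0)) (at_right 0)"
  proof (intro tendsto_ennrealI tendsto_mult tendsto_const)
    have "((\<lambda>\<delta>. \<delta> powr g) \<longlongrightarrow> 0 powr g) (at_right (0::real))"
      by (rule tendsto_powr2) (use g in \<open>auto simp: eventually_at_filter intro!: tendsto_ident_at\<close>)
    then show "((\<lambda>\<delta>::real. \<delta> powr g) \<longlongrightarrow> 0) (at_right 0)" by simp
  qed
  then have "x \<le> ennreal (V * 0)"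
  proof (rule tendsto_lowerbound)
    show "\<forall>\<^sub>F \<delta> in at_right 0. x \<le> ennreal (V * \<delta> powr g)"
      unfolding eventually_at_right_field using le \<delta>0 by (intro exI[of _ \<delta>0]) auto
  qed simp
  then show ?thesis by simp
qed

lemma packing_premeasure_eq_0I:
  assumes le: "\<And>\<delta>. 0 < \<delta> \<Longrightarrow> \<delta> \<le> \<delta>0 \<Longrightarrow> packing_pre s \<delta> A \<le> ennreal (V * \<delta> powr g)"
    and g: "g > 0" and \<delta>0: "\<delta>0 > 0"
  shows "packing_premeasure s A = 0"
proof -
  have le': "packing_premeasure s A \<le> ennreal (V * \<delta> powr g)" if "0 < \<delta>" "\<delta> < \<delta>0" for \<delta>
  proof -
    have "packing_premeasure s A \<le> packing_pre s \<delta> A"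
      unfolding packing_premeasure_def by (rule INF_lower) (use that in simp)
    also have "\<dots> \<le> ennreal (V * \<delta> powr g)" using that by (intro le) auto
    finally show ?thesis .
  qed
  show ?thesis by (rule ennreal_le_powr_imp_zero[OF le' g \<delta>0])
qed

text \<open>Disjoint balls inside the ball of radius \<open>R + 1\<close> have bounded total volume;
  the unit ball volume cancels.\<close>

lemma sum_radii_power_le:
  fixes x :: "'i \<Rightarrow> 'a::euclidean_space"
  assumes I: "finite I" and r: "\<And>i. i \<in> I \<Longrightarrow> 0 \<le> r i \<and> r i \<le> 1 \<and> x i \<in> cball 0 R"
    and disj: "\<And>i j. i \<in> I \<Longrightarrow> j \<in> I \<Longrightarrow> i \<noteq> j \<Longrightarrow> cball (x i) (r i) \<inter> cball (x j) (r j) = {}"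
    and R: "R \<ge> 0"
  shows "(\<Sum>i\<in>I. r i ^ DIM('a)) \<le> (R + 1) ^ DIM('a)"
proof -
  define u where "u = unit_ball_vol (real DIM('a))"
  have u: "u > 0" by (simp add: u_def)
  have "(\<Sum>i\<in>I. u * r i ^ DIM('a)) = (\<Sum>i\<in>I. measure lborel (cball (x i) (r i)))"
  proof (rule sum.cong)
    fix i assume "i \<in> I"
    then have "0 \<le> r i" using r by auto
    then show "u * r i ^ DIM('a) = measure lborel (cball (x i) (r i))" by (simp add: content_cball u_def)
  qed simp
  also have "\<dots> = measure lborel (\<Union>i\<in>I. cball (x i) (r i))"
  proof (rule measure_finite_Union[symmetric, OF I])
    show "disjoint_family_on (\<lambda>i. cball (x i) (r i)) I"
      unfolding disjoint_family_on_def using disj by blast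
    show "emeasure lborel (cball (x i) (r i)) \<noteq> \<infinity>" for i
      using emeasure_lborel_cball_finite[of "x i" "r i"] by simp
  qed auto
  also have "\<dots> \<le> measure lborel (cball (0::'a) (R + 1))"
  proof (rule measure_mono_fmeasurable)
    show "(\<Union>i\<in>I. cball (x i) (r i)) \<subseteq> cball 0 (R + 1)"
    proof clarify
      fix i y assume "i \<in> I" "y \<in> cball (x i) (r i)"
      then have "norm (x i) \<le> R" "norm (x i - y) \<le> 1" using r[of i] by (auto simp: dist_norm)
      then show "y \<in> cball 0 (R + 1)" using norm_triangle_sub[of y "x i"] by (simp add: norm_minus_commute)
    qed
    show "(\<Union>i\<in>I. cball (x i) (r i)) \<in> sets lborel" using I by (intro sets.finite_UN) auto
    show "cball (0::'a) (R + 1) \<in> fmeasurable lborel"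
      by (rule fmeasurableI) (use emeasure_lborel_cball_finite[of "0::'a" "R + 1"] in auto)
  qed
  also have "\<dots> = u * (R + 1) ^ DIM('a)" using R by (simp add: content_cball u_def)
  finally show ?thesis
    using u by (simp flip: sum_distrib_left)
qed

text \<open>It makes the set of exponents in \<open>packing_dim\<close> nonempty, without which its
  infimum would say nothing.\<close>

lemma packing_measure_above_dim:
  fixes A :: "'a::euclidean_space set"
  assumes s: "s > real DIM('a)"
  shows "packing_measure s A = 0"
proof -
  have bdd: "packing_premeasure s (cball (0::'a) R) = 0" if R: "R > 0" for R
  proof -
    define g where "g = s - real DIM('a)"
    define V where "V = 2 powr s * ((R + 1) ^ DIM('a))"
    have pre: "packing_pre s \<delta> (cball (0::'a) R) \<le> ennreal (V * \<delta> powr g)" if \<delta>: "0 < \<delta>" "\<delta> \<le> 1" for \<delta>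
    proof (rule packing_pre_leI)
      fix x :: "nat \<Rightarrow> 'a" and r I
      assume I: "finite I" and r: "\<And>i. i \<in> I \<Longrightarrow> 0 < r i \<and> r i \<le> \<delta> \<and> x i \<in> cball 0 R"
        and disj: "\<And>i j. i \<in> I \<Longrightarrow> j \<in> I \<Longrightarrow> i \<noteq> j \<Longrightarrow> cball (x i) (r i) \<inter> cball (x j) (r j) = {}"
      have vol: "(\<Sum>i\<in>I. r i ^ DIM('a)) \<le> (R + 1) ^ DIM('a)"
      proof (rule sum_radii_power_le[OF I _ disj])
        show "0 \<le> r i \<and> r i \<le> 1 \<and> x i \<in> cball 0 R" if "i \<in> I" for i using r[OF that] \<delta> by auto
      qed (use R in auto)
      have "(\<Sum>i\<in>I. (2 * r i) powr s) \<le> (\<Sum>i\<in>I. 2 powr s * \<delta> powr g * r i ^ DIM('a))"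
      proof (rule sum_mono)
        fix i assume i: "i \<in> I"
        have "(2 * r i) powr s = 2 powr s * (r i powr g * r i ^ DIM('a))"
          using r[OF i] by (simp add: powr_mult g_def powr_diff powr_realpow)
        also have "\<dots> \<le> 2 powr s * (\<delta> powr g * r i ^ DIM('a))"
          using r[OF i] s by (intro mult_left_mono mult_right_mono powr_mono2) (auto simp: g_def)
        finally show "(2 * r i) powr s \<le> 2 powr s * \<delta> powr g * r i ^ DIM('a)" by simp
      qed
      also have "\<dots> = 2 powr s * \<delta> powr g * (\<Sum>i\<in>I. r i ^ DIM('a))" by (simp add: sum_distrib_left)
      also have "\<dots> \<le> 2 powr s * \<delta> powr g * (R + 1) ^ DIM('a)"
        using vol by (intro mult_left_mono) auto
      also have "\<dots> = V * \<delta> powr g" by (simp add: V_def)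
      finally have "(\<Sum>i\<in>I. (2 * r i) powr s) \<le> V * \<delta> powr g" .
      then show "(\<Sum>i\<in>I. ennreal ((2 * r i) powr s)) \<le> ennreal (V * \<delta> powr g)"
        by (simp add: ennreal_leI)
    qed
    show ?thesis
      by (rule packing_premeasure_eq_0I[where ?\<delta>0.0 = 1]) (use pre s in \<open>auto simp: g_def\<close>)
  qed
  have "packing_measure s (\<Union>n. cball (0::'a) (real (Suc n))) = 0"
  proof (rule packing_measure_UN_null)
    fix n
    have "packing_measure s (cball (0::'a) (real (Suc n))) \<le> packing_premeasure s (cball (0::'a) (real (Suc n)))"
      by (rule packing_measure_le_premeasure)
    also have "\<dots> = 0" by (rule bdd) simp
    finally show "packing_measure s (cball (0::'a) (real (Suc n))) = 0" by simp
  qed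
  moreover have "A \<subseteq> (\<Union>n. cball (0::'a) (real (Suc n)))"
  proof
    fix x :: 'a
    obtain n :: nat where "norm x \<le> real n" using real_arch_simple by blast
    then have "x \<in> cball 0 (real (Suc n))" by simp
    then show "x \<in> (\<Union>n. cball (0::'a) (real (Suc n)))" by blast
  qed
  ultimately show ?thesis
    using packing_measure_mono[of A] by (metis le_zero_eq)
qed

text \<open>Removing all relatively open subsets of packing measure zero leaves a closed set whose
  portions all have positive packing premeasure.\<close>

lemma packing_kernel:
  fixes C :: "'a::{metric_space,second_countable_topology} set"
  assumes C: "closed C" "packing_measure s C \<noteq> 0"
  obtains C' where "closed C'" "C' \<subseteq> C" "C' \<noteq> {}"
    "\<And>U. open U \<Longrightarrow> U \<inter> C' \<noteq> {} \<Longrightarrow> packing_premeasure s (C' \<inter> U) \<noteq> 0"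
proof -
  obtain \<B> :: "'a set set" where \<B>: "countable \<B>" "\<And>B. B \<in> \<B> \<Longrightarrow> open B"
    "\<And>S. open S \<Longrightarrow> \<exists>\<U>. \<U> \<subseteq> \<B> \<and> S = \<Union>\<U>"
    using univ_second_countable by metis
  \<comment> \<open>Restricting to a countable base keeps the removed part a countable union of null
    sets, hence null.\<close>
  define \<N> where "\<N> = {B \<in> \<B>. packing_measure s (C \<inter> B) = 0}"
  define C' where "C' = C - \<Union>\<N>"
  have null: "packing_measure s (\<Union>B\<in>\<N>. C \<inter> B) = 0"
    by (rule packing_measure_countable_UN_null) (use \<B>(1) in \<open>auto simp: \<N>_def\<close>)
  have cl: "closed C'" unfolding C'_def using C(1) \<B>(2) by (intro closed_Diff open_Union) (auto simp: \<N>_def)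
  have pos: "packing_premeasure s (C' \<inter> U) \<noteq> 0" if U: "open U" "U \<inter> C' \<noteq> {}" for U
  proof
    assume "packing_premeasure s (C' \<inter> U) = 0"
    then have "packing_measure s (C' \<inter> U) = 0"
      using packing_measure_le_premeasure[of s "C' \<inter> U"] by simp
    from packing_measure_Un_null[OF this null] have 0: "packing_measure s (C' \<inter> U \<union> (\<Union>B\<in>\<N>. C \<inter> B)) = 0" .
    obtain x where x: "x \<in> U" "x \<in> C'" using U by blast
    obtain \<U> where "\<U> \<subseteq> \<B>" "U = \<Union>\<U>" using \<B>(3)[OF U(1)] by blast
    then obtain B where B: "B \<in> \<B>" "x \<in> B" "B \<subseteq> U" using x by blast
    have "C \<inter> B \<subseteq> C' \<inter> U \<union> (\<Union>B\<in>\<N>. C \<inter> B)" using B by (auto simp: C'_def)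
    then have "packing_measure s (C \<inter> B) = 0" using packing_measure_mono 0 by (metis le_zero_eq)
    then have "B \<in> \<N>" using B by (simp add: \<N>_def)
    then show False using x B by (auto simp: C'_def)
  qed
  have "C' \<noteq> {}"
  proof
    assume "C' = {}"
    then have "C \<subseteq> (\<Union>B\<in>\<N>. C \<inter> B)" by (auto simp: C'_def)
    then show False using packing_measure_mono null C(2) by (metis le_zero_eq)
  qed
  then show ?thesis using that[of C'] cl pos by (auto simp: C'_def)
qed

section \<open>Transplanting packings between a product and its factor\<close>

lemma dist_gt_of_disjoint_cballs:
  fixes a b :: "'a::real_normed_vector"
  assumes "cball a r \<inter> cball b s = {}" "0 < r" "0 < s"
  shows "r + s < dist a b"
proof (rule ccontr)
  assume "\<not> r + s < dist a b"
  then have le: "norm (b - a) \<le> r + s" by (simp add: dist_norm norm_minus_commute)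
  \<comment> \<open>The point dividing the segment in the ratio \<open>r : s\<close> would lie in
    both balls; this needs the linear structure.\<close>
  define z where "z = a + (r / (r + s)) *\<^sub>R (b - a)"
  have "dist a z = r / (r + s) * norm (b - a)" using assms by (simp add: z_def dist_norm)
  also have "\<dots> \<le> r / (r + s) * (r + s)" using le assms by (intro mult_left_mono) auto
  finally have 1: "dist a z \<le> r" using assms by simp
  have "b - z = (1 - r / (r + s)) *\<^sub>R (b - a)" by (simp add: z_def algebra_simps)
  also have "1 - r / (r + s) = s / (r + s)" using assms by (simp add: field_simps)
  finally have "dist b z = s / (r + s) * norm (b - a)" using assms by (simp add: dist_norm)
  also have "\<dots> \<le> s / (r + s) * (r + s)" using le assms by (intro mult_left_mono) auto
  finally have 2: "dist b z \<le> s" using assms by simp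
  show False using assms(1) 1 2 by auto
qed

lemma disjoint_cballs_of_dist_gt:
  fixes a b :: "'a::metric_space"
  assumes "r + s < dist a b"
  shows "cball a r \<inter> cball b s = {}"
proof (rule equals0I)
  fix z assume "z \<in> cball a r \<inter> cball b s"
  then show False using assms dist_triangle2[of a b z] by auto
qed

text \<open>A packing of \<open>E\<close> is transplanted to \<open>B\<close>: over every ball of radius \<open>r\<close> one places a grid of mesh
  \<open>3 r\<close> in the remaining \<open>m - 1\<close> coordinates, which raises the exponent by \<open>m - 1\<close>; the centres
  are then moved slightly to points of the dense projection of \<open>B\<close> and lifted.\<close>

lemma packing_transplant:
  fixes B :: "((real^'m::finite) \<times> (real^'m)) set" and E :: "(real \<times> real) set"
    and i0 :: 'm and \<alpha> :: "'m \<Rightarrow> real"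
  assumes dense: "\<And>v b. (v $ i0, b) \<in> E \<Longrightarrow> (\<And>l. l \<noteq> i0 \<Longrightarrow> \<alpha> l \<le> v $ l \<and> v $ l \<le> \<alpha> l + \<kappa>) \<Longrightarrow>
      (v, b) \<in> closure ((\<lambda>(v, a). (v, a $ i0)) ` B)"
    and \<kappa>: "\<kappa> > 0" and B: "packing_pre s \<delta>0 B \<le> 1"
    and gap: "s < s1 + (real CARD('m) - 1)" and \<delta>: "0 < \<delta>" "\<delta> \<le> \<delta>0"
  shows "packing_pre s1 \<delta> E \<le>
    ennreal (2 powr s1 * (3 / \<kappa>) ^ (CARD('m) - 1) * \<delta> powr (s1 + (real CARD('m) - 1) - s))"
proof (rule packing_pre_leI)
  let ?m = "CARD('m) - 1"
  have m: "real ?m = real CARD('m) - 1"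
    using one_le_card_finite[where 'a = 'm] by (simp add: of_nat_diff)
  define g where "g = s1 + (real CARD('m) - 1) - s"
  have g: "g > 0" using gap by (simp add: g_def)
  define Pr :: "(real^'m) \<times> (real^'m) \<Rightarrow> (real^'m) \<times> real" where "Pr = (\<lambda>(v, a). (v, a $ i0))"
  have Pr_lip: "dist (Pr w) (Pr w') \<le> dist w w'" for w w'
  proof -
    have "dist (snd w $ i0) (snd w' $ i0) \<le> dist (snd w) (snd w')" by (rule dist_vec_nth_le)
    then show ?thesis
      unfolding Pr_def dist_prod_def case_prod_beta
      by (auto intro!: real_sqrt_le_mono add_mono power_mono)
  qed
  fix x :: "nat \<Rightarrow> real \<times> real" and r :: "nat \<Rightarrow> real" and I :: "nat set"
  assume I: "finite I" and r: "\<And>i. i \<in> I \<Longrightarrow> 0 < r i \<and> r i \<le> \<delta> \<and> x i \<in> E"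
    and disj: "\<And>i j. i \<in> I \<Longrightarrow> j \<in> I \<Longrightarrow> i \<noteq> j \<Longrightarrow> cball (x i) (r i) \<inter> cball (x j) (r j) = {}"
  \<comment> \<open>The number of steps of length \<open>3 * r i\<close> that fit into the available
    side \<kappa>.\<close>
  define N where "N = (\<lambda>i. nat \<lfloor>\<kappa> / (3 * r i)\<rfloor>)"
  define J where "J = (\<lambda>i. PiE (UNIV - {i0}) (\<lambda>_. {..N i}))"
  define T where "T = Sigma I J"
  define z :: "nat \<times> ('m \<Rightarrow> nat) \<Rightarrow> (real^'m) \<times> real" where
    "z = (\<lambda>(i, j). ((\<chi> l. if l = i0 then fst (x i) else \<alpha> l + 3 * r i * real (j l)), snd (x i)))"
  have finJ: "finite (J i)" for i unfolding J_def by (intro finite_PiE) auto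
  have cardJ: "card (J i) = (N i + 1) ^ ?m" for i
    unfolding J_def by (subst card_PiE) (auto simp: card_Diff_singleton)
  have finT: "finite T" unfolding T_def using I finJ by auto
  have "\<exists>w\<in>B. dist (Pr w) (z p) < r (fst p) / 4" if p: "p \<in> T" for p
  proof -
    obtain i j where ij: "p = (i, j)" "i \<in> I" "j \<in> J i" using p by (auto simp: T_def)
    have "(fst (z p), snd (z p)) \<in> closure ((\<lambda>(v, a). (v, a $ i0)) ` B)"
    proof (rule dense)
      show "(fst (z p) $ i0, snd (z p)) \<in> E" using r[OF ij(2)] by (simp add: z_def ij)
      fix l assume l: "l \<noteq> i0"
      then have "j l \<le> N i" using ij(3) by (auto simp: J_def PiE_def Pi_def)
      then have "real (j l) \<le> real (N i)" by simp
      also have "\<dots> \<le> \<kappa> / (3 * r i)" using \<kappa> r[OF ij(2)] by (simp add: N_def)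
      finally have "3 * r i * real (j l) \<le> \<kappa>" using r[OF ij(2)] by (simp add: field_simps)
      moreover have "0 \<le> 3 * r i * real (j l)" using r[OF ij(2)] by simp
      ultimately show "\<alpha> l \<le> fst (z p) $ l \<and> fst (z p) $ l \<le> \<alpha> l + \<kappa>"
        using l by (simp add: z_def ij)
    qed
    then have "z p \<in> closure (Pr ` B)" by (simp add: Pr_def)
    moreover have "0 < r (fst p) / 4" using r ij by simp
    ultimately obtain y where "y \<in> Pr ` B" "dist y (z p) < r (fst p) / 4"
      unfolding closure_approachable by blast
    then show ?thesis by blast
  qed
  then obtain w where w: "\<And>p. p \<in> T \<Longrightarrow> w p \<in> B" "\<And>p. p \<in> T \<Longrightarrow> dist (Pr (w p)) (z p) < r (fst p) / 4"
    by metis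
  have rT: "0 < r (fst p) \<and> r (fst p) \<le> \<delta>" if "p \<in> T" for p using that r by (auto simp: T_def)
  \<comment> \<open>Moving the centres costs at most a quarter of each radius. Over different balls
    this leaves three quarters of the original gap; over the same ball the mesh \<open>3 * r\<close>
    leaves at least \<open>5/2 * r\<close>. Half radii are therefore safe.\<close>
  have sep: "r (fst p) / 2 + r (fst q) / 2 < dist (w p) (w q)" if pq: "p \<in> T" "q \<in> T" "p \<noteq> q" for p q
  proof -
    obtain i j i' j' where ij: "p = (i, j)" "i \<in> I" "j \<in> J i" "q = (i', j')" "i' \<in> I" "j' \<in> J i'"
      using pq by (auto simp: T_def)
    have "dist (z p) (z q) \<le> dist (z p) (Pr (w p)) + dist (Pr (w p)) (Pr (w q)) + dist (Pr (w q)) (z q)"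
      using dist_triangle[of "z p" "z q" "Pr (w p)"] dist_triangle[of "Pr (w p)" "z q" "Pr (w q)"] by linarith
    then have zw: "dist (z p) (z q) < r i / 4 + dist (w p) (w q) + r i' / 4"
      using w(2)[OF pq(1)] w(2)[OF pq(2)] Pr_lip[of "w p" "w q"] ij by (simp add: dist_commute)
    show ?thesis
    proof (cases "i = i'")
      case False
      have "dist (x i) (x i') \<le> dist (z p) (z q)"
      proof -
        have "dist (fst (z p) $ i0) (fst (z q) $ i0) \<le> dist (fst (z p)) (fst (z q))" by (rule dist_vec_nth_le)
        then have "dist (fst (x i)) (fst (x i')) \<le> dist (fst (z p)) (fst (z q))" by (simp add: z_def ij)
        moreover have "dist (snd (x i)) (snd (x i')) = dist (snd (z p)) (snd (z q))" by (simp add: z_def ij)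
        ultimately show ?thesis
          unfolding dist_prod_def by (auto intro!: real_sqrt_le_mono add_mono power_mono)
      qed
      moreover have "r i + r i' < dist (x i) (x i')"
        using disj[OF ij(2,5) False] r ij by (intro dist_gt_of_disjoint_cballs) auto
      ultimately show ?thesis using zw r[OF ij(2)] r[OF ij(5)] ij by simp
    next
      case True
      then have "j \<noteq> j'" using pq ij by auto
      then obtain l where l: "j l \<noteq> j' l" by blast
      have "l \<noteq> i0" using l ij(3,6) by (auto simp: J_def PiE_def extensional_def)
      have "3 * r i * 1 \<le> 3 * r i * \<bar>real (j l) - real (j' l)\<bar>"
        using l r[OF ij(2)] by (intro mult_left_mono) auto
      also have "\<dots> = \<bar>3 * r i * real (j l) - 3 * r i * real (j' l)\<bar>"
        using r[OF ij(2)] by (simp add: abs_mult flip: right_diff_distrib)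
      also have "\<dots> = dist (fst (z p) $ l) (fst (z q) $ l)"
        using \<open>l \<noteq> i0\<close> True by (simp add: z_def ij dist_real_def)
      also have "\<dots> \<le> dist (fst (z p)) (fst (z q))" by (rule dist_vec_nth_le)
      also have "\<dots> \<le> dist (z p) (z q)" by (rule dist_fst_le)
      finally show ?thesis using zw r[OF ij(2)] True ij by simp
    qed
  qed
  have "(\<Sum>p\<in>T. ennreal ((2 * (r (fst p) / 2)) powr s)) \<le> packing_pre s \<delta>0 B"
  proof (rule packing_pre_finite[OF finT w(1)])
    show "0 < r (fst p) / 2 \<and> r (fst p) / 2 \<le> \<delta>0" if "p \<in> T" for p
    proof -
      have "r (fst p) / 2 \<le> r (fst p)" using rT[OF that] by simp
      then show ?thesis using rT[OF that] \<delta> by linarith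
    qed
    show "cball (w i) (r (fst i) / 2) \<inter> cball (w j) (r (fst j) / 2) = {}" if "i \<in> T" "j \<in> T" "i \<noteq> j" for i j
      using sep[OF that] by (rule disjoint_cballs_of_dist_gt)
  qed (use \<delta> in auto)
  also have "\<dots> \<le> ennreal 1" using B by simp
  finally have "ennreal (\<Sum>p\<in>T. r (fst p) powr s) \<le> ennreal 1" by simp
  then have "(\<Sum>p\<in>T. r (fst p) powr s) \<le> 1" by (subst (asm) ennreal_le_iff) auto
  also have "(\<Sum>p\<in>T. r (fst p) powr s) = (\<Sum>i\<in>I. \<Sum>j\<in>J i. r i powr s)"
    unfolding T_def using sum.Sigma[OF I, of J "\<lambda>i j. r i powr s"] finJ by (simp add: case_prod_beta)
  also have "\<dots> = (\<Sum>i\<in>I. real (N i + 1) ^ ?m * r i powr s)" by (simp add: cardJ)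
  finally have total: "(\<Sum>i\<in>I. real (N i + 1) ^ ?m * r i powr s) \<le> 1" .
  define K where "K = 2 powr s1 * (3 / \<kappa>) ^ ?m * \<delta> powr g"
  have "(\<Sum>i\<in>I. (2 * r i) powr s1) \<le> (\<Sum>i\<in>I. K * (real (N i + 1) ^ ?m * r i powr s))"
  proof (rule sum_mono)
    fix i assume i: "i \<in> I"
    have ri: "0 < r i" "r i \<le> \<delta>" using r[OF i] by auto
    \<comment> \<open>The grid has enough nodes to pay for \<open>r^-(m-1)\<close>; this is where
      the exponent rises.\<close>
    have "\<kappa> / (3 * r i) \<le> real (N i + 1)"
      using \<kappa> ri by (simp add: N_def) linarith
    then have "1 / r i \<le> 3 / \<kappa> * real (N i + 1)" using ri \<kappa> by (simp add: field_simps)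
    then have "(1 / r i) ^ ?m \<le> (3 / \<kappa> * real (N i + 1)) ^ ?m" using ri by (intro power_mono) auto
    then have A: "(1 / r i) ^ ?m \<le> (3 / \<kappa>) ^ ?m * real (N i + 1) ^ ?m" by (simp only: power_mult_distrib)
    have "s1 = g + s - real ?m" by (simp add: g_def m)
    then have "r i powr s1 = r i powr g * r i powr s / r i powr (real ?m)"
      by (simp add: powr_diff powr_add)
    also have "r i powr (real ?m) = r i ^ ?m" by (rule powr_realpow[OF ri(1)])
    also have "r i powr g * r i powr s / r i ^ ?m = r i powr g * r i powr s * (1 / r i) ^ ?m"
      by (simp add: power_one_over)
    also have "\<dots> \<le> \<delta> powr g * r i powr s * ((3 / \<kappa>) ^ ?m * real (N i + 1) ^ ?m)"
    proof (rule mult_mono[OF mult_right_mono A])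
      show "r i powr g \<le> \<delta> powr g" using ri g by (intro powr_mono2) auto
    qed (use ri in auto)
    finally have "2 powr s1 * r i powr s1 \<le> 2 powr s1 * (\<delta> powr g * r i powr s * ((3 / \<kappa>) ^ ?m * real (N i + 1) ^ ?m))"
      by (intro mult_left_mono) auto
    then show "(2 * r i) powr s1 \<le> K * (real (N i + 1) ^ ?m * r i powr s)"
      using ri by (simp add: K_def powr_mult mult_ac)
  qed
  also have "\<dots> = K * (\<Sum>i\<in>I. real (N i + 1) ^ ?m * r i powr s)" by (simp add: sum_distrib_left)
  also have "\<dots> \<le> K * 1" using total \<kappa> by (intro mult_left_mono) (auto simp: K_def)
  finally show "(\<Sum>i\<in>I. ennreal ((2 * r i) powr s1)) \<le> ennreal (2 powr s1 * (3 / \<kappa>) ^ ?m * \<delta> powr (s1 + (real CARD('m) - 1) - s))"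
    by (simp add: K_def g_def ennreal_leI)
qed

text \<open>A cover of \<open>A\<close> with small packing premeasures has, by Baire, a member dense
  over a portion of the kernel of \<open>C\<close> times a small cube. Transplanting packings to
  that member makes the portion null, against the choice of the kernel.\<close>

lemma packing_measure_product:
  fixes A :: "((real^'m::finite) \<times> (real^'m)) set" and C :: "(real \<times> real) set"
  assumes C: "compact C" "fst ` C = {0..1}" and A: "{(v, a). \<forall>i. (v $ i, a $ i) \<in> C} \<subseteq> A"
    and gap: "s < s1 + (real CARD('m) - 1)" and null: "packing_measure s A = 0"
  shows "packing_measure s1 C = 0"
proof (rule ccontr)
  assume "packing_measure s1 C \<noteq> 0"
  then obtain C' where C': "closed C'" "C' \<subseteq> C" "C' \<noteq> {}"
    "\<And>U. open U \<Longrightarrow> U \<inter> C' \<noteq> {} \<Longrightarrow> packing_premeasure s1 (C' \<inter> U) \<noteq> 0"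
    using packing_kernel[of C s1] compact_imp_closed[OF C(1)] by blast
  define i0 :: 'm where "i0 = undefined"
  \<comment> \<open>Only one coordinate of \<open>a\<close> is kept, paired with the kernel; the
    remaining slopes run freely over the unit interval because \<open>C\<close> lies above all of
    it.\<close>
  define X :: "((real^'m) \<times> real) set" where "X = {(v, b). (v $ i0, b) \<in> C' \<and> (\<forall>i. v $ i \<in> {0..1})}"
  define Pr :: "(real^'m) \<times> (real^'m) \<Rightarrow> (real^'m) \<times> real" where "Pr = (\<lambda>(v, a). (v, a $ i0))"
  have C'01: "fst p \<in> {0..1}" if "p \<in> C'" for p using that C' C(2) by blast
  have closedX: "closed X"
  proof -
    have "X = ((\<lambda>z. (fst z $ i0, snd z)) -` C') \<inter> (\<Inter>i. {z. 0 \<le> fst z $ i} \<inter> {z. fst z $ i \<le> 1})"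
      by (auto simp: X_def)
    moreover have "closed ((\<lambda>z :: (real^'m) \<times> real. (fst z $ i0, snd z)) -` C')"
      by (intro closed_vimage C') (auto intro!: continuous_intros)
    moreover have "closed (\<Inter>i. {z :: (real^'m) \<times> real. 0 \<le> fst z $ i} \<inter> {z. fst z $ i \<le> 1})"
      by (intro closed_INT ballI closed_Int closed_Collect_le continuous_intros)
    ultimately show ?thesis by auto
  qed
  obtain p0 where p0: "p0 \<in> C'" using C' by blast
  have "((\<chi> i. fst p0), snd p0) \<in> X" using p0 C'01[OF p0] by (simp add: X_def)
  then have "X \<noteq> {}" by blast
  have "packing_measure s A < 1" using null by simp
  \<comment> \<open>A total below 1 makes each premeasure below 1, hence each packing sum below 1 at
    some positive scale.\<close>
  then obtain B where B: "A \<subseteq> (\<Union>k. B k)" "(\<Sum>k::nat. packing_premeasure s (B k)) < 1"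
    unfolding packing_measure_def INF_less_iff by auto
  have covX: "X \<subseteq> (\<Union>k. Pr ` B k)"
  proof
    fix z assume z: "z \<in> X"
    then obtain v b where vb: "z = (v, b)" "(v $ i0, b) \<in> C'" "\<And>i. v $ i \<in> {0..1}" by (auto simp: X_def)
    have "\<forall>i. \<exists>y. (v $ i, y) \<in> C"
    proof
      fix i have "v $ i \<in> fst ` C" using vb(3) C(2) by simp
      then show "\<exists>y. (v $ i, y) \<in> C" by force
    qed
    then obtain y where y: "\<And>i. (v $ i, y i) \<in> C" by metis
    define a :: "real^'m" where "a = (\<chi> i. if i = i0 then b else y i)"
    have "(v $ i, a $ i) \<in> C" for i
    proof (cases "i = i0")
      case True
      then show ?thesis using vb(2) C'(2) by (auto simp: a_def)
    next
      case False
      then show ?thesis using y[of i] by (simp add: a_def)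
    qed
    then have "(v, a) \<in> A" using A by blast
    then obtain k where "(v, a) \<in> B k" using B(1) by blast
    moreover have "z = Pr (v, a)" by (simp add: Pr_def vb a_def)
    ultimately show "z \<in> (\<Union>k. Pr ` B k)" by blast
  qed
  have "\<exists>k. \<exists>y\<in>X. \<exists>\<eta>>0. X \<inter> ball y \<eta> \<subseteq> closure (Pr ` B k)"
  proof (rule ccontr)
    assume neg: "\<not> ?thesis"
    define \<G> where "\<G> = range (\<lambda>k. X - closure (Pr ` B k))"
    have "X \<subseteq> closure (\<Inter>\<G>)"
    proof (rule Baire[OF closedX])
      show "countable \<G>" by (simp add: \<G>_def)
      fix T assume "T \<in> \<G>"
      then obtain k where T: "T = X - closure (Pr ` B k)" by (auto simp: \<G>_def)
      have "openin (top_of_set X) (X \<inter> - closure (Pr ` B k))" by (intro openin_open_Int) auto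
      then have "openin (top_of_set X) T" by (simp add: T Diff_eq)
      moreover have "X \<subseteq> closure T"
      proof
        fix y assume y: "y \<in> X"
        show "y \<in> closure T"
          unfolding closure_approachable
        proof (intro allI impI)
          fix e :: real assume "0 < e"
          then have "\<not> X \<inter> ball y e \<subseteq> closure (Pr ` B k)" using neg y by blast
          then obtain u where "u \<in> X" "u \<in> ball y e" "u \<notin> closure (Pr ` B k)" by blast
          then show "\<exists>u\<in>T. dist u y < e" by (intro bexI[of _ u]) (auto simp: T dist_commute)
        qed
      qed
      ultimately show "openin (top_of_set X) T \<and> X \<subseteq> closure T" by blast
    qed
    moreover have "\<Inter>\<G> = {}"
    proof (rule equals0I)
      fix u assume u: "u \<in> \<Inter>\<G>"
      then have "u \<in> X" by (auto simp: \<G>_def)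
      then obtain k where "u \<in> Pr ` B k" using covX by blast
      then have "u \<in> closure (Pr ` B k)" by (rule subsetD[OF closure_subset])
      then show False using u by (auto simp: \<G>_def)
    qed
    ultimately show False using \<open>X \<noteq> {}\<close> by simp
  qed
  then obtain k y \<eta> where k: "y \<in> X" "\<eta> > 0" "X \<inter> ball y \<eta> \<subseteq> closure (Pr ` B k)" by blast
  obtain v0 b0 where y: "y = (v0, b0)" by (cases y)
  have vb0: "(v0 $ i0, b0) \<in> C'" "\<And>i. v0 $ i \<in> {0..1}" using k(1) by (auto simp: X_def y)
  \<comment> \<open>Each of the \<open>CARD('m)\<close> slopes and the one foot coordinate may move
    by \<tau>, for a total of \<open>\<eta> / 2\<close>.\<close>
  define \<tau> where "\<tau> = \<eta> / (2 * (real CARD('m) + 1))"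
  have \<tau>: "\<tau> > 0" using k(2) by (simp add: \<tau>_def)
  define \<kappa> where "\<kappa> = min (1/2) \<tau>"
  have \<kappa>: "\<kappa> > 0" "\<kappa> \<le> \<tau>" "\<kappa> \<le> 1/2" using \<tau> by (auto simp: \<kappa>_def)
  \<comment> \<open>The side of length \<kappa> extends to the right of \<open>v0 $ l\<close> in the
    left half of the unit interval and to its left otherwise, so it never leaves the
    interval.\<close>
  define \<alpha> where "\<alpha> = (\<lambda>l. if v0 $ l \<le> 1/2 then v0 $ l else v0 $ l - \<kappa>)"
  define U where "U = {p :: real \<times> real. \<bar>fst p - v0 $ i0\<bar> < \<tau> \<and> \<bar>snd p - b0\<bar> < \<tau>}"
  have "open U" unfolding U_def by (intro open_Collect_conj open_Collect_less continuous_intros)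
  moreover have "(v0 $ i0, b0) \<in> U" using \<tau> by (simp add: U_def)
  ultimately have pos: "packing_premeasure s1 (C' \<inter> U) \<noteq> 0" using C'(4) vb0(1) by blast
  have "packing_premeasure s (B k) < 1" using ennreal_suminf_lessD[OF B(2)] .
  then obtain \<delta>0 where \<delta>0: "\<delta>0 > 0" "packing_pre s \<delta>0 (B k) < 1"
    unfolding packing_premeasure_def INF_less_iff by auto
  have dense: "(v, b) \<in> closure ((\<lambda>(v, a). (v, a $ i0)) ` B k)"
    if E: "(v $ i0, b) \<in> C' \<inter> U" and box: "\<And>l. l \<noteq> i0 \<Longrightarrow> \<alpha> l \<le> v $ l \<and> v $ l \<le> \<alpha> l + \<kappa>" for v b
  proof -
    have v: "v $ l \<in> {0..1} \<and> \<bar>v $ l - v0 $ l\<bar> \<le> \<tau>" for l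
    proof (cases "l = i0")
      case True
      then show ?thesis using E C'01[of "(v $ i0, b)"] by (auto simp: U_def)
    next
      case False
      show ?thesis
      proof (cases "v0 $ l \<le> 1/2")
        case True
        then have "v0 $ l \<le> v $ l" "v $ l \<le> v0 $ l + \<kappa>" using box[OF False] by (auto simp: \<alpha>_def)
        then show ?thesis using vb0(2)[of l] \<kappa> True by auto
      next
        case False': False
        then have "v0 $ l - \<kappa> \<le> v $ l" "v $ l \<le> v0 $ l" using box[OF False] by (auto simp: \<alpha>_def)
        then show ?thesis using vb0(2)[of l] \<kappa> False' by auto
      qed
    qed
    have "dist (v, b) y \<le> dist v v0 + dist b b0"
      unfolding y dist_prod_def by (simp add: sqrt_add_le_add_sqrt[THEN order_trans])
    also have "dist v v0 \<le> (\<Sum>l\<in>UNIV. \<bar>(v - v0) $ l\<bar>)" unfolding dist_norm by (rule norm_le_l1_cart)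
    also have "(\<Sum>l\<in>UNIV. \<bar>(v - v0) $ l\<bar>) \<le> real CARD('m) * \<tau>"
      using v by (intro sum_bounded_above) auto
    also have "real CARD('m) * \<tau> + dist b b0 \<le> (real CARD('m) + 1) * \<tau>"
      using E by (simp add: U_def dist_real_def algebra_simps)
    also have "\<dots> = \<eta> / 2" by (simp add: \<tau>_def field_simps)
    also have "\<dots> < \<eta>" using k(2) by simp
    finally have "(v, b) \<in> ball y \<eta>" by (simp add: dist_commute)
    moreover have "(v, b) \<in> X" using E v by (simp add: X_def)
    ultimately show ?thesis using k(3) by (auto simp: Pr_def)
  qed
  have "packing_premeasure s1 (C' \<inter> U) = 0"
  proof (rule packing_premeasure_eq_0I[OF _ _ \<delta>0(1)])
    fix \<delta> assume "0 < \<delta>" "\<delta> \<le> \<delta>0"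
    then show "packing_pre s1 \<delta> (C' \<inter> U) \<le> ennreal (2 powr s1 * (3 / \<kappa>) ^ (CARD('m) - 1) * \<delta> powr (s1 + (real CARD('m) - 1) - s))"
      using \<delta>0(2) by (intro packing_transplant[where B = "B k" and \<alpha> = \<alpha> and ?i0.0 = i0, OF dense \<kappa>(1) _ gap]) auto
  qed (use gap in simp)
  with pos show False by contradiction
qed

lemma packing_dim_product:
  fixes A :: "((real^'m::finite) \<times> (real^'m)) set" and C :: "(real \<times> real) set"
  assumes C: "compact C" "fst ` C = {0..1}" and A: "{(v, a). \<forall>i. (v $ i, a $ i) \<in> C} \<subseteq> A"
    and dim: "packing_dim C > 1"
  shows "packing_dim A > real CARD('m)"
proof -
  obtain s1 where s1: "1 < s1" "s1 < packing_dim C" using dim dense by blast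
  have P1: "packing_measure s1 C \<noteq> 0"
  proof
    assume "packing_measure s1 C = 0"
    then have "packing_dim C \<le> s1"
      unfolding packing_dim_def using s1 by (intro cInf_lower bdd_belowI[of _ 0]) auto
    then show False using s1 by simp
  qed
  \<comment> \<open>A witness that the infimum in \<open>packing_dim A\<close> is over a nonempty
    set.\<close>
  define s0 where "s0 = real DIM((real^'m) \<times> (real^'m)) + 1"
  have "s0 \<in> {s. 0 \<le> s \<and> packing_measure s A = 0}"
    using packing_measure_above_dim[of s0 A] by (simp add: s0_def)
  then have "s1 + (real CARD('m) - 1) \<le> packing_dim A"
    unfolding packing_dim_def
  proof (intro cInf_greatest)
    fix s assume "s \<in> {s. 0 \<le> s \<and> packing_measure s A = 0}"
    then have "\<not> s < s1 + (real CARD('m) - 1)"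
      using packing_measure_product[OF C A] P1 by blast
    then show "s1 + (real CARD('m) - 1) \<le> s" by simp
  qed blast
  then show ?thesis using s1 by simp
qed

section \<open>Hausdorff dimension\<close>

text \<open>Vitali with equal radii: disjoint balls of radius \<epsilon> in a bounded region number
  at most a constant times \<open>\<epsilon>^(-DIM('a))\<close>, and their fivefold enlargements
  cover.\<close>

lemma hausdorff_measure_above_dim:
  fixes A :: "'a::euclidean_space set"
  assumes A: "bounded A" and s: "s > real DIM('a)"
  shows "hausdorff_measure s A = 0"
proof -
  obtain R where R: "R > 0" "A \<subseteq> cball 0 R"
  proof -
    obtain B where "\<forall>x\<in>A. norm x \<le> B" using A by (auto simp: bounded_iff)
    then show ?thesis by (intro that[of "max 1 B"]) auto
  qed
  define g where "g = s - real DIM('a)"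
  define V where "V = 10 powr s * (R + 1) ^ DIM('a)"
  have g: "g > 0" using s by (simp add: g_def)
  have content: "hausdorff_content s \<delta> A \<le> ennreal (V * \<epsilon> powr g)" if \<epsilon>: "0 < \<epsilon>" "\<epsilon> \<le> 1" "10 * \<epsilon> \<le> \<delta>" for \<delta> \<epsilon>
  proof -
    obtain Q where Q: "countable Q" "Q \<subseteq> A"
      "pairwise (\<lambda>i j. disjnt (cball i \<epsilon>) (cball j \<epsilon>)) Q" "A \<subseteq> (\<Union>i\<in>Q. cball i (5 * \<epsilon>))"
    proof (rule Vitali_covering_lemma_cballs[where S = A and K = A and a = "\<lambda>i. i" and r = "\<lambda>_. \<epsilon>" and B = \<epsilon>])
      show "A \<subseteq> (\<Union>i\<in>A. cball i \<epsilon>)" using \<epsilon> by force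
    qed (use \<epsilon> in auto)
    have bound: "real (card P) * \<epsilon> ^ DIM('a) \<le> (R + 1) ^ DIM('a)" if P: "finite P" "P \<subseteq> Q" for P
    proof -
      have "(\<Sum>x\<in>P. \<epsilon> ^ DIM('a)) \<le> (R + 1) ^ DIM('a)"
      proof (rule sum_radii_power_le[where x = "\<lambda>x. x" and r = "\<lambda>_. \<epsilon>", OF P(1)])
        show "0 \<le> \<epsilon> \<and> \<epsilon> \<le> 1 \<and> x \<in> cball 0 R" if "x \<in> P" for x
          using subsetD[OF R(2), of x] that P(2) Q(2) \<epsilon> by auto
        show "cball i \<epsilon> \<inter> cball j \<epsilon> = {}" if "i \<in> P" "j \<in> P" "i \<noteq> j" for i j
          using that P(2) Q(3) unfolding pairwise_def disjnt_def by blast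
      qed (use R in simp)
      then show ?thesis by simp
    qed
    have "finite Q"
    proof (rule ccontr)
      assume "infinite Q"
      obtain N :: nat where N: "real N > (R + 1) ^ DIM('a) / \<epsilon> ^ DIM('a)" using reals_Archimedean2 by blast
      obtain P where P: "finite P" "card P = N" "P \<subseteq> Q"
        using infinite_arbitrarily_large[OF \<open>infinite Q\<close>] by blast
      show False using bound[OF P(1,3)] P(2) N \<epsilon> by (simp add: field_simps)
    qed
    define N where "N = card Q"
    obtain h where h: "bij_betw h {..<N} Q"
      using ex_bij_betw_nat_finite[OF \<open>finite Q\<close>] by (auto simp: N_def atLeast0LessThan)
    define U where "U = (\<lambda>i. if i < N then cball (h i) (5 * \<epsilon>) else {})"
    have diam: "diameter (cball x (5 * \<epsilon>)) = 10 * \<epsilon>" for x :: 'a using \<epsilon> by simp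
    have "hausdorff_content s \<delta> A \<le> (\<Sum>i. ennreal (diameter (U i) powr s))"
    proof (rule hausdorff_content_le_suminf)
      show "A \<subseteq> (\<Union>i. U i)"
      proof
        fix x assume "x \<in> A"
        then obtain q where q: "q \<in> Q" "x \<in> cball q (5 * \<epsilon>)" using Q(4) by blast
        then obtain i where "i < N" "q = h i" using h by (auto simp: bij_betw_def)
        then have "x \<in> U i" using q by (simp add: U_def)
        then show "x \<in> (\<Union>i. U i)" by blast
      qed
      show "bounded (U i)" for i by (simp add: U_def)
      show "diameter (U i) \<le> \<delta>" for i using \<epsilon> diam by (simp add: U_def)
    qed
    also have "\<dots> = (\<Sum>i<N. ennreal (diameter (U i) powr s))"
      by (rule suminf_finite) (auto simp: U_def)
    also have "\<dots> = (\<Sum>i<N. ennreal ((10 * \<epsilon>) powr s))"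
      by (intro sum.cong) (simp_all only: U_def diam lessThan_iff if_True)
    also have "\<dots> = ennreal (real N * (10 * \<epsilon>) powr s)" by (simp add: ennreal_mult ennreal_of_nat_eq_real_of_nat)
    also have "real N * (10 * \<epsilon>) powr s = 10 powr s * \<epsilon> powr g * (real N * \<epsilon> ^ DIM('a))"
    proof -
      have "\<epsilon> powr s = \<epsilon> powr g * \<epsilon> ^ DIM('a)"
        using \<epsilon> by (simp add: g_def powr_diff powr_realpow)
      then show ?thesis using \<epsilon> by (simp add: powr_mult)
    qed
    also have "\<dots> \<le> 10 powr s * \<epsilon> powr g * (R + 1) ^ DIM('a)"
      using bound[OF \<open>finite Q\<close> order_refl] by (intro mult_left_mono) (auto simp: N_def)
    finally show ?thesis by (simp add: V_def mult_ac ennreal_leI)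
  qed
  have "hausdorff_content s \<delta> A = 0" if \<delta>: "\<delta> > 0" for \<delta>
    by (rule ennreal_le_powr_imp_zero[where ?\<delta>0.0 = "min 1 (\<delta> / 10)" and V = V and g = g])
       (use content \<delta> g in auto)
  then have "hausdorff_measure s A \<le> 0"
    unfolding hausdorff_measure_def by (intro SUP_least) auto
  then show ?thesis by simp
qed

lemma hausdorff_dim_eqI:
  fixes A :: "'a::euclidean_space set"
  assumes A: "bounded A" and pos: "\<And>s. 0 \<le> s \<Longrightarrow> s < real DIM('a) \<Longrightarrow> hausdorff_measure s A \<noteq> 0"
  shows "hausdorff_dim A = real DIM('a)"
proof -
  let ?S = "{s. 0 \<le> s \<and> hausdorff_measure s A = 0}"
  have above: "s \<in> ?S" if "s > real DIM('a)" for s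
    using hausdorff_measure_above_dim[OF A that] that by simp
  have below: "real DIM('a) \<le> s" if "s \<in> ?S" for s
    using pos[of s] that by force
  show ?thesis
    unfolding hausdorff_dim_def
  proof (rule antisym)
    show "real DIM('a) \<le> Inf ?S"
    proof (rule cInf_greatest)
      have "real DIM('a) + 1 \<in> ?S" by (rule above) simp
      then show "?S \<noteq> {}" by blast
    qed (rule below)
    show "Inf ?S \<le> real DIM('a)"
    proof (rule field_le_epsilon)
      fix e :: real assume "e > 0"
      then show "Inf ?S \<le> real DIM('a) + e"
        by (intro cInf_lower above bdd_belowI[of _ 0]) auto
    qed
  qed
qed

text \<open>Uniform measure on the unit interval, carried by the whole line so that Borel sets and
  products need no restriction.\<close>

definition unit_lebesgue :: "real measure" where
  "unit_lebesgue = density lborel (indicator {0..1})"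

lemma sets_unit_lebesgue [simp, measurable_cong]: "sets unit_lebesgue = sets borel"
  by (simp add: unit_lebesgue_def)

lemma space_unit_lebesgue [simp]: "space unit_lebesgue = UNIV"
  by (simp add: unit_lebesgue_def)

lemma emeasure_unit_lebesgue: "A \<in> sets borel \<Longrightarrow> emeasure unit_lebesgue A = emeasure lborel ({0..1} \<inter> A)"
  unfolding unit_lebesgue_def
  by (subst emeasure_density) (auto simp flip: indicator_inter_arith)

lemma emeasure_unit_lebesgue_UNIV: "emeasure unit_lebesgue UNIV = 1"
  by (simp add: emeasure_unit_lebesgue)

lemma emeasure_unit_lebesgue_le: "A \<in> sets borel \<Longrightarrow> emeasure unit_lebesgue A \<le> emeasure lborel A"
  by (simp add: emeasure_unit_lebesgue emeasure_mono)

lemma AE_unit_lebesgue: "AE w in unit_lebesgue. w \<in> {0..1}"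
  unfolding unit_lebesgue_def by (subst AE_density) (auto simp: indicator_def)

interpretation unit_lebesgue: finite_measure unit_lebesgue
  by (rule finite_measureI) (simp add: emeasure_unit_lebesgue_UNIV)

interpretation unit_lebesgue_pair: pair_sigma_finite unit_lebesgue unit_lebesgue
  by unfold_locales

interpretation unit_lebesgue_prod: product_sigma_finite "\<lambda>_. unit_lebesgue"
  by unfold_locales

lemma emeasure_PiM_unit_lebesgue_UNIV:
  assumes "finite I"
  shows "emeasure (Pi\<^sub>M I (\<lambda>_. unit_lebesgue)) (space (Pi\<^sub>M I (\<lambda>_. unit_lebesgue))) = 1"
  using assms unfolding space_PiM
  by (subst unit_lebesgue_prod.emeasure_PiM) (auto simp: emeasure_unit_lebesgue_UNIV)

text \<open>The two-dimensional marginal of the product: the remaining coordinates integrate to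
  total mass 1.\<close>

lemma PiM_two_coordinates:
  fixes a b :: "'i" and D :: "(real \<times> real) set"
  assumes I: "finite I" "a \<in> I" "b \<in> I" "a \<noteq> b" and D: "D \<in> sets borel"
  shows "emeasure (Pi\<^sub>M I (\<lambda>_. unit_lebesgue)) {f \<in> space (Pi\<^sub>M I (\<lambda>_. unit_lebesgue)). (f a, f b) \<in> D}
    = emeasure (unit_lebesgue \<Otimes>\<^sub>M unit_lebesgue) D"
proof -
  let ?M = "\<lambda>_ :: 'i. unit_lebesgue"
  define I1 where "I1 = I - {b}"
  define I2 where "I2 = I1 - {a}"
  have I': "finite I1" "b \<notin> I1" "I = insert b I1" "finite I2" "a \<notin> I2" "I1 = insert a I2"
    using I by (auto simp: I1_def I2_def)
  define A where "A = {f \<in> space (Pi\<^sub>M I ?M). (f a, f b) \<in> D}"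
  have D2: "D \<in> sets (unit_lebesgue \<Otimes>\<^sub>M unit_lebesgue)"
  proof -
    have "D \<in> sets (borel \<Otimes>\<^sub>M borel)" unfolding borel_prod by (rule D)
    then show ?thesis by (simp cong: sets_pair_measure_cong)
  qed
  have pr: "(\<lambda>f. (f a, f b)) \<in> Pi\<^sub>M I ?M \<rightarrow>\<^sub>M unit_lebesgue \<Otimes>\<^sub>M unit_lebesgue"
    using I by measurable
  have A: "A \<in> sets (Pi\<^sub>M I ?M)"
    unfolding A_def using measurable_sets[OF pr D2] by (simp add: vimage_def Int_def conj_commute)
  have sec: "Pair t -` D \<in> sets borel" for t
    using sets_Pair1[OF D2, of t] by simp
  have "emeasure (Pi\<^sub>M I ?M) A = (\<integral>\<^sup>+f. indicator A f \<partial>Pi\<^sub>M (insert b I1) ?M)" using A I' by simp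
  also have "\<dots> = (\<integral>\<^sup>+f. (\<integral>\<^sup>+y. indicator A (f(b := y)) \<partial>unit_lebesgue) \<partial>Pi\<^sub>M I1 ?M)"
    by (rule unit_lebesgue_prod.product_nn_integral_insert) (use I' A in auto)
  also have "\<dots> = (\<integral>\<^sup>+f. emeasure unit_lebesgue (Pair (f a) -` D) \<partial>Pi\<^sub>M I1 ?M)"
  proof (rule nn_integral_cong)
    fix f assume f: "f \<in> space (Pi\<^sub>M I1 ?M)"
    have "indicator A (f(b := y)) = (indicator (Pair (f a) -` D) y :: ennreal)" for y
    proof -
      have "f(b := y) \<in> space (Pi\<^sub>M I ?M)"
        using f I' by (auto simp: space_PiM PiE_def extensional_def)
      then show ?thesis using I(4) by (auto simp: A_def indicator_def)
    qed
    then show "(\<integral>\<^sup>+y. indicator A (f(b := y)) \<partial>unit_lebesgue) = emeasure unit_lebesgue (Pair (f a) -` D)"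
      using sec by simp
  qed
  also have "\<dots> = (\<integral>\<^sup>+f. (\<integral>\<^sup>+t. emeasure unit_lebesgue (Pair ((f(a := t)) a) -` D) \<partial>unit_lebesgue) \<partial>Pi\<^sub>M I2 ?M)"
    unfolding I'(6)
  proof (rule unit_lebesgue_prod.product_nn_integral_insert)
    have "(\<lambda>t. emeasure unit_lebesgue (Pair t -` D)) \<in> borel_measurable unit_lebesgue"
      by (rule unit_lebesgue.measurable_emeasure_Pair[OF D2])
    then show "(\<lambda>f. emeasure unit_lebesgue (Pair (f a) -` D)) \<in> borel_measurable (Pi\<^sub>M (insert a I2) ?M)"
      by (rule measurable_compose[rotated]) (rule measurable_component_singleton, simp)
  qed (use I' in auto)
  also have "\<dots> = emeasure (unit_lebesgue \<Otimes>\<^sub>M unit_lebesgue) D"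
    using emeasure_PiM_unit_lebesgue_UNIV[OF I'(4)]
    by (simp add: unit_lebesgue.emeasure_pair_measure_alt[OF D2])
  finally show ?thesis by (simp add: A_def)
qed

lemma nn_integral_indicator_cball_le:
  assumes "r \<ge> 0"
  shows "(\<integral>\<^sup>+w'. indicator (cball w r) w' \<partial>unit_lebesgue) \<le> ennreal (2 * r)"
proof -
  have "(\<integral>\<^sup>+w'. indicator (cball w r) w' \<partial>unit_lebesgue) = emeasure unit_lebesgue (cball w r)"
    by (rule nn_integral_indicator) simp
  also have "\<dots> \<le> emeasure lborel (cball w r)" by (rule emeasure_unit_lebesgue_le) simp
  also have "\<dots> = ennreal (2 * r)" using assms by (simp add: cball_eq_atLeastAtMost)
  finally show ?thesis .
qed

lemma emeasure_slopes_le: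
  assumes "d \<noteq> 0" "q \<ge> 0"
  shows "emeasure unit_lebesgue {t. \<bar>c + t * d\<bar> \<le> 2 * q} \<le> ennreal (4 * q / \<bar>d\<bar>)"
proof -
  have eq: "{t. \<bar>c + t * d\<bar> \<le> 2 * q} = cball (- c / d) (2 * q / \<bar>d\<bar>)"
  proof (intro set_eqI)
    fix t
    have "\<bar>- c / d - t\<bar> * \<bar>d\<bar> = \<bar>c + t * d\<bar>"
      using assms by (simp add: abs_mult[symmetric] field_simps abs_minus_commute)
    then show "t \<in> {t. \<bar>c + t * d\<bar> \<le> 2 * q} \<longleftrightarrow> t \<in> cball (- c / d) (2 * q / \<bar>d\<bar>)"
      using assms by (simp add: dist_real_def pos_le_divide_eq)
  qed
  have "emeasure unit_lebesgue {t. \<bar>c + t * d\<bar> \<le> 2 * q} \<le> emeasure lborel (cball (- c / d) (2 * q / \<bar>d\<bar>))"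
    unfolding eq by (rule emeasure_unit_lebesgue_le) simp
  also have "\<dots> = ennreal (4 * q / \<bar>d\<bar>)" using assms by (simp add: cball_eq_atLeastAtMost)
  finally show ?thesis .
qed

text \<open>The mass of parameters whose points at height \<open>t\<close> are close to that of
  \<open>w\<close>. The factor 2 leaves room for a change of height by \<open>(1/2)^k\<close> when
  balls are compared with slices.\<close>

definition near_mass :: "(real \<Rightarrow> real) \<Rightarrow> nat \<Rightarrow> real \<Rightarrow> real \<Rightarrow> ennreal" where
  "near_mass g k t w = emeasure unit_lebesgue {w'. \<bar>(g w' - g w) + t * (w' - w)\<bar> \<le> 2 * (1/2) ^ k}"

context
  fixes g :: "real \<Rightarrow> real"
  assumes g [measurable]: "g \<in> borel_measurable borel"
begin

lemma near_set_borel: "{w'. \<bar>(g w' - g w) + t * (w' - w)\<bar> \<le> 2 * (1/2) ^ k} \<in> sets borel"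
  by measurable

lemma near_mass_eq_nn_integral:
  "near_mass g k t w = (\<integral>\<^sup>+w'. indicator {(w', t). \<bar>(g w' - g w) + t * (w' - w)\<bar> \<le> 2 * (1/2) ^ k} (w', t) \<partial>unit_lebesgue)"
proof -
  have "near_mass g k t w = (\<integral>\<^sup>+w'. indicator {w'. \<bar>(g w' - g w) + t * (w' - w)\<bar> \<le> 2 * (1/2) ^ k} w' \<partial>unit_lebesgue)"
    unfolding near_mass_def by (rule nn_integral_indicator[symmetric]) (simp add: near_set_borel)
  then show ?thesis by (simp add: indicator_def)
qed

lemma near_mass_measurable [measurable]:
  "(\<lambda>(t, w). near_mass g k t w) \<in> borel_measurable (unit_lebesgue \<Otimes>\<^sub>M unit_lebesgue)"
proof -
  let ?Q = "{x \<in> space ((unit_lebesgue \<Otimes>\<^sub>M unit_lebesgue) \<Otimes>\<^sub>M unit_lebesgue).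
     \<bar>(g (snd x) - g (snd (fst x))) + fst (fst x) * (snd x - snd (fst x))\<bar> \<le> 2 * (1/2) ^ k}"
  have "?Q \<in> sets ((unit_lebesgue \<Otimes>\<^sub>M unit_lebesgue) \<Otimes>\<^sub>M unit_lebesgue)" by measurable
  from unit_lebesgue.measurable_emeasure_Pair[OF this] show ?thesis
    by (rule measurable_cong[THEN iffD1, rotated])
       (auto simp: near_mass_def vimage_def space_pair_measure intro!: arg_cong[where f = "emeasure unit_lebesgue"])
qed

text \<open>Fubini and the dyadic decomposition of \<open>|w - w'|\<close>: two parameters at distance about \<open>2^-i\<close>
  are close for a set of heights of measure at most about \<open>2^i/2^k\<close>.\<close>

lemma near_mass_integral:
  "(\<integral>\<^sup>+w. \<integral>\<^sup>+t. near_mass g k t w \<partial>unit_lebesgue \<partial>unit_lebesgue) \<le> ennreal (16 * real (Suc k) * (1/2) ^ k)"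
proof -
  define q :: real where "q = (1/2) ^ k"
  have q: "q > 0" by (simp add: q_def)
  \<comment> \<open>A majorant by dyadic distance: at distance above \<open>(1/2)^(i+1)\<close> the
    heights have measure at most \<open>4 * q * 2^(i+1)\<close>; within distance \<open>q\<close>
    the trivial bound 1 is used.\<close>
  define S where "S = (\<lambda>w w' :: real. (\<Sum>i<k. ennreal (4 * q * 2 ^ (i+1)) * indicator (cball w ((1/2) ^ i)) w')
     + (indicator (cball w q) w' :: ennreal))"
  have inner: "(\<integral>\<^sup>+t. indicator {(w', t). \<bar>(g w' - g w) + t * (w' - w)\<bar> \<le> 2 * (1/2) ^ k} (w', t) \<partial>unit_lebesgue) \<le> S w w'"
    if w: "w \<in> {0..1}" "w' \<in> {0..1}" for w w'
  proof -
    let ?d = "w' - w"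
    have b: "{t. \<bar>(g w' - g w) + t * ?d\<bar> \<le> 2 * q} \<in> sets borel" by measurable
    have eq: "(\<integral>\<^sup>+t. indicator {(w', t). \<bar>(g w' - g w) + t * (w' - w)\<bar> \<le> 2 * (1/2) ^ k} (w', t) \<partial>unit_lebesgue)
        = emeasure unit_lebesgue {t. \<bar>(g w' - g w) + t * ?d\<bar> \<le> 2 * q}"
    proof -
      have "emeasure unit_lebesgue {t. \<bar>(g w' - g w) + t * ?d\<bar> \<le> 2 * q} = (\<integral>\<^sup>+t. indicator {t. \<bar>(g w' - g w) + t * ?d\<bar> \<le> 2 * q} t \<partial>unit_lebesgue)"
        by (rule nn_integral_indicator[symmetric]) (simp add: b)
      then show ?thesis by (simp add: indicator_def q_def)
    qed
    show ?thesis
    proof (cases "\<bar>?d\<bar> \<le> q")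
      case True
      have "emeasure unit_lebesgue {t. \<bar>(g w' - g w) + t * ?d\<bar> \<le> 2 * q} \<le> emeasure unit_lebesgue UNIV"
        by (intro emeasure_mono) auto
      also have "\<dots> \<le> S w w'"
        using True by (simp add: S_def emeasure_unit_lebesgue_UNIV indicator_def dist_real_def abs_minus_commute add_increasing)
      finally show ?thesis using eq by simp
    next
      case False
      define P where "P = (\<lambda>i::nat. (1/2) ^ i < \<bar>?d\<bar>)"
      have "P k" using False by (simp add: P_def q_def)
      define n where "n = (LEAST i. P i)"
      have n: "P n" "n \<le> k" unfolding n_def using \<open>P k\<close> by (auto intro: LeastI Least_le)
      have "\<not> P 0" using w by (auto simp: P_def)
      then have "n \<noteq> 0" using n by metis
      then obtain i where i: "n = Suc i" using not0_implies_Suc by blast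
      have "\<not> P i" unfolding n_def using not_less_Least[of i P] i by (simp add: n_def)
      then have di: "(1/2) ^ (i+1) < \<bar>?d\<bar>" "\<bar>?d\<bar> \<le> (1/2) ^ i" using n(1) i by (auto simp: P_def)
      have "i < k" using n i by simp
      have "?d \<noteq> 0" using di(1) by (metis abs_zero less_asym zero_less_power half_gt_zero zero_less_one)
      then have "emeasure unit_lebesgue {t. \<bar>(g w' - g w) + t * ?d\<bar> \<le> 2 * q} \<le> ennreal (4 * q / \<bar>?d\<bar>)"
        using q by (intro emeasure_slopes_le) auto
      also have "\<dots> \<le> ennreal (4 * q * 2 ^ (i+1))"
      proof (rule ennreal_leI)
        have "4 * q / \<bar>?d\<bar> \<le> 4 * q / (1/2) ^ (i+1)"
          using di(1) q \<open>?d \<noteq> 0\<close> by (intro divide_left_mono mult_pos_pos) auto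
        also have "\<dots> = 4 * q * 2 ^ (i+1)" by (simp add: power_one_over)
        finally show "4 * q / \<bar>?d\<bar> \<le> 4 * q * 2 ^ (i+1)" .
      qed
      also have "\<dots> = ennreal (4 * q * 2 ^ (i+1)) * indicator (cball w ((1/2) ^ i)) w'"
        using di(2) by (simp add: indicator_def dist_real_def abs_minus_commute)
      also have "\<dots> \<le> (\<Sum>i<k. ennreal (4 * q * 2 ^ (i+1)) * indicator (cball w ((1/2) ^ i)) w')"
        by (rule member_le_sum[of i "{..<k}" "\<lambda>i. ennreal (4 * q * 2 ^ (i+1)) * indicator (cball w ((1/2) ^ i)) w'"])
           (use \<open>i < k\<close> in auto)
      also have "\<dots> \<le> S w w'" by (simp add: S_def)
      finally show ?thesis using eq by simp
    qed
  qed
  have intS: "(\<integral>\<^sup>+w'. S w w' \<partial>unit_lebesgue) \<le> ennreal (16 * real (Suc k) * (1/2) ^ k)" for w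
  proof -
    have "(\<integral>\<^sup>+w'. S w w' \<partial>unit_lebesgue) = (\<Sum>i<k. ennreal (4 * q * 2 ^ (i+1)) * (\<integral>\<^sup>+w'. indicator (cball w ((1/2) ^ i)) w' \<partial>unit_lebesgue))
        + (\<integral>\<^sup>+w'. indicator (cball w q) w' \<partial>unit_lebesgue)"
    proof -
      have m [measurable]: "(\<lambda>w'. indicator (cball w r) w' :: ennreal) \<in> borel_measurable unit_lebesgue" for r
        by (rule borel_measurable_indicator) simp
      have "(\<integral>\<^sup>+w'. S w w' \<partial>unit_lebesgue) = (\<integral>\<^sup>+w'. (\<Sum>i<k. ennreal (4 * q * 2 ^ (i+1)) * indicator (cball w ((1/2) ^ i)) w') \<partial>unit_lebesgue)
          + (\<integral>\<^sup>+w'. indicator (cball w q) w' \<partial>unit_lebesgue)"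
        unfolding S_def by (rule nn_integral_add) measurable
      also have "(\<integral>\<^sup>+w'. (\<Sum>i<k. ennreal (4 * q * 2 ^ (i+1)) * indicator (cball w ((1/2) ^ i)) w') \<partial>unit_lebesgue)
          = (\<Sum>i<k. \<integral>\<^sup>+w'. ennreal (4 * q * 2 ^ (i+1)) * indicator (cball w ((1/2) ^ i)) w' \<partial>unit_lebesgue)"
        by (rule nn_integral_sum) measurable
      also have "\<dots> = (\<Sum>i<k. ennreal (4 * q * 2 ^ (i+1)) * (\<integral>\<^sup>+w'. indicator (cball w ((1/2) ^ i)) w' \<partial>unit_lebesgue))"
        by (intro sum.cong refl nn_integral_cmult m)
      finally show ?thesis .
    qed
    also have "\<dots> \<le> (\<Sum>i<k. ennreal (4 * q * 2 ^ (i+1)) * ennreal (2 * (1/2) ^ i)) + ennreal (2 * q)"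
      using q by (intro add_mono sum_mono mult_left_mono nn_integral_indicator_cball_le) auto
    \<comment> \<open>Every dyadic scale contributes the same \<open>16 * q\<close>, which produces
      the factor \<open>k\<close>.\<close>
    also have "(\<Sum>i<k. ennreal (4 * q * 2 ^ (i+1)) * ennreal (2 * (1/2) ^ i)) = (\<Sum>i<k. ennreal (16 * q))"
      using q by (intro sum.cong) (auto simp: power_one_over simp flip: ennreal_mult)
    also have "\<dots> + ennreal (2 * q) = ennreal (16 * real k * q + 2 * q)"
      using q by (simp add: ennreal_mult ennreal_of_nat_eq_real_of_nat mult_ac)
    also have "\<dots> \<le> ennreal (16 * real (Suc k) * q)"
      using q by (intro ennreal_leI) (simp add: algebra_simps)
    finally show ?thesis by (simp add: q_def)
  qed
  have "(\<integral>\<^sup>+w. \<integral>\<^sup>+t. near_mass g k t w \<partial>unit_lebesgue \<partial>unit_lebesgue) \<le> (\<integral>\<^sup>+w. ennreal (16 * real (Suc k) * (1/2) ^ k) \<partial>unit_lebesgue)"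
  proof (rule nn_integral_mono_AE)
    show "AE w in unit_lebesgue. (\<integral>\<^sup>+t. near_mass g k t w \<partial>unit_lebesgue) \<le> ennreal (16 * real (Suc k) * (1/2) ^ k)"
      using AE_unit_lebesgue
    proof eventually_elim
      case (elim w)
      let ?Q = "{(w', t). \<bar>(g w' - g w) + t * (w' - w)\<bar> \<le> 2 * (1/2) ^ k}"
      have Q: "?Q \<in> sets (unit_lebesgue \<Otimes>\<^sub>M unit_lebesgue)"
      proof -
        have "{x \<in> space (unit_lebesgue \<Otimes>\<^sub>M unit_lebesgue). \<bar>(g (fst x) - g w) + snd x * (fst x - w)\<bar> \<le> 2 * (1/2) ^ k} \<in> sets (unit_lebesgue \<Otimes>\<^sub>M unit_lebesgue)"
          by measurable
        moreover have "{x \<in> space (unit_lebesgue \<Otimes>\<^sub>M unit_lebesgue). \<bar>(g (fst x) - g w) + snd x * (fst x - w)\<bar> \<le> 2 * (1/2) ^ k} = ?Q"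
          by (auto simp: space_pair_measure)
        ultimately show ?thesis by simp
      qed
      have "(\<integral>\<^sup>+t. near_mass g k t w \<partial>unit_lebesgue) = (\<integral>\<^sup>+t. \<integral>\<^sup>+w'. indicator ?Q (w', t) \<partial>unit_lebesgue \<partial>unit_lebesgue)"
        by (simp only: near_mass_eq_nn_integral)
      also have "\<dots> = (\<integral>\<^sup>+w'. \<integral>\<^sup>+t. indicator ?Q (w', t) \<partial>unit_lebesgue \<partial>unit_lebesgue)"
        using Q by (intro unit_lebesgue_pair.Fubini') (simp add: case_prod_beta)
      also have "\<dots> \<le> (\<integral>\<^sup>+w'. S w w' \<partial>unit_lebesgue)"
      proof (rule nn_integral_mono_AE)
        show "AE w' in unit_lebesgue. (\<integral>\<^sup>+t. indicator ?Q (w', t) \<partial>unit_lebesgue) \<le> S w w'"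
          using AE_unit_lebesgue by eventually_elim (rule inner[OF elim])
      qed
      also have "\<dots> \<le> ennreal (16 * real (Suc k) * (1/2) ^ k)" by (rule intS)
      finally show ?case .
    qed
  qed
  also have "\<dots> = ennreal (16 * real (Suc k) * (1/2) ^ k)" by (simp add: emeasure_unit_lebesgue_UNIV)
  finally show ?thesis .
qed

text \<open>Markov's inequality for the averaged bound.\<close>

lemma near_mass_large_measure:
  assumes \<tau>: "\<tau> > 0"
  shows "emeasure (unit_lebesgue \<Otimes>\<^sub>M unit_lebesgue) {(t, w). ennreal \<tau> < near_mass g k t w}
    \<le> ennreal (16 * real (Suc k) * (1/2) ^ k / \<tau>)"
    and near_mass_large_borel: "{(t, w). ennreal \<tau> < near_mass g k t w} \<in> sets borel"
proof -
  let ?P = "unit_lebesgue \<Otimes>\<^sub>M unit_lebesgue"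
  let ?u = "\<lambda>(t, w). near_mass g k t w"
  have sP: "sets ?P = sets (borel :: (real \<times> real) measure)"
  proof -
    have "sets ?P = sets ((borel :: real measure) \<Otimes>\<^sub>M (borel :: real measure))"
      by (rule sets_pair_measure_cong) simp_all
    then show ?thesis by (simp only: borel_prod)
  qed
  have eq: "{(t, w). ennreal \<tau> < near_mass g k t w} = {x \<in> space ?P. ennreal \<tau> < ?u x}"
    by (auto simp: space_pair_measure)
  have "{x \<in> space ?P. ennreal \<tau> < ?u x} \<in> sets ?P" by measurable
  then show b: "{(t, w). ennreal \<tau> < near_mass g k t w} \<in> sets borel" by (simp only: eq sP)
  have "ennreal \<tau> * emeasure ?P {(t, w). ennreal \<tau> < near_mass g k t w}
      = (\<integral>\<^sup>+x. ennreal \<tau> * indicator {(t, w). ennreal \<tau> < near_mass g k t w} x \<partial>?P)"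
    using b sP by (subst nn_integral_cmult_indicator) auto
  also have "\<dots> \<le> (\<integral>\<^sup>+x. ?u x \<partial>?P)"
    by (intro nn_integral_mono) (auto simp: indicator_def less_imp_le)
  also have "\<dots> = (\<integral>\<^sup>+w. \<integral>\<^sup>+t. near_mass g k t w \<partial>unit_lebesgue \<partial>unit_lebesgue)"
    using unit_lebesgue_pair.nn_integral_snd[of ?u] by simp
  also have "\<dots> \<le> ennreal (16 * real (Suc k) * (1/2) ^ k)" by (rule near_mass_integral)
  finally have le: "ennreal \<tau> * emeasure ?P {(t, w). ennreal \<tau> < near_mass g k t w} \<le> ennreal (16 * real (Suc k) * (1/2) ^ k)" .
  have "emeasure ?P {(t, w). ennreal \<tau> < near_mass g k t w}
      = ennreal (1 / \<tau>) * (ennreal \<tau> * emeasure ?P {(t, w). ennreal \<tau> < near_mass g k t w})"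
    using \<tau> by (simp add: mult.assoc[symmetric] ennreal_mult[symmetric])
  also have "\<dots> \<le> ennreal (1 / \<tau>) * ennreal (16 * real (Suc k) * (1/2) ^ k)" by (intro mult_left_mono le) auto
  also have "\<dots> = ennreal (16 * real (Suc k) * (1/2) ^ k / \<tau>)" using \<tau> by (simp flip: ennreal_mult')
  finally show "emeasure ?P {(t, w). ennreal \<tau> < near_mass g k t w} \<le> ennreal (16 * real (Suc k) * (1/2) ^ k / \<tau>)" .
qed

end

text \<open>The lowest point of each fibre is a Borel choice: its sublevel sets on the unit interval
  are projections of compact sets.\<close>

lemma borel_selection:
  fixes C :: "(real \<times> real) set"
  assumes C: "compact C" "fst ` C = {0..1}"
  obtains g where "g \<in> borel_measurable borel" "\<And>v. v \<in> {0..1} \<Longrightarrow> (v, g v) \<in> C"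
proof -
  define S where "S = (\<lambda>v. {a. (v, a) \<in> C})"
  have compS: "compact (S v)" for v
  proof -
    have "S v = snd ` (C \<inter> ({v} \<times> UNIV))" by (force simp: S_def)
    moreover have "compact (C \<inter> ({v} \<times> UNIV))" by (intro compact_Int_closed C closed_Times) auto
    ultimately show ?thesis by (simp add: compact_continuous_image continuous_on_snd)
  qed
  have neS: "S v \<noteq> {}" if "v \<in> {0..1}" for v
  proof -
    have "v \<in> fst ` C" using that C(2) by simp
    then show ?thesis by (force simp: S_def)
  qed
  define g where "g = (\<lambda>v. if v \<in> {0..1} then Inf (S v) else 0)"
  have gS: "g v \<in> S v" "\<And>a. a \<in> S v \<Longrightarrow> g v \<le> a" if "v \<in> {0..1}" for v
  proof -
    have bdd: "bdd_below (S v)" by (rule bounded_imp_bdd_below[OF compact_imp_bounded[OF compS]])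
    show "g v \<in> S v"
      using closed_contains_Inf[OF neS[OF that] bdd compact_imp_closed[OF compS]] that by (simp add: g_def)
    show "g v \<le> a" if "a \<in> S v" for a
      using cInf_lower[OF that bdd] \<open>v \<in> {0..1}\<close> by (simp add: g_def)
  qed
  have "g \<in> borel_measurable borel"
    unfolding borel_measurable_iff_le
  proof
    fix c
    have "compact (fst ` (C \<inter> {p. snd p \<le> c}))"
      by (intro compact_continuous_image compact_Int_closed C closed_Collect_le continuous_intros)
    then have "fst ` (C \<inter> {p. snd p \<le> c}) \<in> sets borel" by (simp add: compact_imp_closed)
    moreover have "{w \<in> space borel. g w \<le> c} = fst ` (C \<inter> {p. snd p \<le> c}) \<union> (if 0 \<le> c then - {0..1} else {})"
    proof (intro set_eqI)
      fix v
      show "v \<in> {w \<in> space borel. g w \<le> c} \<longleftrightarrow> v \<in> fst ` (C \<inter> {p. snd p \<le> c}) \<union> (if 0 \<le> c then - {0..1} else {})"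
      proof (cases "v \<in> {0..1}")
        case True
        have "g v \<le> c \<longleftrightarrow> (\<exists>a. (v, a) \<in> C \<and> a \<le> c)"
          using gS[OF True] by (auto simp: S_def intro: order_trans)
        also have "\<dots> \<longleftrightarrow> v \<in> fst ` (C \<inter> {p. snd p \<le> c})" by force
        finally show ?thesis using True by auto
      next
        case False
        moreover have "v \<notin> fst ` (C \<inter> {p. snd p \<le> c})" using False C(2) by blast
        moreover have "g v = 0" using False by (auto simp: g_def)
        ultimately show ?thesis by auto
      qed
    qed
    ultimately show "{w \<in> space borel. g w \<le> c} \<in> sets borel" by auto
  qed
  then show ?thesis using that[of g] gS(1) by (auto simp: S_def)
qed

lemma dyadic_scale:
  assumes d: "0 < d" "d \<le> (1/2 :: real) ^ k0"
  obtains k where "d \<le> (1/2) ^ (k + k0)" "(1/2) ^ (k + k0) < 2 * d"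
proof -
  define P where "P = (\<lambda>n. (1/2 :: real) ^ n < d)"
  obtain n0 where "P n0" using real_arch_pow_inv[of d "1/2"] d by (auto simp: P_def)
  define n where "n = (LEAST n. P n)"
  have n: "P n" unfolding n_def using \<open>P n0\<close> by (rule LeastI)
  have "k0 < n"
  proof (rule ccontr)
    assume "\<not> k0 < n"
    then have "(1/2 :: real) ^ k0 \<le> (1/2) ^ n" by (intro power_decreasing) auto
    moreover have "(1/2 :: real) ^ n < d" using n by (simp only: P_def)
    ultimately show False using d by linarith
  qed
  then obtain k where k: "n = Suc (k + k0)" by (metis add.commute less_iff_Suc_add)
  have "\<not> P (k + k0)" unfolding n_def using not_less_Least[of "k + k0" P] k by (simp add: n_def)
  then show ?thesis using that[of k] n k by (simp add: P_def)
qed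

text \<open>Mass distribution principle for the image of the cube under
  \<open>(v, t) \<mapsto> (g v + t v, t)\<close>: outside a set of parameters of measure \<open>1/2\<close>, a ball of radius \<open>2^-k\<close>
  around an image point has mass at most of order \<open>2^(-k s)\<close>.\<close>

lemma hausdorff_measure_K0_nonzero:
  fixes C :: "(real \<times> real) set"
  assumes C: "compact C" "fst ` C = {0..1}" and s: "0 \<le> s" "s < real CARD('m::finite option)"
  shows "hausdorff_measure s (K0 C :: (real^('m option)) set) \<noteq> 0"
proof
  assume null: "hausdorff_measure s (K0 C :: (real^('m option)) set) = 0"
  obtain g where g [measurable]: "g \<in> borel_measurable borel" and gC: "\<And>v. v \<in> {0..1} \<Longrightarrow> (v, g v) \<in> C"
    using borel_selection[OF C] by blast
  define m where "m = CARD('m)"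
  have m: "m > 0" "real CARD('m option) = real m + 1" by (simp_all add: m_def card_UNIV_option)
  \<comment> \<open>Solves \<open>1 + m (1 - e) = s\<close>, so that a ball of radius
    \<open>q\<close> gets mass of order \<open>q powr s\<close>; positivity of \<open>e\<close> is
    exactly \<open>s < m + 1\<close>.\<close>
  define e where "e = (real m + 1 - s) / real m"
  have e: "e > 0" "1 + real m * (1 - e) = s" using s m by (auto simp: e_def field_simps)
  define x :: real where "x = 2 powr (- e)"
  have x: "0 < x" "x < 1" using e by (auto simp: x_def powr_less_one)
  define \<tau> where "\<tau> = (\<lambda>k::nat. 2 powr (- real k * (1 - e)))"
  have \<tau>: "\<tau> k > 0" for k by (simp add: \<tau>_def)
  define a where "a = (\<lambda>k. 16 * (real (Suc k) * x ^ k))"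
  have ratio: "16 * real (Suc k) * (1/2) ^ k / \<tau> k = a k" for k
  proof -
    have "(1/2 :: real) ^ k = 2 powr (- real k)" by (simp add: powr_minus powr_realpow power_one_over inverse_eq_divide)
    moreover have "x ^ k = 2 powr (- real k) / \<tau> k"
      by (simp add: x_def \<tau>_def powr_diff[symmetric] powr_power algebra_simps)
    ultimately show ?thesis by (simp add: a_def)
  qed
  have a_nonneg: "a k \<ge> 0" for k using x by (simp add: a_def)
  have "summable a"
    unfolding a_def using x geometric_deriv_sums[of x] by (intro summable_mult) (auto simp: sums_iff)
  from suminf_exist_split2[OF this] have "(\<lambda>i. \<Sum>k. a (k + i)) \<longlonglongrightarrow> 0" .
  then have "eventually (\<lambda>i. (\<Sum>k. a (k + i)) < 1 / (2 * real m)) sequentially"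
    using m by (intro order_tendstoD) auto
  then obtain k0 where k0: "(\<Sum>k. a (k + k0)) < 1 / (2 * real m)"
    by (auto simp: eventually_sequentially)
  let ?M = "Pi\<^sub>M (UNIV :: 'm option set) (\<lambda>_. unit_lebesgue)"
  define D where "D = (\<lambda>k. {(t, w). ennreal (\<tau> k) < near_mass g k t w})"
  have D_borel: "D k \<in> sets borel" for k unfolding D_def by (rule near_mass_large_borel[OF g \<tau>])
  define bad where "bad = (\<lambda>i k. {f \<in> space ?M. (f None, f (Some i)) \<in> D (k + k0)})"
  have bad_sets: "bad i k \<in> sets ?M" for i k
  proof -
    have "(\<lambda>f. (f None, f (Some i))) \<in> ?M \<rightarrow>\<^sub>M borel \<Otimes>\<^sub>M borel" by measurable
    then have "(\<lambda>f. (f None, f (Some i))) \<in> ?M \<rightarrow>\<^sub>M borel" by (simp only: borel_prod)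
    from measurable_sets[OF this D_borel] show ?thesis
      by (simp add: bad_def vimage_def Int_def conj_commute)
  qed
  have bad_le: "emeasure ?M (bad i k) \<le> ennreal (a (k + k0))" for i k
  proof -
    have "emeasure ?M (bad i k) = emeasure (unit_lebesgue \<Otimes>\<^sub>M unit_lebesgue) (D (k + k0))"
      unfolding bad_def by (rule PiM_two_coordinates) (use D_borel in auto)
    also have "\<dots> \<le> ennreal (16 * real (Suc (k + k0)) * (1/2) ^ (k + k0) / \<tau> (k + k0))"
      unfolding D_def by (rule near_mass_large_measure[OF g \<tau>])
    finally show ?thesis by (simp only: ratio)
  qed
  define Bad where "Bad = (\<Union>i. \<Union>k. bad i k)"
  have Bad_sets: "Bad \<in> sets ?M" unfolding Bad_def using bad_sets by (intro sets.finite_UN sets.countable_UN) auto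
  have Bad_le: "emeasure ?M Bad \<le> ennreal (1/2)"
  proof -
    have "emeasure ?M Bad \<le> (\<Sum>i\<in>UNIV. emeasure ?M (\<Union>k. bad i k))"
      unfolding Bad_def using bad_sets by (intro emeasure_subadditive_finite) auto
    also have "\<dots> \<le> (\<Sum>i\<in>(UNIV :: 'm set). ennreal (1 / (2 * real m)))"
    proof (rule sum_mono)
      fix i
      have "emeasure ?M (\<Union>k. bad i k) \<le> (\<Sum>k. emeasure ?M (bad i k))"
        using bad_sets by (intro emeasure_subadditive_countably) auto
      also have "\<dots> \<le> (\<Sum>k. ennreal (a (k + k0)))" by (intro suminf_le bad_le) auto
      also have "\<dots> = ennreal (\<Sum>k. a (k + k0))"
        by (intro suminf_ennreal2 summable_ignore_initial_segment \<open>summable a\<close> a_nonneg)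
      also have "\<dots> \<le> ennreal (1 / (2 * real m))" using k0 by (intro ennreal_leI) auto
      finally show "emeasure ?M (\<Union>k. bad i k) \<le> ennreal (1 / (2 * real m))" .
    qed
    also have "\<dots> = ennreal (real m * (1 / (2 * real m)))"
    proof -
      have "(\<Sum>i\<in>(UNIV :: 'm set). ennreal (1 / (2 * real m))) = of_nat m * ennreal (1 / (2 * real m))"
        by (simp add: m_def)
      also have "\<dots> = ennreal (real m * (1 / (2 * real m)))"
        unfolding ennreal_of_nat_eq_real_of_nat by (rule ennreal_mult[symmetric]) auto
      finally show ?thesis .
    qed
    also have "\<dots> = ennreal (1/2)" using m by simp
    finally show ?thesis .
  qed
  define All where "All = PiE (UNIV :: 'm option set) (\<lambda>_. {0..1::real})"
  have All_sets: "All \<in> sets ?M" unfolding All_def by (rule sets_PiM_I_finite) auto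
  have All_1: "emeasure ?M All = 1"
    unfolding All_def by (subst unit_lebesgue_prod.emeasure_PiM) (auto simp: emeasure_unit_lebesgue)
  define F :: "('m option \<Rightarrow> real) \<Rightarrow> real^('m option)" where
    "F = (\<lambda>f. \<chi> j. case j of None \<Rightarrow> f None | Some i \<Rightarrow> g (f (Some i)) + f None * f (Some i))"
  have FK: "F f \<in> K0 C" if "f \<in> All" for f
  proof -
    have "f j \<in> {0..1}" for j using that by (auto simp: All_def)
    then show ?thesis
      unfolding K0_iff by (auto simp: F_def proj_def intro!: image_eqI[OF _ gC])
  qed
  \<comment> \<open>Makes \<open>2 powr (1 + s) * c\<close> equal to 1/4, so that bad and covered
    parameters together have mass at most 3/4.\<close>
  define c :: real where "c = 2 powr (- 3 - s)"
  have "hausdorff_content s ((1/2) ^ k0) (K0 C :: (real^('m option)) set) \<le> 0"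
    using hausdorff_content_le_measure[of "(1/2) ^ k0" s "K0 C :: (real^('m option)) set"] null by simp
  then have "hausdorff_content s ((1/2) ^ k0) (K0 C :: (real^('m option)) set) < ennreal c"
    by (simp add: c_def)
  then obtain U where U: "(K0 C :: (real^('m option)) set) \<subseteq> (\<Union>i. U i)" "\<And>i::nat. bounded (U i)"
    "\<And>i. diameter (U i) \<le> (1/2) ^ k0" "(\<Sum>i. ennreal (diameter (U i) powr s)) < ennreal c"
    by (rule hausdorff_content_cover) blast
  \<comment> \<open>Covering sets are arbitrary, so their preimages are enclosed in measurable
    boxes.\<close>
  have "\<exists>V\<in>sets ?M. (All - Bad) \<inter> F -` U n \<subseteq> V \<and> emeasure ?M V \<le> ennreal (2 powr (1 + s)) * ennreal (diameter (U n) powr s)" for n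
  proof (cases "(All - Bad) \<inter> F -` U n = {}")
    case True
    then show ?thesis by (intro bexI[of _ "{}"]) auto
  next
    case False
    then obtain f0 where f0: "f0 \<in> All" "f0 \<notin> Bad" "F f0 \<in> U n" by blast
    have f01: "f j \<in> {0..1}" if "f \<in> All" for f j using that by (auto simp: All_def)
    have close: "\<bar>F f $ j - F f0 $ j\<bar> \<le> diameter (U n)" if "F f \<in> U n" for f j
      using dist_vec_nth_le[of "F f" j "F f0"] diameter_bounded_bound[OF U(2) that f0(3)]
      by (simp add: dist_real_def)
    show ?thesis
    \<comment> \<open>No dyadic scale matches diameter 0, and the bound required is 0; fixing the
      height alone already gives a null set.\<close>
    proof (cases "diameter (U n) = 0")
      case True
      define V where "V = PiE (UNIV :: 'm option set) (\<lambda>j. case j of None \<Rightarrow> {f0 None} | Some _ \<Rightarrow> UNIV)"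
      have V_sets: "V \<in> sets ?M" unfolding V_def by (rule sets_PiM_I_finite) (auto split: option.split)
      have "f None = f0 None" if "F f \<in> U n" for f
        using close[OF that, of None] True by (simp add: F_def)
      then have "(All - Bad) \<inter> F -` U n \<subseteq> V" by (auto simp: V_def PiE_UNIV_domain split: option.split)
      moreover have "emeasure ?M V = 0"
      proof -
        have z: "emeasure unit_lebesgue {f0 None} = 0"
          using emeasure_unit_lebesgue_le[of "{f0 None}"] by simp
        have "emeasure ?M V = (\<Prod>j\<in>(UNIV :: 'm option set). emeasure unit_lebesgue (case j of None \<Rightarrow> {f0 None} | Some _ \<Rightarrow> UNIV))"
          unfolding V_def by (subst unit_lebesgue_prod.emeasure_PiM) (auto split: option.split)
        also have "\<dots> = 0" by (rule prod_zero, simp, rule bexI[of _ None]) (simp_all add: z)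
        finally show ?thesis .
      qed
      ultimately show ?thesis using V_sets by (intro bexI[of _ V]) auto
    next
      case False
      then have dpos: "0 < diameter (U n)" using diameter_ge_0[OF U(2)[of n]] by simp
      obtain k where k: "diameter (U n) \<le> (1/2) ^ (k + k0)" "(1/2) ^ (k + k0) < 2 * diameter (U n)"
        using dyadic_scale[OF dpos U(3)] by blast
      define K where "K = k + k0"
      define q :: real where "q = (1/2) ^ K"
      have q: "0 < q" "diameter (U n) \<le> q" "q < 2 * diameter (U n)" using k by (auto simp: q_def K_def)
      define t where "t = f0 None"
      \<comment> \<open>A box around \<open>f0\<close>: heights within \<open>q\<close>, and in each
        slope coordinate the near set taken at the fixed height \<open>t\<close>, so that its
        measure is a product.\<close>
      define W where "W = (\<lambda>j. case j of None \<Rightarrow> cball t q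
         | Some l \<Rightarrow> {w'. \<bar>(g w' - g (f0 (Some l))) + t * (w' - f0 (Some l))\<bar> \<le> 2 * (1/2) ^ K})"
      have W_sets: "W j \<in> sets borel" for j
        unfolding W_def using near_set_borel[OF g] by (auto split: option.split)
      define V where "V = PiE (UNIV :: 'm option set) W"
      have V_sets: "V \<in> sets ?M" unfolding V_def using W_sets by (intro sets_PiM_I_finite) auto
      have "(All - Bad) \<inter> F -` U n \<subseteq> V"
      proof
        fix f assume f: "f \<in> (All - Bad) \<inter> F -` U n"
        then have fU: "F f \<in> U n" and fA: "f \<in> All" by auto
        have t': "\<bar>f None - t\<bar> \<le> q" using close[OF fU, of None] q by (simp add: F_def t_def)
        have "f j \<in> W j" for j
        proof (cases j)
          case None
          then show ?thesis using t' by (simp add: W_def dist_real_def abs_minus_commute)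
        next
          case (Some l)
          define w w' where "w = f0 (Some l)" and "w' = f (Some l)"
          have A: "\<bar>g w' + f None * w' - (g w + t * w)\<bar> \<le> q"
            using close[OF fU, of "Some l"] q by (simp add: F_def t_def w_def w'_def)
          have "\<bar>(t - f None) * w'\<bar> \<le> q * 1"
            unfolding abs_mult using t' f01[OF fA, of "Some l"] q by (intro mult_mono) (auto simp: w'_def)
          \<comment> \<open>Replacing the height of \<open>f\<close> by \<open>t\<close> costs at
            most \<open>q\<close> because slopes are at most 1; this uses up the factor 2 in
            \<open>near_mass\<close>.\<close>
          moreover have "(g w' - g w) + t * (w' - w) = (g w' + f None * w' - (g w + t * w)) + (t - f None) * w'"
            by (simp add: algebra_simps)
          ultimately have "\<bar>(g w' - g w) + t * (w' - w)\<bar> \<le> q + q" using A by linarith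
          then show ?thesis using Some by (simp add: W_def w_def w'_def q_def)
        qed
        then show "f \<in> V" by (simp add: V_def PiE_UNIV_domain)
      qed
      moreover have "emeasure ?M V \<le> ennreal (2 powr (1 + s)) * ennreal (diameter (U n) powr s)"
      proof -
        have nm: "near_mass g K t (f0 (Some l)) \<le> ennreal (\<tau> K)" for l
        proof -
          have "f0 \<notin> bad l k" using f0(2) by (auto simp: Bad_def)
          moreover have "f0 \<in> space ?M" using sets.sets_into_space[OF All_sets] f0(1) by blast
          ultimately show ?thesis by (auto simp: bad_def D_def K_def t_def not_less)
        qed
        have "emeasure ?M V = (\<Prod>j\<in>UNIV. emeasure unit_lebesgue (W j))"
          unfolding V_def using W_sets by (intro unit_lebesgue_prod.emeasure_PiM) auto
        also have "\<dots> = emeasure unit_lebesgue (cball t q) * (\<Prod>l\<in>UNIV. near_mass g K t (f0 (Some l)))"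
          unfolding UNIV_option_conv
          by (subst prod.insert) (auto simp: prod.reindex W_def near_mass_def)
        also have "\<dots> \<le> ennreal (2 * q) * (\<Prod>l\<in>(UNIV :: 'm set). ennreal (\<tau> K))"
        proof (intro mult_mono prod_mono_ennreal nm)
          have "emeasure unit_lebesgue (cball t q) \<le> emeasure lborel (cball t q)"
            by (rule emeasure_unit_lebesgue_le) simp
          then show "emeasure unit_lebesgue (cball t q) \<le> ennreal (2 * q)"
            using q by (simp add: cball_eq_atLeastAtMost)
        qed auto
        also have "\<dots> = ennreal (2 * (q * \<tau> K ^ m))"
          using q \<tau>[of K] by (simp add: m_def ennreal_power ennreal_mult[symmetric] mult.assoc)
        also have "\<dots> \<le> ennreal (2 powr (1 + s) * diameter (U n) powr s)"
        proof (rule ennreal_leI)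
          have q2: "q = 2 powr (- real K)"
            by (simp add: q_def powr_minus powr_realpow power_one_over inverse_eq_divide)
          have "\<tau> K ^ m = 2 powr (- real K * (1 - e) * real m)" by (simp add: \<tau>_def powr_power mult_ac)
          then have "q * \<tau> K ^ m = 2 powr (- real K * (1 + real m * (1 - e)))"
            by (simp add: q2 powr_add[symmetric] algebra_simps)
          also have "\<dots> = q powr s" by (simp add: e(2) q2 powr_powr)
          also have "\<dots> \<le> (2 * diameter (U n)) powr s" using q s by (intro powr_mono2) auto
          also have "\<dots> = 2 powr s * diameter (U n) powr s" using dpos by (simp add: powr_mult)
          finally show "2 * (q * \<tau> K ^ m) \<le> 2 powr (1 + s) * diameter (U n) powr s"
            by (simp add: powr_add)
        qed
        also have "\<dots> = ennreal (2 powr (1 + s)) * ennreal (diameter (U n) powr s)" by (rule ennreal_mult) auto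
        finally show ?thesis .
      qed
      ultimately show ?thesis using V_sets by blast
    qed
  qed
  then obtain V where V: "\<And>n. V n \<in> sets ?M" "\<And>n. (All - Bad) \<inter> F -` U n \<subseteq> V n"
    "\<And>n. emeasure ?M (V n) \<le> ennreal (2 powr (1 + s)) * ennreal (diameter (U n) powr s)"
    by metis
  have "All \<subseteq> Bad \<union> (\<Union>n. V n)"
  proof
    fix f assume f: "f \<in> All"
    show "f \<in> Bad \<union> (\<Union>n. V n)"
    proof (cases "f \<in> Bad")
      case False
      obtain n where "F f \<in> U n" using FK[OF f] U(1) by blast
      then have "f \<in> V n" using V(2)[of n] f False by blast
      then show ?thesis by blast
    qed simp
  qed
  then have "1 \<le> emeasure ?M (Bad \<union> (\<Union>n. V n))"
    unfolding All_1[symmetric] using Bad_sets V(1) by (intro emeasure_mono) auto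
  also have "\<dots> \<le> emeasure ?M Bad + emeasure ?M (\<Union>n. V n)"
    using Bad_sets V(1) by (intro emeasure_subadditive) auto
  also have "emeasure ?M (\<Union>n. V n) \<le> (\<Sum>n. emeasure ?M (V n))"
    using V(1) by (intro emeasure_subadditive_countably) auto
  also have "\<dots> \<le> (\<Sum>n. ennreal (2 powr (1 + s)) * ennreal (diameter (U n) powr s))"
    by (intro suminf_le V(3)) auto
  also have "\<dots> = ennreal (2 powr (1 + s)) * (\<Sum>n. ennreal (diameter (U n) powr s))" by simp
  also have "\<dots> \<le> ennreal (2 powr (1 + s)) * ennreal c" using U(4) by (intro mult_left_mono) auto
  also have "\<dots> = ennreal (1/4)"
  proof -
    have "2 powr (1 + s) * c = 2 powr (- 2)" by (simp add: c_def powr_add[symmetric])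
    also have "\<dots> = 1/4" by (simp add: powr_minus_divide)
    finally show ?thesis by (simp add: ennreal_mult[symmetric] c_def)
  qed
  also have "emeasure ?M Bad + ennreal (1/4) \<le> ennreal (1/2) + ennreal (1/4)" by (intro add_right_mono Bad_le)
  also have "\<dots> = ennreal (1/2 + 1/4)" by (rule ennreal_plus[symmetric]) auto
  also have "(1/2 + 1/4 :: real) = 3/4" by simp
  finally have "ennreal 1 \<le> ennreal (3/4)" by (simp add: add_left_mono)
  then show False by simp
qed

section \<open>Conclusion\<close>

lemma negligible_linear_image:
  fixes f :: "'a::euclidean_space \<Rightarrow> 'a"
  assumes "linear f" "negligible S"
  shows "negligible (f ` S)"
  by (rule negligible_differentiable_image_negligible)
     (use assms in \<open>auto intro: linear_imp_differentiable_on\<close>)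

lemma negligible_proj_pm:
  assumes C: "compact C" and null: "emeasure lebesgue (proj_plus ` C) = 0" "emeasure lebesgue (proj_minus ` C) = 0"
  shows "negligible ((\<lambda>p. fst p + snd p) ` C)" "negligible ((\<lambda>p. fst p - snd p) ` C)"
proof -
  have cp: "compact (proj_plus ` C)" "compact (proj_minus ` C)"
    unfolding proj_plus_def proj_minus_def
    by (intro compact_continuous_image C continuous_intros; simp)+
  then have "negligible (proj_plus ` C)" "negligible (proj_minus ` C)"
    using null by (auto simp: negligible_iff_null_sets null_sets_def compact_imp_closed)
  then have "negligible ((\<lambda>x. sqrt 2 *\<^sub>R x) ` proj_plus ` C)" "negligible ((\<lambda>x. sqrt 2 *\<^sub>R x) ` proj_minus ` C)"
    by (auto intro!: negligible_linear_image linear_scaleR)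
  then show "negligible ((\<lambda>p. fst p + snd p) ` C)" "negligible ((\<lambda>p. fst p - snd p) ` C)"
    by (simp_all add: image_image proj_plus_def proj_minus_def)
qed

theorem theorem4p3:
  fixes n :: "nat \<Rightarrow> nat" and Cs :: "nat \<Rightarrow> (nat \<times> nat) set"
  assumes constr: "cantor_construction n Cs"
    and n_ge: "\<forall>k\<ge>1. n (2*k-1) \<ge> n (2*k)"
    and H1_pos: "0 < hausdorff_measure 1 (cantor_set n Cs)"
    and H1_fin: "hausdorff_measure 1 (cantor_set n Cs) < \<infinity>"
    and pdim: "packing_dim (cantor_set n Cs) > 1"
    and proj_p: "emeasure lebesgue (proj_plus ` cantor_set n Cs) = 0"
    and proj_m: "emeasure lebesgue (proj_minus ` cantor_set n Cs) = 0"
  shows "\<exists>R :: ((real^('m::finite option)) \<Rightarrow> real^('m option)) set.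
           finite R \<and> (\<forall>\<rho>\<in>R. rotation \<rho>) \<and>
           (let K = (\<Union>\<rho>\<in>R. \<rho> ` K0 (cantor_set n Cs)) in
              kakeya_set K \<and> non_sticky K \<and> emeasure lebesgue K = 0 \<and>
              hausdorff_dim K = real CARD('m option))"
proof -
  define C where "C = cantor_set n Cs"
  have C: "compact C" "fst ` C = {0..1}"
    unfolding C_def by (rule compact_cantor_set[OF constr], rule fst_cantor_set[OF constr])
  interpret besicovitch C
    by unfold_locales (use C H1_fin in \<open>auto simp: C_def\<close>)
  have null: "negligible {t \<in> {0..1}. \<not> negligible (proj t ` C)}"
    using proj_p proj_m C by (intro negligible_projections negligible_proj_pm) (auto simp: C_def)
  obtain R :: "((real^('m option)) \<Rightarrow> real^('m option)) set" where R: "finite R" "id \<in> R" "\<And>\<rho>. \<rho> \<in> R \<Longrightarrow> rotation \<rho>"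
    "\<And>e. norm e = 1 \<Longrightarrow> \<exists>\<rho>\<in>R. \<exists>c v. 0 < c \<and> c \<le> 1 \<and> (\<forall>i. v $ i \<in> {0..1}) \<and> e = \<rho> (c *\<^sub>R lift_pt v 1)"
    by (rule finite_rotation_cover[where 'm = 'm]) (rule that)
  define K where "K = (\<Union>\<rho>\<in>R. \<rho> ` K0 C)"
  have K0K: "K0 C \<subseteq> K"
  proof
    fix x :: "real^('m option)" assume "x \<in> K0 C"
    then have "x \<in> id ` K0 C" by simp
    then show "x \<in> K" using R(2) unfolding K_def by blast
  qed
  have kak: "kakeya_set K"
    unfolding K_def by (rule kakeya_rotated_K0[OF C R(1,3,4)])
  have "non_sticky K"
    unfolding non_sticky_def using pdim by (intro packing_dim_product[OF C A_set_K0[OF K0K]]) (simp add: C_def)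
  moreover have "emeasure lebesgue K = 0"
  proof -
    have "negligible (K0 C :: (real^('m option)) set)"
      using K0_null[OF C(1) null, where ?'m = 'm] compact_K0[OF C(1), where ?'m = 'm]
      by (auto simp: negligible_iff_null_sets null_sets_def compact_imp_closed)
    then have "negligible (\<rho> ` K0 C)" if "\<rho> \<in> R" for \<rho> :: "real^('m option) \<Rightarrow> real^('m option)"
      using R(3)[OF that] by (intro negligible_linear_image) (simp_all add: rotation_def orthogonal_transformation_linear)
    then have "negligible K" unfolding K_def using R(1) by (intro negligible_Union) auto
    then show ?thesis by (simp add: negligible_iff_null_sets null_sets_def)
  qed
  moreover have "hausdorff_dim K = real CARD('m option)"
  proof -
    have "hausdorff_measure s K \<noteq> 0" if "0 \<le> s" "s < real DIM(real^('m option))" for s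
      \<comment> \<open>The lower bound for the unrotated copy suffices by monotonicity; the upper
        bound is the ambient dimension.\<close>
      using hausdorff_measure_K0_nonzero[OF C, of s, where ?'m = 'm] hausdorff_measure_mono[OF K0K, of s] that
      by auto
    then have "hausdorff_dim K = real DIM(real^('m option))"
      using kak by (intro hausdorff_dim_eqI) (auto simp: kakeya_set_def compact_imp_bounded)
    then show ?thesis by simp
  qed
  ultimately show ?thesis
    using R(1,3) kak by (intro exI[of _ R]) (simp add: K_def C_def Let_def)
qed

end
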